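(* Let $g\in L^1(\mathbb{R}^4,\mathbb{Q})$ and suppose $\{(x,y)\in\mathbb{R}^4: g(x,y)\neq 0\}\subseteq A$, where $A\subseteq\mathbb{R}^4$ is of the form $A=A^{(1,3)}\times A^{(2,4)}$ and $A^{(1,3)}$, $A^{(2,4)}$ have finite $2$-dimensional Lebesgue measure. If $W(g)$ has finite rank, then $g=0$.
   Context: $\mathbb{Q}$ is the algebra of Hamilton quaternions with imaginary units $i,j,k$ ($i^2=j^2=k^2=ijk=-1$), and $L^r(\mathbb{R}^n,\mathbb{Q})$ is the space of $\mathbb{Q}$-valued measurable functions with $\|f\|_r=(\int|f|^r)^{1/r}<\infty$. Points of $\mathbb{R}^4$ are written $(x,y)=(x_1,x_2,y_1,y_2)$ with $x=(x_1,x_2)$, $y=(y_1,y_2)\in\mathbb{R}^2$. Writing $A=A^{(1,3)}\times A^{(2,4)}$ means that $(x_1,x_2,y_1,y_2)\in A$ if and only if $(x_1,y_1)\in A^{(1,3)}$ and $(x_2,y_2)\in A^{(2,4)}$, where $A^{(1,3)}=\{(x_1,y_1)\in\mathbb{R}^2:(x_1,x_2,y_1,y_2)\in A\}$ and $A^{(2,4)}=\{(x_2,y_2)\in\mathbb{R}^2:(x_1,x_2,y_1,y_2)\in A\}$ are the projections of $A$ to the $X_1Y_1$-plane and the $X_2Y_2$-plane. For $x,y\in\mathbb{R}^2$ the operator $\rho(x,y)$ on $L^2(\mathbb{R}^2,\mathbb{Q})$ is $$\rho(x,y)\varphi(\xi)=e^{2\pi i(x_1\xi_1+\frac12 x_1y_1)}\,\varphi(\xi+y)\,e^{2\pi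 j(x_2\xi_2+\frac12 x_2y_2)},$$ and the Weyl transform of $g$ is the operator on $L^2(\mathbb{R}^2,\mathbb{Q})$ $$W(g)=\int_{\mathbb{R}^2}\int_{\mathbb{R}^2} g(x,y)\,\rho(x,y)\,dx\,dy,$$ where $g(x,y)$ acts by left multiplication. Finite rank means that the range of $W(g)$ is finite dimensional. *)

theory Defs
  imports "HOL-Analysis.Analysis"
begin

section \<open>Hamilton quaternions\<close>

codatatype quat = Quat (qRe: real) (qIm1: real) (qIm2: real) (qIm3: real)

lemma quat_eq_iff:
  "x = y \<longleftrightarrow> qRe x = qRe y \<and> qIm1 x = qIm1 y \<and> qIm2 x = qIm2 y \<and> qIm3 x = qIm3 y"
  by (auto intro: quat.expand)

instantiation quat :: ab_group_add
begin

primcorec zero_quat where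
  "qRe 0 = 0"
| "qIm1 0 = 0"
| "qIm2 0 = 0"
| "qIm3 0 = 0"

primcorec plus_quat where
  "qRe (x + y) = qRe x + qRe y"
| "qIm1 (x + y) = qIm1 x + qIm1 y"
| "qIm2 (x + y) = qIm2 x + qIm2 y"
| "qIm3 (x + y) = qIm3 x + qIm3 y"

primcorec uminus_quat where
  "qRe (- x) = - qRe x"
| "qIm1 (- x) = - qIm1 x"
| "qIm2 (- x) = - qIm2 x"
| "qIm3 (- x) = - qIm3 x"

primcorec minus_quat where
  "qRe (x - y) = qRe x - qRe y"
| "qIm1 (x - y) = qIm1 x - qIm1 y"
| "qIm2 (x - y) = qIm2 x - qIm2 y"
| "qIm3 (x - y) = qIm3 x - qIm3 y"

instance
  by standard (simp_all add: quat_eq_iff)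

end

instantiation quat :: real_algebra_1
begin

primcorec scaleR_quat where
  "qRe (scaleR r x) = r * qRe x"
| "qIm1 (scaleR r x) = r * qIm1 x"
| "qIm2 (scaleR r x) = r * qIm2 x"
| "qIm3 (scaleR r x) = r * qIm3 x"

primcorec one_quat where
  "qRe 1 = 1"
| "qIm1 1 = 0"
| "qIm2 1 = 0"
| "qIm3 1 = 0"

primcorec times_quat where
  "qRe (x * y) = qRe x * qRe y - qIm1 x * qIm1 y - qIm2 x * qIm2 y - qIm3 x * qIm3 y"
| "qIm1 (x * y) = qRe x * qIm1 y + qIm1 x * qRe y + qIm2 x * qIm3 y - qIm3 x * qIm2 y"
| "qIm2 (x * y) = qRe x * qIm2 y - qIm1 x * qIm3 y + qIm2 x * qRe y + qIm3 x * qIm1 y"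
| "qIm3 (x * y) = qRe x * qIm3 y + qIm1 x * qIm2 y - qIm2 x * qIm1 y + qIm3 x * qRe y"

instance
  by standard (simp_all add: quat_eq_iff algebra_simps)

end

definition quat_i :: quat where "quat_i = Quat 0 1 0 0"
definition quat_j :: quat where "quat_j = Quat 0 0 1 0"
definition quat_k :: quat where "quat_k = Quat 0 0 0 1"

lemma quat_unit_sel [simp]:
  "qRe quat_i = 0" "qIm1 quat_i = 1" "qIm2 quat_i = 0" "qIm3 quat_i = 0"
  "qRe quat_j = 0" "qIm1 quat_j = 0" "qIm2 quat_j = 1" "qIm3 quat_j = 0"
  "qRe quat_k = 0" "qIm1 quat_k = 0" "qIm2 quat_k = 0" "qIm3 quat_k = 1"
  by (simp_all add: quat_i_def quat_j_def quat_k_def)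

lemma quat_units:
  "quat_i * quat_i = - 1" "quat_j * quat_j = - 1" "quat_k * quat_k = - 1"
  "quat_i * quat_j * quat_k = - 1"
  by (simp_all add: quat_eq_iff)

instantiation quat :: real_inner
begin

definition inner_quat_def:
  "inner x y = qRe x * qRe y + qIm1 x * qIm1 y + qIm2 x * qIm2 y + qIm3 x * qIm3 y"

definition norm_quat_def: "norm x = sqrt (inner x x)" for x :: quat

definition sgn_quat_def: "sgn x = x /\<^sub>R norm (x::quat)"

definition dist_quat_def: "dist x y = norm (x - y :: quat)"

definition uniformity_quat_def [code del]:
  "(uniformity :: (quat \<times> quat) filter) = (INF e\<in>{0 <..}. principal {(x, y). dist x y < e})"

definition open_quat_def [code del]:
  "open (U :: quat set) \<longleftrightarrow> (\<forall>x\<in>U. eventually (\<lambda>(x', y). x' = x \<longrightarrow> y \<in> U) uniformity)"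

instance
proof
  fix r :: real and x y z :: quat and U :: "quat set"
  show "inner x y = inner y x"
    by (simp add: inner_quat_def mult.commute)
  show "inner (x + y) z = inner x z + inner y z"
    by (simp add: inner_quat_def algebra_simps)
  show "inner (scaleR r x) y = r * inner x y"
    by (simp add: inner_quat_def algebra_simps)
  show "0 \<le> inner x x"
    by (simp add: inner_quat_def)
  show "inner x x = 0 \<longleftrightarrow> x = 0"
    by (simp add: inner_quat_def quat_eq_iff add_nonneg_eq_0_iff)
qed (simp_all add: norm_quat_def sgn_quat_def dist_quat_def uniformity_quat_def open_quat_def)

end

lemma norm_quat_eq: "norm x = sqrt ((qRe x)\<^sup>2 + (qIm1 x)\<^sup>2 + (qIm2 x)\<^sup>2 + (qIm3 x)\<^sup>2)"
  by (simp add: norm_quat_def inner_quat_def power2_eq_square)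

instantiation quat :: real_normed_div_algebra
begin

primcorec inverse_quat where
  "qRe (inverse x) = qRe x / (norm x)\<^sup>2"
| "qIm1 (inverse x) = - qIm1 x / (norm x)\<^sup>2"
| "qIm2 (inverse x) = - qIm2 x / (norm x)\<^sup>2"
| "qIm3 (inverse x) = - qIm3 x / (norm x)\<^sup>2"

definition divide_quat_def: "x div y = x * inverse y" for x y :: quat

instance
proof
  fix x y :: quat
  have inv: "inverse x = (1 / (norm x)\<^sup>2) *\<^sub>R Quat (qRe x) (- qIm1 x) (- qIm2 x) (- qIm3 x)"
    by (simp add: quat_eq_iff)
  have conj:
    "Quat (qRe x) (- qIm1 x) (- qIm2 x) (- qIm3 x) * x = (norm x)\<^sup>2 *\<^sub>R 1"
    "x * Quat (qRe x) (- qIm1 x) (- qIm2 x) (- qIm3 x) = (norm x)\<^sup>2 *\<^sub>R 1"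
    by (simp_all add: quat_eq_iff norm_quat_eq power2_eq_square)
  show "inverse x * x = 1" if "x \<noteq> 0"
    using that unfolding inv by (simp add: conj)
  show "x * inverse x = 1" if "x \<noteq> 0"
    using that unfolding inv by (simp add: conj)
  show "x div y = x * inverse y"
    by (rule divide_quat_def)
  show "inverse (0::quat) = 0"
    by (simp add: quat_eq_iff)
  show "norm (x * y) = norm x * norm y"
    unfolding norm_quat_eq real_sqrt_mult[symmetric]
    by (rule arg_cong[where f = sqrt]) (simp add: power2_eq_square algebra_simps)
qed

end

instantiation quat :: euclidean_space
begin

definition Basis_quat_def: "Basis = {1, quat_i, quat_j, quat_k}"

instance
proof
  fix u v x :: quat
  show "(Basis :: quat set) \<noteq> {}" "finite (Basis :: quat set)"
    by (simp_all add: Basis_quat_def)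
  show "inner u v = (if u = v then 1 else 0)" if "u \<in> Basis" "v \<in> Basis"
    using that unfolding Basis_quat_def by (elim insertE emptyE) (simp_all add: inner_quat_def quat_eq_iff)
  show "(\<forall>u\<in>Basis. inner x u = 0) \<longleftrightarrow> x = 0"
    by (simp add: Basis_quat_def inner_quat_def quat_eq_iff[of x 0])
qed

end


section \<open>The Weyl transform\<close>

text \<open>
  Elements of \<open>L\<^sup>r\<close> are represented by functions; identity of elements is equality almost
  everywhere.
\<close>

definition Lspace :: "real \<Rightarrow> ('a::euclidean_space \<Rightarrow> quat) set" where
  "Lspace r = {f \<in> borel_measurable lebesgue. integrable lebesgue (\<lambda>x. norm (f x) powr r)}"

definition proj13 :: "((real^2) \<times> (real^2)) set \<Rightarrow> (real \<times> real) set" where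
  "proj13 A = (\<lambda>(x, y). (x $ 1, y $ 1)) ` A"

definition proj24 :: "((real^2) \<times> (real^2)) set \<Rightarrow> (real \<times> real) set" where
  "proj24 A = (\<lambda>(x, y). (x $ 2, y $ 2)) ` A"

definition rho :: "real^2 \<Rightarrow> real^2 \<Rightarrow> (real^2 \<Rightarrow> quat) \<Rightarrow> real^2 \<Rightarrow> quat" where
  "rho x y \<phi> \<xi> =
     exp ((2 * pi * (x $ 1 * \<xi> $ 1 + x $ 1 * y $ 1 / 2)) *\<^sub>R quat_i)
     * \<phi> (\<xi> + y)
     * exp ((2 * pi * (x $ 2 * \<xi> $ 2 + x $ 2 * y $ 2 / 2)) *\<^sub>R quat_j)"

text \<open>
  The operator-valued integral is evaluated pointwise. For \<open>g \<in> L\<^sup>1\<close> and \<open>\<phi> \<in> L\<^sup>2\<close> the integrand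
  is dominated in norm by \<open>norm (g (x, y)) * norm (\<phi> (\<xi> + y))\<close>, so by Young's inequality the
  integral converges absolutely for almost every \<open>\<xi>\<close> and the result is in \<open>L\<^sup>2\<close>. On the
  remaining null set of \<open>\<xi>\<close> the Bochner integral has the default value 0.
\<close>

definition weyl :: "((real^2) \<times> (real^2) \<Rightarrow> quat) \<Rightarrow> (real^2 \<Rightarrow> quat) \<Rightarrow> real^2 \<Rightarrow> quat" where
  "weyl g \<phi> \<xi> = (LINT (x, y)|lebesgue. g (x, y) * rho x y \<phi> \<xi>)"

text \<open>
  The range of \<open>T\<close>, as a set of elements of \<open>L\<^sup>2\<close>, lies in the span of finitely many elements
  of \<open>L\<^sup>2\<close>. Real scalars are used because \<open>g\<close> acts from the left and does not commute with left
  multiplication by quaternions. As the quaternions have real dimension 4, being contained in a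
  finite-dimensional space means the same over the reals, \<open>\<real> + \<real>i\<close>, \<open>\<real> + \<real>j\<close> or the quaternions.
\<close>

definition finite_rank :: "((real^2 \<Rightarrow> quat) \<Rightarrow> real^2 \<Rightarrow> quat) \<Rightarrow> bool" where
  "finite_rank T \<longleftrightarrow>
     (\<exists>B. finite B \<and> B \<subseteq> Lspace 2 \<and>
        (\<forall>\<phi>\<in>Lspace 2. \<exists>c :: (real^2 \<Rightarrow> quat) \<Rightarrow> real.
           AE \<xi> in lebesgue. T \<phi> \<xi> = (\<Sum>b\<in>B. c b *\<^sub>R b \<xi>)))"

end

theory Submission
  imports Defs
begin

text \<open>
  Right multiplication by \<open>j\<close> agrees with left multiplication by \<open>i\<close> on the line through \<open>i + j\<close>,
  so writing \<open>g = a + j b\<close> the operator \<open>W(g)\<close> splits into two complex Weyl transforms of finite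
  rank. Freezing the second coordinates leaves a function \<open>f\<close> on the plane with support of finite
  measure, for which the kernel \<open>K(\<xi>, \<eta>) = \<integral> f(x, \<eta> - \<xi>) exp(2\<pi>i x\<xi>) dx\<close> is a sum of \<open>N\<close> products
  \<open>u(\<xi>) v(\<eta>)\<close> of integrable functions.

  Taking Zak transforms of \<open>u\<close> and \<open>v\<close> and summing by Poisson turns this into a factorization of
  rank \<open>N\<close> whose entry at \<open>(a, b)\<close> is, for almost all \<open>a, b\<close>, a trigonometric polynomial in a
  common shift of \<open>a\<close> and \<open>b\<close>: only finitely many points of \<open>b - a + \<int>\<^sup>2\<close> lie in the support of \<open>f\<close>,
  and their heights are the exponents. If \<open>f \<noteq> 0\<close>, cut off at a height \<open>\<theta>\<close> above which the support
  has positive but small measure. A random choice then yields \<open>N + 1\<close> pairs such that \<open>b\<^sub>i - a\<^sub>i\<close> lies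
  in the part above \<open>\<theta>\<close> while no translate of \<open>b\<^sub>j - a\<^sub>i\<close>, \<open>i \<noteq> j\<close>, does. The determinant of the
  resulting matrix has a single term of top degree, so it does not vanish, contradicting rank \<open>N\<close>.
\<close>

section \<open>Determinants with dominant diagonal degrees\<close>

text \<open>The support of \<open>f\<close> has finite measure but may be unbounded, so its partial
  Fourier transforms need not be entire and no argument by analyticity is at hand. Sampling on a
  lattice restores finiteness: almost every translate of the integer lattice meets a set of finite
  measure in finitely many points, and a polynomial vanishing on the unit circle takes the place of
  analytic continuation. The heights of these points have no common bound, so single degrees cannot
  be prescribed. What can be prescribed is on which side of \<theta> a height lies, and as the
  height of \<open>b j - a i\<close> is a part from \<open>b j\<close> minus a part from
  \<open>a i\<close>, this comparison suffices for a determinant. Zak sums need integrable factors,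
  while the functions spanning the range are only known to be square integrable; two eliminations
  trade them for sections of the kernel. Freezing the second coordinates means a Fourier transform
  in the second position variable at fixed frequency and fixed difference, which uniqueness on the
  line undoes at the end.\<close>

lemma leibniz_sum_low_rank_eq_0:
  fixes U V :: "nat \<Rightarrow> nat \<Rightarrow> complex"
  assumes "N < M"
  shows "(\<Sum>p | p permutes {..<M}. of_int (sign p) * (\<Prod>i<M. \<Sum>k<N. U i k * V k (p i))) = 0"
proof -
  let ?P = "{p. p permutes {..<M}}"
  let ?K = "PiE {..<M} (\<lambda>_. {..<N})"
  have fin: "finite ?P" by (simp add: finite_permutations)
  have "(\<Sum>p\<in>?P. of_int (sign p) * (\<Prod>i<M. \<Sum>k<N. U i k * V k (p i))) =
        (\<Sum>p\<in>?P. \<Sum>\<kappa>\<in>?K. of_int (sign p) * (\<Prod>i<M. U i (\<kappa> i) * V (\<kappa> i) (p i)))"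
    by (subst prod_sum_PiE) (auto simp: sum_distrib_left)
  also have "\<dots> = (\<Sum>\<kappa>\<in>?K. \<Sum>p\<in>?P. of_int (sign p) * (\<Prod>i<M. U i (\<kappa> i) * V (\<kappa> i) (p i)))"
    by (rule sum.swap)
  also have "\<dots> = 0"
  proof (rule sum.neutral, rule ballI)
    \<comment> \<open>\<kappa> records which inner index each row uses. Having fewer values than
      rows it repeats one, and composing \<open>p\<close> with the transposition of those two rows
      flips the sign but not the product, so the inner sum equals its own negative.\<close>
    fix \<kappa> assume \<kappa>: "\<kappa> \<in> ?K"
    have "\<not> inj_on \<kappa> {..<M}"
    proof
      assume "inj_on \<kappa> {..<M}"
      moreover have "\<kappa> ` {..<M} \<subseteq> {..<N}" using \<kappa> by auto
      ultimately have "card {..<M} \<le> card {..<N}" by (metis card_inj_on_le finite_lessThan)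
      with assms show False by simp
    qed
    then obtain i i' where i: "i < M" "i' < M" "i \<noteq> i'" "\<kappa> i = \<kappa> i'"
      by (auto simp: inj_on_def)
    define t where "t = Transposition.transpose i i'"
    have tp: "t permutes {..<M}" unfolding t_def using i by (auto intro: permutes_swap_id)
    have kt: "\<kappa> (t x) = \<kappa> x" for x using i by (auto simp: t_def Transposition.transpose_def)
    have bij: "bij_betw (\<lambda>p. p \<circ> t) ?P ?P"
    proof (rule bij_betwI[where g = "\<lambda>p. p \<circ> t"])
      show "(\<lambda>p. p \<circ> t) \<in> ?P \<rightarrow> ?P" "(\<lambda>p. p \<circ> t) \<in> ?P \<rightarrow> ?P"
        using tp by (auto intro: permutes_compose)
    qed (auto simp: t_def comp_assoc)
    define S where "S = (\<Sum>p\<in>?P. of_int (sign p) * (\<Prod>i<M. U i (\<kappa> i) * V (\<kappa> i) (p i)))"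
    have "S = (\<Sum>p\<in>?P. of_int (sign (p \<circ> t)) * (\<Prod>i<M. U i (\<kappa> i) * V (\<kappa> i) ((p \<circ> t) i)))"
      unfolding S_def by (rule sum.reindex_bij_betw[OF bij, symmetric])
    also have "\<dots> = (\<Sum>p\<in>?P. - (of_int (sign p) * (\<Prod>i<M. U i (\<kappa> i) * V (\<kappa> i) (p i))))"
    proof (rule sum.cong)
      fix p assume p: "p \<in> ?P"
      have "permutation p" "permutation t" using p tp by (auto intro: permutes_imp_permutation)
      then have "sign (p \<circ> t) = - sign p"
        using i by (simp add: sign_compose t_def sign_swap_id)
      moreover have "(\<Prod>x<M. V (\<kappa> x) ((p \<circ> t) x)) = (\<Prod>x<M. V (\<kappa> (t x)) (p (t x)))"
        by (simp add: kt)
      moreover have "\<dots> = (\<Prod>x<M. V (\<kappa> x) (p x))"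
        using prod.permute[OF tp, of "\<lambda>x. V (\<kappa> x) (p x)"] by (simp add: comp_def)
      ultimately show "of_int (sign (p \<circ> t)) * (\<Prod>i<M. U i (\<kappa> i) * V (\<kappa> i) ((p \<circ> t) i)) =
        - (of_int (sign p) * (\<Prod>i<M. U i (\<kappa> i) * V (\<kappa> i) (p i)))"
        by (simp add: prod.distrib)
    qed simp
    also have "\<dots> = - S" by (simp add: S_def sum_negf)
    finally show "S = 0" by simp
  qed
  finally show ?thesis by simp
qed

text \<open>The degree matrix has the identity as its only maximal permutation, so the leading term of
  the determinant cannot cancel.\<close>

lemma rank_ge_if_diagonal_degrees_dominate:
  fixes p :: "nat \<Rightarrow> nat \<Rightarrow> complex poly" and r s :: "nat \<Rightarrow> real"
  assumes low_rank: "\<And>\<zeta>. norm \<zeta> = 1 \<Longrightarrow>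
      \<exists>U V. \<forall>i<M. \<forall>j<M. poly (p i j) \<zeta> = (\<Sum>k<N. U i k * V k j)"
    and diag: "\<And>i. i < M \<Longrightarrow> p i i \<noteq> 0 \<and> real (degree (p i i)) > r i + s i"
    and off: "\<And>i j. i < M \<Longrightarrow> j < M \<Longrightarrow> i \<noteq> j \<Longrightarrow> p i j \<noteq> 0 \<Longrightarrow> real (degree (p i j)) \<le> r i + s j"
  shows "M \<le> N"
proof (rule ccontr)
  assume "\<not> M \<le> N"
  then have NM: "N < M" by simp
  let ?P = "{q. q permutes {..<M}}"
  define d where "d i = degree (p i i)" for i
  define D where "D = (\<Sum>q\<in>?P. of_int (sign q) * (\<Prod>i<M. p i (q i)))"
  have fin: "finite ?P" by (simp add: finite_permutations)
  have zero: "poly D \<zeta> = 0" if \<zeta>: "norm \<zeta> = 1" for \<zeta>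
  proof -
    obtain U V where UV: "\<And>i j. i<M \<Longrightarrow> j<M \<Longrightarrow> poly (p i j) \<zeta> = (\<Sum>k<N. U i k * V k j)"
      using low_rank[OF \<zeta>] by metis
    have "poly D \<zeta> = (\<Sum>q\<in>?P. of_int (sign q) * (\<Prod>i<M. poly (p i (q i)) \<zeta>))"
      unfolding D_def by (simp add: poly_sum poly_prod)
    also have "\<dots> = (\<Sum>q\<in>?P. of_int (sign q) * (\<Prod>i<M. \<Sum>k<N. U i k * V k (q i)))"
    proof (intro sum.cong refl arg_cong2[where f="(*)"] prod.cong)
      fix q i assume "q \<in> ?P" "i \<in> {..<M}"
      then show "poly (p i (q i)) \<zeta> = (\<Sum>k<N. U i k * V k (q i))"
        using permutes_in_image[of q "{..<M}" i] by (auto simp: UV)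
    qed
    also have "\<dots> = 0" by (rule leibniz_sum_low_rank_eq_0[OF NM])
    finally show ?thesis .
  qed
  \<comment> \<open>\<open>D\<close> is the determinant taken over polynomials; it vanishes on the
    unit circle, which is infinite.\<close>
  have "D = 0"
  proof (rule ccontr)
    assume "D \<noteq> 0"
    then have "finite {\<zeta>. poly D \<zeta> = 0}" by (rule poly_roots_finite)
    moreover have "sphere 0 1 \<subseteq> {\<zeta>. poly D \<zeta> = 0}" using zero by auto
    ultimately have "finite (sphere (0::complex) 1)" by (rule finite_subset[rotated])
    moreover have "infinite (sphere (0::complex) 1)"
    proof
      assume "finite (sphere (0::complex) 1)"
      then have "sphere (0::complex) 1 = {} \<or> (\<exists>a. sphere (0::complex) 1 = {a})"
        using connected_finite_iff_sing[OF connected_sphere, of "0::complex" 1] by simp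
      moreover have "1 \<in> sphere (0::complex) 1" "-1 \<in> sphere (0::complex) 1" by simp_all
      ultimately have "(1::complex) = -1" by (metis empty_iff singletonD)
      then show False by simp
    qed
    ultimately show False by simp
  qed
  have other: "coeff (\<Prod>i<M. p i (q i)) (\<Sum>i<M. d i) = 0" if q: "q permutes {..<M}" "q \<noteq> id" for q
  proof (cases "\<exists>i<M. p i (q i) = 0")
    case True
    then have "(\<Prod>i<M. p i (q i)) = 0" by (intro prod_zero) auto
    then show ?thesis by (simp only: coeff_0)
  next
    case False
    have qi: "q i < M" if "i < M" for i using permutes_in_image[OF q(1), of i] that by auto
    let ?F = "{i. i < M \<and> q i \<noteq> i}"
    \<comment> \<open>\<open>e\<close> bounds the degree of the factor in row \<open>i\<close>.
      Since \<open>q\<close> permutes the indices, the summands \<open>s (q i)\<close> may be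
      redistributed as \<open>s i\<close>; the total is then that of \<open>e'\<close>, which
      \<open>diag\<close> compares row by row, strictly at each point moved by
      \<open>q\<close>.\<close>
    define e where "e i = (if q i = i then real (d i) else r i + s (q i))" for i
    define e' where "e' i = (if q i = i then real (d i) else r i + s i)" for i
    have "real (degree (\<Prod>i<M. p i (q i))) = (\<Sum>i<M. real (degree (p i (q i))))"
      using False by (subst degree_prod_sum_eq) auto
    also have "\<dots> \<le> (\<Sum>i<M. e i)"
      by (rule sum_mono) (use off False qi in \<open>auto simp: e_def d_def\<close>)
    also have "\<dots> = (\<Sum>i<M. (if q i = i then real (d i) - s i else r i) + s (q i))"
      by (rule sum.cong) (auto simp: e_def)
    also have "\<dots> = (\<Sum>i<M. (if q i = i then real (d i) - s i else r i)) + (\<Sum>i<M. s (q i))"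
      by (rule sum.distrib)
    also have "(\<Sum>i<M. s (q i)) = (\<Sum>i<M. s i)"
      using sum.permute[OF q(1), of s] by (simp add: comp_def)
    also have "(\<Sum>i<M. (if q i = i then real (d i) - s i else r i)) + (\<Sum>i<M. s i) = (\<Sum>i<M. e' i)"
      unfolding sum.distrib[symmetric] by (rule sum.cong) (auto simp: e'_def)
    also have "\<dots> < (\<Sum>i<M. real (d i))"
    proof (rule sum_strict_mono_ex1)
      show "\<forall>i\<in>{..<M}. e' i \<le> real (d i)" using diag by (auto simp: e'_def d_def less_imp_le)
      obtain i where "q i \<noteq> i" using q(2) by (auto simp: fun_eq_iff)
      moreover then have "i < M" using permutes_not_in[OF q(1), of i] by auto
      ultimately show "\<exists>i\<in>{..<M}. e' i < real (d i)"
        using diag by (intro bexI[of _ i]) (auto simp: e'_def d_def)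
    qed simp
    finally have "degree (\<Prod>i<M. p i (q i)) < (\<Sum>i<M. d i)" by (simp flip: of_nat_sum)
    then show ?thesis by (rule coeff_eq_0)
  qed
  have ci: "coeff (of_int k * P) n = of_int k * coeff P n" for k n and P :: "complex poly"
    by (simp add: of_int_poly)
  have "coeff D (\<Sum>i<M. d i) = (\<Sum>q\<in>?P. of_int (sign q) * coeff (\<Prod>i<M. p i (q i)) (\<Sum>i<M. d i))"
    by (simp add: D_def coeff_sum ci)
  also have "\<dots> = (\<Sum>q\<in>{id}. of_int (sign q) * coeff (\<Prod>i<M. p i (q i)) (\<Sum>i<M. d i))"
    by (rule sum.mono_neutral_right) (use fin other in \<open>auto simp: permutes_id\<close>)
  also have "\<dots> = (\<Prod>i<M. coeff (p i i) (d i))"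
    using lead_coeff_prod[of "\<lambda>i. p i i" "{..<M}"] diag degree_prod_sum_eq[of "{..<M}" "\<lambda>i. p i i"]
    by (simp add: d_def)
  also have "\<dots> \<noteq> 0" using diag by (simp add: d_def)
  finally show False using \<open>D = 0\<close> by simp
qed

section \<open>Fourier uniqueness on the circle\<close>

lemma cis_uminus_mult_cancel [simp]: "cis a * cis (- a) = 1" "cis (- a) * cis a = 1"
  by (simp_all add: cis_mult)

lemma measurable_cis [measurable]: "cis \<in> borel_measurable borel"
  by (intro borel_measurable_continuous_onI continuous_intros)

lemma integrable_mult_cis [simp]:
  fixes F :: "'a \<Rightarrow> complex"
  assumes "t \<in> borel_measurable M"
  shows "integrable M (\<lambda>x. F x * cis (t x)) \<longleftrightarrow> integrable M F"
proof
  assume *: "integrable M F"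
  have [measurable]: "F \<in> borel_measurable M" "t \<in> borel_measurable M" using * assms by auto
  have "(\<lambda>x. F x * cis (t x)) \<in> borel_measurable M" by measurable
  from * this show "integrable M (\<lambda>x. F x * cis (t x))"
    by (rule Bochner_Integration.integrable_bound) (simp add: norm_mult)
next
  assume *: "integrable M (\<lambda>x. F x * cis (t x))"
  have [measurable]: "(\<lambda>x. F x * cis (t x)) \<in> borel_measurable M" "t \<in> borel_measurable M" using * assms by auto
  have "(\<lambda>x. (F x * cis (t x)) * cis (- t x)) \<in> borel_measurable M" by measurable
  then have "F \<in> borel_measurable M" by (simp add: mult.assoc)
  from * this show "integrable M F"
    by (rule Bochner_Integration.integrable_bound) (simp add: norm_mult)
qed

section \<open>Translation invariance of Lebesgue measure\<close>

lemma lborel_distr_add_right: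
  fixes c :: "'a::euclidean_space"
  shows "distr lborel borel (\<lambda>x. x + c) = lborel"
  using lborel_distr_plus[of c] by (simp add: add.commute[of _ c])

lemma nn_integral_lborel_translate:
  fixes c :: "'a::euclidean_space"
  assumes [measurable]: "f \<in> borel_measurable borel"
  shows "(\<integral>\<^sup>+x. f (x + c) \<partial>lborel) = (\<integral>\<^sup>+x. f x \<partial>lborel)"
  by (subst (2) lborel_distr_add_right[of c, symmetric], subst nn_integral_distr) auto

lemma integrable_lborel_translate:
  fixes c :: "'a::euclidean_space" and f :: "'a \<Rightarrow> 'b::{banach, second_countable_topology}"
  assumes "integrable lborel f"
  shows "integrable lborel (\<lambda>x. f (x + c))"
proof -
  have "integrable (distr lborel borel (\<lambda>x. x + c)) f"
    using assms by (simp add: lborel_distr_add_right)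
  then show ?thesis by (rule integrable_distr[rotated]) simp
qed

lemma integral_lborel_translate:
  fixes c :: "'a::euclidean_space" and f :: "'a \<Rightarrow> 'b::{banach, second_countable_topology}"
  assumes [measurable]: "f \<in> borel_measurable borel"
  shows "(LINT x|lborel. f (x + c)) = (LINT x|lborel. f x)"
  by (subst (2) lborel_distr_add_right[of c, symmetric], subst integral_distr) auto

lemma AE_lborel_translate:
  fixes c :: "'a::euclidean_space"
  assumes "AE x in lborel. P x"
  shows "AE x in lborel. P (x + c)"
proof -
  have "AE x in distr lborel borel (\<lambda>x. x + c). P x"
    using assms by (subst lborel_distr_add_right)
  then show ?thesis by (rule AE_distrD[rotated]) simp
qed

text \<open>The sets over which \<open>v\<close> integrates to 0 form a Dynkin system as soon as the
  total integral is 0. The exhaustion \<open>C\<close> by generators supplies the total integral,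
  which the step to complements consumes.\<close>

lemma AE_eq_0_if_generator_integrals_eq_0:
  fixes v :: "'a::euclidean_space \<Rightarrow> 'b::{banach, second_countable_topology}"
  assumes v: "integrable lborel v"
    and stable: "Int_stable G" and gen: "sigma_sets UNIV G = sets borel"
    and C: "\<And>n::nat. C n \<in> G" "incseq C" "(\<Union>n. C n) = UNIV"
    and zero: "\<And>A. A \<in> G \<Longrightarrow> (LINT x:A|lborel. v x) = 0"
  shows "AE x in lborel. v x = 0"
proof (rule sigma_finite_measure.density_zero[OF sigma_finite_lborel v])
  have si: "set_integrable lborel A v" if "A \<in> sets borel" for A
    using that v unfolding set_integrable_def by (intro integrable_mult_indicator) auto
  have Csets: "C n \<in> sets borel" for n using C(1) gen by blast
  have "(\<lambda>n. LINT x:C n|lborel. v x) \<longlonglongrightarrow> (LINT x:(\<Union>n. C n)|lborel. v x)"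
    using C(2) Csets C(3) by (intro set_integral_cont_up si) auto
  then have tot: "(LINT x:UNIV|lborel. v x) = 0"
    using zero[OF C(1)] C(3) by (simp add: LIMSEQ_const_iff)
  fix A :: "'a set" assume "A \<in> sets lborel"
  then have "A \<in> sigma_sets UNIV G" using gen by simp
  from stable subset_UNIV[of G, folded Pow_UNIV] this show "(LINT x:A|lborel. v x) = 0"
  proof (induction A rule: sigma_sets_induct_disjoint)
    case (compl A)
    have A: "A \<in> sets borel" using compl gen by simp
    have "(LINT x:A \<union> (UNIV - A)|lborel. v x) = (LINT x:A|lborel. v x) + (LINT x:UNIV - A|lborel. v x)"
      using A by (intro set_integral_Un si) auto
    then show ?case using tot compl by simp
  next
    case (union A)
    have A: "A i \<in> sets borel" for i using union(2) gen by auto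
    have "(LINT x:(\<Union>i. A i)|lborel. v x) = (\<Sum>i. LINT x:A i|lborel. v x)"
      using union(1) A by (intro lebesgue_integral_countable_add si) (auto simp: disjoint_family_on_def)
    then show ?case using union by simp
  qed (use zero in \<open>auto simp: set_lebesgue_integral_def\<close>)
qed

lemma AE_eq_0_if_interval_integrals_eq_0:
  fixes v :: "real \<Rightarrow> 'b::{banach, second_countable_topology}"
  assumes v: "integrable lborel v"
    and zero: "\<And>a b. a \<le> b \<Longrightarrow> (LINT x:{a..b}|lborel. v x) = 0"
  shows "AE x in lborel. v x = 0"
proof (rule AE_eq_0_if_generator_integrals_eq_0[OF v])
  show "sigma_sets UNIV (range (\<lambda>(a, b). {a..b})) = sets (borel :: real measure)"
    by (simp add: borel_eq_atLeastAtMost)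
  show "Int_stable (range (\<lambda>(a, b). {a..b::real}))"
    by (auto simp: Int_stable_def)
  show "{- real n..real n} \<in> range (\<lambda>(a, b). {a..b::real})" for n by auto
  show "incseq (\<lambda>n. {- real n..real n})" by (auto simp: incseq_def)
  show "(\<Union>n. {- real n..real n}) = UNIV"
  proof (intro equalityI subsetI UNIV_I)
    fix x :: real
    obtain n :: nat where "\<bar>x\<bar> \<le> n" using real_arch_simple by blast
    then show "x \<in> (\<Union>n. {- real n..real n})" by (intro UN_I[of n]) auto
  qed
  show "(LINT x:A|lborel. v x) = 0" if "A \<in> range (\<lambda>(a, b). {a..b})" for A
  proof -
    obtain a b where "A = {a..b}" using \<open>A \<in> _\<close> by auto
    then show ?thesis using zero[of a b] by (cases "a \<le> b") (auto simp: set_lebesgue_integral_def)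
  qed
qed

text \<open>Vanishing of all Fourier coefficients, phrased on the whole line so that no periodicity
  is involved; support in the unit interval enters only in \<open>trig_null_AE_eq_0\<close>.\<close>

definition trig_null :: "(real \<Rightarrow> complex) \<Rightarrow> bool" where
  "trig_null H \<longleftrightarrow> integrable lborel H \<and> (\<forall>k::int. (LINT x|lborel. H x * cis (2 * pi * k * x)) = 0)"

text \<open>On the circle a real linear function is a combination of \<open>cis t\<close> and
  \<open>cis (- t)\<close>, so multiplying by it shifts the vanishing coefficients by one in either
  direction. \<open>H\<close> is arbitrary in the induction, so that products are absorbed one
  factor at a time.\<close>

lemma trig_null_mult_polynomial:
  assumes "real_polynomial_function p" "trig_null H"
  shows "trig_null (\<lambda>x. H x * of_real (p (cis (2 * pi * x))))"
  using assms
proof (induction arbitrary: H rule: real_polynomial_function.induct)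
  case (linear f)
  let ?a = "complex_of_real (f 1)" and ?b = "complex_of_real (f \<i>)"
  have H: "integrable lborel H" and H0: "\<And>k::int. (LINT x|lborel. H x * cis (2 * pi * k * x)) = 0"
    using linear(2) by (auto simp: trig_null_def)
  have f: "of_real (f (cis t)) = (?a - \<i> * ?b) / 2 * cis t + (?a + \<i> * ?b) / 2 * cis (- t)" for t
  proof -
    interpret bounded_linear f by fact
    have "cis t = cos t *\<^sub>R 1 + sin t *\<^sub>R \<i>" by (simp add: complex_eq_iff)
    then have "f (cis t) = cos t * f 1 + sin t * f \<i>"
      by (metis add scaleR real_scaleR_def)
    then show ?thesis by (simp add: complex_eq_iff algebra_simps add_divide_distrib[symmetric])
  qed
  have eq: "H x * of_real (f (cis (2 * pi * x))) * cis (2 * pi * k * x) =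
    (?a - \<i> * ?b) / 2 * (H x * cis (2 * pi * (k + 1) * x)) +
    (?a + \<i> * ?b) / 2 * (H x * cis (2 * pi * (k - 1) * x))" for x and k :: real
  proof -
    have 1: "cis (2 * pi * (k + 1) * x) = cis (2 * pi * x) * cis (2 * pi * k * x)"
       by (simp add: cis_mult algebra_simps)
    have 2: "cis (2 * pi * (k - 1) * x) = cis (- (2 * pi * x)) * cis (2 * pi * k * x)"
      by (simp add: cis_mult algebra_simps)
    show ?thesis unfolding f 1 2 by (simp add: algebra_simps)
  qed
  have ic: "integrable lborel (\<lambda>x. H x * cis (2 * pi * k * x))" for k
    using H by (subst integrable_mult_cis) auto
  have int: "integrable lborel (\<lambda>x. H x * of_real (f (cis (2 * pi * x))) * cis (2 * pi * k * x))" for k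
    unfolding eq using ic by (intro Bochner_Integration.integrable_add Bochner_Integration.integrable_mult_right) auto
  have "integrable lborel (\<lambda>x. H x * of_real (f (cis (2 * pi * x))))"
    using int[of 0] by simp
  moreover have "(LINT x|lborel. H x * of_real (f (cis (2 * pi * x))) * cis (2 * pi * k * x)) = 0" for k :: int
    unfolding eq using ic H0[of "k+1"] H0[of "k-1"] by (subst Bochner_Integration.integral_add) auto
  ultimately show ?case unfolding trig_null_def by blast
next
  case (const c)
  have "H x * of_real c * cis t = of_real c * (H x * cis t)" for x t by simp
  then have "(LINT x|lborel. H x * of_real c * cis (2 * pi * k * x)) = 0" for k :: int
    using const by (simp only: trig_null_def integral_mult_right_zero) simp
  then show ?case using const by (simp add: trig_null_def)
next
  case (add f g)
  have "trig_null (\<lambda>x. H x * of_real (f (cis (2 * pi * x))))" "trig_null (\<lambda>x. H x * of_real (g (cis (2 * pi * x))))"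
    using add by auto
  then show ?case by (auto simp: trig_null_def distrib_left distrib_right)
next
  case (mult f g)
  then show ?case by (simp add: mult.assoc[symmetric])
qed

text \<open>Stone-Weierstrass on the unit circle: a polynomial uniformly within \<open>e\<close> of
  \<phi> changes the integral by at most \<open>e * N\<close>, and the polynomial itself contributes
  the coefficient at \<open>k = 0\<close> of a \<open>trig_null\<close> function.\<close>

lemma trig_null_integral_continuous:
  fixes \<phi> :: "complex \<Rightarrow> real"
  assumes H: "trig_null H" and \<phi>: "continuous_on UNIV \<phi>"
  shows "(LINT x|lborel. H x * of_real (\<phi> (cis (2 * pi * x)))) = 0"
proof -
  let ?h = "\<lambda>x. H x * of_real (\<phi> (cis (2 * pi * x)))"
  have Hi: "integrable lborel H" using H by (simp add: trig_null_def)
  have [measurable]: "H \<in> borel_measurable borel" using Hi by auto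
  have [measurable]: "\<phi> \<in> borel_measurable borel" using \<phi> by (rule borel_measurable_continuous_onI)
  define N where "N = (LINT x|lborel. norm (H x))"
  have N: "N \<ge> 0" unfolding N_def by simp
  have bound: "norm (LINT x|lborel. ?h x) \<le> e * N" if e: "e > 0" for e
  proof -
    obtain p where p: "real_polynomial_function p" "\<And>z. z \<in> sphere 0 1 \<Longrightarrow> \<bar>\<phi> z - p z\<bar> < e"
      using Stone_Weierstrass_real_polynomial_function
        [OF compact_sphere[of 0 1] continuous_on_subset[OF \<phi> subset_UNIV] e] by metis
    let ?p = "\<lambda>x. H x * of_real (p (cis (2 * pi * x)))"
    let ?d = "\<lambda>x. H x * of_real (\<phi> (cis (2 * pi * x)) - p (cis (2 * pi * x)))"
    have pn: "trig_null (\<lambda>x. ?p x)"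
      by (rule trig_null_mult_polynomial[OF p(1) H])
    then have pi: "integrable lborel (\<lambda>x. ?p x)"
      and p0: "(LINT x|lborel. ?p x) = 0"
      unfolding trig_null_def by (auto dest: spec[of _ 0])
    have bd: "norm (?d x) \<le> e * norm (H x)" for x
      using p(2)[of "cis (2 * pi * x)"] by (simp add: norm_mult mult.commute[of e] mult_left_mono del: of_real_diff)
    have [measurable]: "p \<in> borel_measurable borel"
      using p(1) by (intro borel_measurable_continuous_onI continuous_on_polymonial_function)
        (simp add: real_polynomial_function_eq)
    have di: "integrable lborel (\<lambda>x. ?d x)"
      by (rule Bochner_Integration.integrable_bound[of _ "\<lambda>x. e * norm (H x)"]) (use Hi bd e in auto)
    have "(LINT x|lborel. ?h x) =
      (LINT x|lborel. ?d x + ?p x)"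
      by (simp add: algebra_simps)
    also have "\<dots> = (LINT x|lborel. ?d x)"
      using di pi p0 by (subst Bochner_Integration.integral_add) auto
    also have "norm \<dots> \<le> (LINT x|lborel. e * norm (H x))"
      by (rule order_trans[OF integral_norm_bound], rule integral_mono) (use di Hi bd in auto)
    also have "\<dots> = e * N" by (simp add: N_def)
    finally show ?thesis .
  qed
  have "norm (LINT x|lborel. ?h x) \<le> 0"
  proof (rule field_le_epsilon)
    fix e :: real assume e: "e > 0"
    \<comment> \<open>The summand 1 keeps the quotient meaningful when \<open>H\<close> is
      null.\<close>
    have "norm (LINT x|lborel. ?h x) \<le> e / (N + 1) * N"
      using bound[of "e / (N + 1)"] e N by simp
    also have "\<dots> \<le> e" using e N by (simp add: field_simps)
    finally show "norm (LINT x|lborel. ?h x) \<le> 0 + e" by simp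
  qed
  then show ?thesis by simp
qed

text \<open>The two end points have the same image, so one argument is kept off them; the other may
  then range over the closed interval, as needed for arcs that end at 0 or 1.\<close>

lemma cis_2pi_inj:
  assumes "cis (2 * pi * x) = cis (2 * pi * y)" "x \<in> {0<..<1}" "y \<in> {0..1}"
  shows "x = y"
proof -
  have "sin (2 * pi * x) = sin (2 * pi * y) \<and> cos (2 * pi * x) = cos (2 * pi * y)"
    using assms(1) by (simp add: complex_eq_iff)
  then obtain n :: int where "2 * pi * x = 2 * pi * y + 2 * pi * n"
    using sin_cos_eq_iff[of "2 * pi * x" "2 * pi * y"] by blast
  then have "2 * pi * x = 2 * pi * (y + n)" by (simp add: algebra_simps)
  then have "x = y + n" by simp
  moreover from this have "- 1 < real_of_int n" "real_of_int n < 1" using assms by auto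
  then have "n = 0" by linarith
  ultimately show ?thesis by simp
qed

lemma trig_null_AE_eq_0:
  assumes H: "trig_null H" and supp: "\<And>x. x \<notin> {0..<1} \<Longrightarrow> H x = 0"
  shows "AE x in lborel. H x = 0"
proof (rule AE_eq_0_if_interval_integrals_eq_0)
  show Hi: "integrable lborel H" using H by (simp add: trig_null_def)
  have [measurable]: "H \<in> borel_measurable borel" using Hi by auto
  fix a b :: real assume "a \<le> b"
  define a' b' where "a' = max a 0" and "b' = min b 1"
  show "(LINT x:{a..b}|lborel. H x) = 0"
  proof (cases "a' \<le> b'")
    case False
    have "(\<lambda>x. indicator {a..b} x *\<^sub>R H x) = (\<lambda>_. 0)"
    proof
      fix x show "indicator {a..b} x *\<^sub>R H x = 0"
        using False supp[of x] by (auto simp: a'_def b'_def indicator_def)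
    qed
    then show ?thesis by (simp add: set_lebesgue_integral_def)
  next
    case True
    define C where "C = (\<lambda>x. cis (2 * pi * x)) ` {a'..b'}"
    have C: "compact C" "C \<noteq> {}" unfolding C_def using True
      by (auto intro!: compact_continuous_image continuous_intros)
    let ?g = "\<lambda>x. H x * of_real (indicator C (cis (2 * pi * x)))"
    \<comment> \<open>Continuous tents that tend to the indicator of the closed arc \<open>C\<close>
      pointwise and stay between 0 and 1, so dominated convergence carries the vanishing over to the
      arc.\<close>
    define \<phi> where "\<phi> n z = max 0 (1 - real n * infdist z C)" for n z
    have cont: "continuous_on UNIV (\<phi> n)" for n unfolding \<phi>_def by (intro continuous_intros)
    have [measurable]: "\<phi> n \<in> borel_measurable borel" for n
      using cont by (rule borel_measurable_continuous_onI)
    have lim: "(\<lambda>n. \<phi> n z) \<longlonglongrightarrow> indicator C z" for z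
    proof (cases "z \<in> C")
      case True then show ?thesis by (simp add: \<phi>_def)
    next
      case False
      then have "infdist z C > 0" using C by (simp add: infdist_pos_not_in_closed compact_imp_closed)
      then obtain m :: nat where m: "1 < real m * infdist z C"
        using reals_Archimedean3 by blast
      have "\<phi> n z = 0" if "n \<ge> m" for n
      proof -
        have "real m * infdist z C \<le> real n * infdist z C" using that by (intro mult_right_mono) (auto simp: infdist_nonneg)
        then show ?thesis using m by (simp add: \<phi>_def)
      qed
      then have "eventually (\<lambda>n. \<phi> n z = 0) sequentially" by (auto simp: eventually_sequentially)
      then show ?thesis using False by (simp add: tendsto_eventually)
    qed
    have "(\<lambda>n. LINT x|lborel. H x * of_real (\<phi> n (cis (2 * pi * x)))) \<longlonglongrightarrow>
       (LINT x|lborel. ?g x)"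
    proof (rule integral_dominated_convergence[where w = "\<lambda>x. norm (H x)"])
      show "AE x in lborel. (\<lambda>n. H x * of_real (\<phi> n (cis (2 * pi * x)))) \<longlonglongrightarrow> ?g x"
        by (intro AE_I2 tendsto_intros lim)
      show "AE x in lborel. norm (H x * of_real (\<phi> n (cis (2 * pi * x)))) \<le> norm (H x)" for n
        by (intro AE_I2) (auto simp: norm_mult \<phi>_def infdist_nonneg intro!: mult_left_le)
      have [measurable]: "C \<in> sets borel" using C by (simp add: borel_compact)
      show "(\<lambda>x. ?g x) \<in> borel_measurable lborel" by measurable
    qed (use Hi in auto)
    then have "(LINT x|lborel. ?g x) = 0"
      using trig_null_integral_continuous[OF H cont] by (simp add: LIMSEQ_const_iff)
    moreover have "(LINT x|lborel. ?g x) = (LINT x|lborel. indicator {a..b} x *\<^sub>R H x)"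
    proof (rule integral_cong_AE)
      have [measurable]: "C \<in> sets borel" using C by (simp add: borel_compact)
      show "(\<lambda>x. ?g x) \<in> borel_measurable lborel" by measurable
      \<comment> \<open>At 0 the two integrands may differ: an arc that ends at 1 contains the image
        of 0.\<close>
      have "AE x in lborel. x \<noteq> (0::real)" by (rule AE_lborel_singleton)
      then show "AE x in lborel. ?g x = indicator {a..b} x *\<^sub>R H x"
      proof eventually_elim
        case (elim x)
        show ?case
        proof (cases "x \<in> {0<..<1}")
          case True
          have "cis (2 * pi * x) \<in> C \<longleftrightarrow> x \<in> {a'..b'}"
            unfolding C_def using cis_2pi_inj[OF _ True] by (auto simp: a'_def b'_def)
          also have "\<dots> \<longleftrightarrow> x \<in> {a..b}" using True by (auto simp: a'_def b'_def)
          finally show ?thesis by (simp add: indicator_def)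
        next
          case False
          then show ?thesis using supp[of x] elim by auto
        qed
      qed
    qed measurable
    ultimately show ?thesis by (simp add: set_lebesgue_integral_def)
  qed
qed

section \<open>Poisson summation and Fourier uniqueness on the line\<close>

type_synonym plane = "real \<times> real"

abbreviation cint :: "int measure" where "cint \<equiv> count_space UNIV"

interpretation lborel_cint: pair_sigma_finite "lborel :: 'a::euclidean_space measure" cint
  by (intro pair_sigma_finite.intro sigma_finite_lborel sigma_finite_measure_count_space)

interpretation cint_cint: pair_sigma_finite cint cint
  by (intro pair_sigma_finite.intro sigma_finite_measure_count_space)

lemma integrable_count_space_finite_support:
  fixes f :: "'a \<Rightarrow> 'b::{banach, second_countable_topology}"
  assumes "finite {m. f m \<noteq> 0}"
  shows "integrable (count_space UNIV) f"
proof (rule integrableI_bounded)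
  have "(\<integral>\<^sup>+m. ennreal (norm (f m)) \<partial>count_space UNIV) = (\<Sum>m | f m \<noteq> 0. ennreal (norm (f m)))"
    using assms by (intro nn_integral_count_space') auto
  also have "\<dots> < \<infinity>" using assms by simp
  finally show "(\<integral>\<^sup>+m. ennreal (norm (f m)) \<partial>count_space UNIV) < \<infinity>" .
qed simp

text \<open>The left end \<open>c\<close> stays free: Fourier coefficients use the interval from 0
  to 1, the uniqueness proof on the line the interval centred at 0.\<close>

lemma nn_integral_unfold_interval:
  fixes f :: "real \<Rightarrow> ennreal"
  assumes [measurable]: "f \<in> borel_measurable borel"
  shows "(\<integral>\<^sup>+x. f x \<partial>lborel) =
    (\<integral>\<^sup>+m. (\<integral>\<^sup>+x. indicator {c..<c+1} x * f (x + of_int m) \<partial>lborel) \<partial>cint)"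
proof -
  let ?I = "\<lambda>m :: int. {c + real_of_int m..<c + real_of_int m + 1}"
  have pt: "(\<integral>\<^sup>+m. indicator (?I m) x * f x \<partial>cint) = f x" for x
  proof -
    have "(\<integral>\<^sup>+m. indicator (?I m) x * f x \<partial>cint) =
      (\<Sum>m\<in>{\<lfloor>x - c\<rfloor>}. indicator (?I m) x * f x)"
    proof (rule nn_integral_count_space')
      fix m assume "m \<notin> {\<lfloor>x - c\<rfloor>}"
      then have "\<not> (real_of_int m \<le> x - c \<and> x - c < real_of_int m + 1)"
        by (metis floor_unique singletonI)
      then show "indicator (?I m) x * f x = 0"
        by (auto simp: indicator_def)
    qed auto
    also have "\<dots> = f x"
    proof -
      have "c + real_of_int \<lfloor>x - c\<rfloor> \<le> x" "x < c + real_of_int \<lfloor>x - c\<rfloor> + 1" by linarith+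
      then show ?thesis by simp
    qed
    finally show ?thesis .
  qed
  have "(\<integral>\<^sup>+x. f x \<partial>lborel) =
     (\<integral>\<^sup>+x. (\<integral>\<^sup>+m. indicator (?I m) x * f x \<partial>cint) \<partial>lborel)"
    by (simp add: pt)
  also have "\<dots> = (\<integral>\<^sup>+m. (\<integral>\<^sup>+x. indicator (?I m) x * f x \<partial>lborel) \<partial>cint)"
    by (rule lborel_cint.Fubini'[symmetric]) (simp add: indicator_def split_beta', measurable)
  also have "\<dots> = (\<integral>\<^sup>+m. (\<integral>\<^sup>+x. indicator {c..<c+1} x * f (x + of_int m) \<partial>lborel) \<partial>cint)"
  proof (rule nn_integral_cong)
    fix m :: int
    have "(\<integral>\<^sup>+x. indicator (?I m) x * f x \<partial>lborel) =
      (\<integral>\<^sup>+x. indicator (?I m) (x + of_int m) * f (x + of_int m) \<partial>lborel)"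
      by (subst nn_integral_lborel_translate[of "\<lambda>x. indicator (?I m) x * f x"]) auto
    also have "\<dots> = (\<integral>\<^sup>+x. indicator {c..<c+1} x * f (x + of_int m) \<partial>lborel)"
      by (intro nn_integral_cong) (auto simp: indicator_def)
    finally show "(\<integral>\<^sup>+x. indicator (?I m) x * f x \<partial>lborel) =
      (\<integral>\<^sup>+x. indicator {c..<c+1} x * f (x + of_int m) \<partial>lborel)" .
  qed
  finally show ?thesis .
qed

lemma
  fixes F :: "real \<Rightarrow> complex"
  assumes F: "integrable lborel F"
  shows integrable_unfold: "integrable (lborel \<Otimes>\<^sub>M cint) (\<lambda>(x, m). indicator {0..<1} x *\<^sub>R F (x + of_int m))"
    and integral_unfold: "(LINT x|lborel. LINT m|cint. indicator {0..<1} x *\<^sub>R F (x + of_int m)) = (LINT x|lborel. F x)"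
proof -
  let ?H = "\<lambda>x (m::int). indicator {0..<1} x *\<^sub>R F (x + of_int m)"
  have [measurable]: "F \<in> borel_measurable borel" using F by auto
  have nF: "(\<integral>\<^sup>+x. ennreal (norm (F x)) \<partial>lborel) < \<infinity>" using F by (simp add: integrable_iff_bounded)
  show int: "integrable (lborel \<Otimes>\<^sub>M cint) (\<lambda>(x, m). ?H x m)"
  proof (rule integrableI_bounded)
    have "(\<integral>\<^sup>+p. ennreal (norm (case p of (x, m) \<Rightarrow> ?H x m)) \<partial>(lborel \<Otimes>\<^sub>M cint)) =
      (\<integral>\<^sup>+m. (\<integral>\<^sup>+x. ennreal (norm (?H x m)) \<partial>lborel) \<partial>cint)"
      by (subst lborel_cint.nn_integral_snd[symmetric]) auto
    also have "\<dots> = (\<integral>\<^sup>+m. (\<integral>\<^sup>+x. indicator {0..<0+1} x * ennreal (norm (F (x + of_int m))) \<partial>lborel) \<partial>cint)"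
      by (intro nn_integral_cong) (auto simp: indicator_def)
    also have "\<dots> = (\<integral>\<^sup>+x. ennreal (norm (F x)) \<partial>lborel)"
      by (rule nn_integral_unfold_interval[symmetric]) measurable
    finally show "(\<integral>\<^sup>+p. ennreal (norm (case p of (x, m) \<Rightarrow> ?H x m)) \<partial>(lborel \<Otimes>\<^sub>M cint)) < \<infinity>"
      using nF by simp
  qed measurable
  have pt: "x \<in> {of_int m..<of_int m + 1} \<longleftrightarrow> m = \<lfloor>x\<rfloor>" for x :: real and m :: int
    by (auto simp: floor_unique)
  \<comment> \<open>The untranslated picture: for each \<open>x\<close> only
    \<open>m = \<lfloor>x\<rfloor>\<close> contributes, so summing over \<open>m\<close> returns
    \<open>F x\<close>. Exchanging the integrals and translating by \<open>m\<close> for each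
    \<open>m\<close> turns \<open>?G\<close> into \<open>?H\<close>.\<close>
  let ?G = "\<lambda>x m. indicator {real_of_int m..<real_of_int m + 1} x *\<^sub>R F x"
  have G: "?G x m = (if m = \<lfloor>x\<rfloor> then F x else 0)" for x m
    using pt[of x m] by (auto simp: indicator_def)
  have [measurable]: "(\<lambda>(x, m). ?G x m) \<in> borel_measurable (lborel \<Otimes>\<^sub>M cint)"
    unfolding G by measurable
  have one: "(LINT m|cint. ?G x m) = F x" for x
    unfolding G by (subst lebesgue_integral_count_space_finite_support) (auto simp: Collect_conv_if)
  have none: "(\<integral>\<^sup>+m. ennreal (norm (?G x m)) \<partial>cint) = ennreal (norm (F x))" for x
    unfolding G by (subst nn_integral_count_space'[of "{\<lfloor>x\<rfloor>}"]) auto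
  have intG: "integrable (lborel \<Otimes>\<^sub>M cint) (\<lambda>(x, m). ?G x m)"
  proof (rule integrableI_bounded)
    have "(\<integral>\<^sup>+p. ennreal (norm (case p of (x, m) \<Rightarrow> ?G x m)) \<partial>(lborel \<Otimes>\<^sub>M cint)) =
      (\<integral>\<^sup>+x. (\<integral>\<^sup>+m. ennreal (norm (?G x m)) \<partial>cint) \<partial>lborel)"
      by (subst lborel_cint.M2.nn_integral_fst[symmetric]) auto
    also have "\<dots> < \<infinity>" using nF by (simp only: none)
    finally show "(\<integral>\<^sup>+p. ennreal (norm (case p of (x, m) \<Rightarrow> ?G x m)) \<partial>(lborel \<Otimes>\<^sub>M cint)) < \<infinity>" .
  qed measurable
  have "(LINT x|lborel. F x) = (LINT x|lborel. LINT m|cint. ?G x m)" by (simp add: one)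
  also have "\<dots> = (LINT m|cint. LINT x|lborel. ?G x m)"
    by (rule lborel_cint.Fubini_integral[OF intG, symmetric])
  also have "\<dots> = (LINT m|cint. LINT x|lborel. ?H x m)"
  proof (rule Bochner_Integration.integral_cong[OF refl])
    fix m :: int
    have "(LINT x|lborel. ?G x m) = (LINT x|lborel. ?G (x + of_int m) m)"
      by (rule integral_lborel_translate[symmetric]) measurable
    also have "\<dots> = (LINT x|lborel. ?H x m)"
      by (intro Bochner_Integration.integral_cong) (auto simp: indicator_def)
    finally show "(LINT x|lborel. ?G x m) = \<dots>" .
  qed
  also have "\<dots> = (LINT x|lborel. LINT m|cint. ?H x m)"
    by (rule lborel_cint.Fubini_integral[OF int])
  finally show "(LINT x|lborel. LINT m|cint. ?H x m) = (LINT x|lborel. F x)" by simp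
qed

lemma integral_cis_interval:
  "(LINT x|lborel. indicator {0..<1} x *\<^sub>R cis (2 * pi * of_int k * x)) = (if k = 0 then 1 else 0)"
proof -
  have "(LINT x|lborel. indicator {0..<1} x *\<^sub>R cis (2 * pi * of_int k * x)) =
    (LINT x|lborel. indicator {0..1} x *\<^sub>R cis (2 * pi * of_int k * x))"
  proof (rule integral_cong_AE)
    have "AE x in lborel. x \<noteq> (1::real)" by (rule AE_lborel_singleton)
    then show "AE x in lborel. indicator {0..<1} x *\<^sub>R cis (2 * pi * of_int k * x) = indicator {0..1} x *\<^sub>R cis (2 * pi * of_int k * x)"
      by eventually_elim (auto simp: indicator_def)
  qed measurable
  also have "\<dots> = (if k = 0 then 1 else 0)"
  proof (cases "k = 0")
    case False
    define F where "F x = cis (2 * pi * of_int k * x) / (\<i> * of_real (2 * pi * of_int k))" for x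
    have "(LINT x|lborel. indicator {0..1} x *\<^sub>R cis (2 * pi * of_int k * x)) = F 1 - F 0"
    proof (rule integral_FTC_Icc)
      fix x :: real
      have d: "((\<lambda>x. cis (2 * pi * of_int k * x)) has_vector_derivative (2 * pi * of_int k) *\<^sub>R (\<i> * cis (2 * pi * of_int k * x))) (at x within {0..1})"
        unfolding cis_conv_exp
        by (rule has_vector_derivative_real_field[THEN has_vector_derivative_at_within] | auto intro!: derivative_eq_intros simp: scaleR_conv_of_real)+
      show "(F has_vector_derivative cis (2 * pi * of_int k * x)) (at x within {0..1})"
        unfolding F_def using has_vector_derivative_divide[OF d, of "\<i> * of_real (2 * pi * of_int k)"] False
        by (simp add: scaleR_conv_of_real field_simps)
    qed (auto intro!: continuous_intros)
    moreover have "cis (2 * pi * of_int k) = 1" by (rule cis_multiple_2pi) simp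
    ultimately show ?thesis using False by (simp add: F_def)
  qed simp
  finally show ?thesis .
qed

lemma AE_lborel_ex:
  fixes P :: "'a::euclidean_space \<Rightarrow> bool"
  assumes "AE x in lborel. P x"
  shows "\<exists>x. P x"
proof -
  have "ae_filter (lborel :: 'a measure) \<noteq> bot" by (simp add: ae_filter_eq_bot_iff)
  then show ?thesis using assms by (rule eventually_happens')
qed

lemma AE_lborel_periodic:
  fixes \<Phi> :: "real \<Rightarrow> bool"
  assumes ae: "AE x in lborel. x \<in> {0..<1} \<longrightarrow> \<Phi> x"
    and per: "\<And>x (n::int). \<Phi> (x + of_int n) \<Longrightarrow> \<Phi> x"
  shows "AE x in lborel. \<Phi> x"
proof -
  have "AE x in lborel. \<forall>n::int. x + of_int n \<in> {0..<1} \<longrightarrow> \<Phi> (x + of_int n)"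
    unfolding AE_all_countable using AE_lborel_translate[OF ae] by blast
  then show ?thesis
  proof eventually_elim
    case (elim x)
    have "x + of_int (- \<lfloor>x\<rfloor>) \<in> {0..<1}" by (simp; linarith)
    then have "\<Phi> (x + of_int (- \<lfloor>x\<rfloor>))" using elim by blast
    then show ?case by (rule per)
  qed
qed

lemma bij_betw_int_translate: "bij_betw (\<lambda>m. m + n) UNIV (UNIV :: int set)"
  by (rule bij_betwI[where g = "\<lambda>m. m - n"]) auto

lemma AE_integrable_translates:
  fixes F :: "real \<Rightarrow> complex"
  assumes F: "integrable lborel F"
  shows "AE x in lborel. integrable cint (\<lambda>m. F (x + of_int m))"
proof (rule AE_lborel_periodic)
  have "AE x in lborel. integrable cint (\<lambda>m. indicator {0..<1} x *\<^sub>R F (x + of_int m))"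
    by (rule lborel_cint.AE_integrable_fst[OF integrable_unfold[OF F]])
  then show "AE x in lborel. x \<in> {0..<1} \<longrightarrow> integrable cint (\<lambda>m. F (x + of_int m))"
    by eventually_elim auto
next
  fix x and n :: int
  assume "integrable cint (\<lambda>m. F (x + of_int n + of_int m))"
  then show "integrable cint (\<lambda>m. F (x + of_int m))"
    using integrable_bij_count_space[OF bij_betw_int_translate[of n], of "\<lambda>m. F (x + of_int m)"]
    by (simp add: add_ac)
qed

text \<open>Both sides have period 1 and, by unfolding and Fubini, the same Fourier coefficients
  over one period, so uniqueness on the circle makes them agree almost everywhere. Summability of
  \<open>hF\<close> does not follow from integrability of \<open>F\<close>; in the application it
  comes from the product form of the kernel.\<close>

lemma poisson_summation:
  fixes F :: "real \<Rightarrow> complex"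
  defines "hF \<equiv> \<lambda>l::int. LINT x|lborel. F x * cis (2 * pi * of_int l * x)"
  assumes F: "integrable lborel F" and hF: "integrable cint hF"
  shows "AE x in lborel. integrable cint (\<lambda>m. F (x + of_int m)) \<and>
    (LINT m|cint. F (x + of_int m)) = (LINT l|cint. hF l * cis (- (2 * pi * of_int l * x)))"
proof -
  have [measurable]: "F \<in> borel_measurable borel" using F by auto
  define P where "P x = (LINT m|cint. F (x + of_int m))" for x
  define R where "R x = (LINT l|cint. hF l * cis (- (2 * pi * of_int l * x)))" for x
  define H where "H x = indicator {0..<1} x *\<^sub>R (P x - R x)" for x
  have intP: "integrable lborel (\<lambda>x. indicator {0..<1} x *\<^sub>R P x)"
    using lborel_cint.integrable_fst[OF integrable_unfold[OF F]] by (simp add: P_def)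
  \<comment> \<open>The frequencies \<open>t\<close> are arbitrary so that one bound serves both
    \<open>R\<close> and \<open>R\<close> times a character.\<close>
  have intR2: "integrable (lborel \<Otimes>\<^sub>M cint) (\<lambda>(x, l). indicator {0..<1} x *\<^sub>R (hF l * cis (t l * x)))" for t :: "int \<Rightarrow> real"
  proof (rule integrableI_bounded)
    have "(\<integral>\<^sup>+p. ennreal (norm (case p of (x, l) \<Rightarrow> indicator {0..<1} x *\<^sub>R (hF l * cis (t l * x)))) \<partial>(lborel \<Otimes>\<^sub>M cint)) =
      (\<integral>\<^sup>+l. (\<integral>\<^sup>+x. ennreal (norm (indicator {0..<1} x *\<^sub>R (hF l * cis (t l * x)))) \<partial>lborel) \<partial>cint)"
      by (subst lborel_cint.nn_integral_snd[symmetric]) auto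
    also have "\<dots> = (\<integral>\<^sup>+l. (\<integral>\<^sup>+x. ennreal (norm (hF l)) * indicator {0..<1::real} x \<partial>lborel) \<partial>cint)"
      by (intro nn_integral_cong) (auto simp: indicator_def norm_mult)
    also have "\<dots> = (\<integral>\<^sup>+l. ennreal (norm (hF l)) \<partial>cint)"
      by (simp add: nn_integral_cmult_indicator)
    also have "\<dots> < \<infinity>" using hF by (simp add: integrable_iff_bounded)
    finally show "(\<integral>\<^sup>+p. ennreal (norm (case p of (x, l) \<Rightarrow> indicator {0..<1} x *\<^sub>R (hF l * cis (t l * x)))) \<partial>(lborel \<Otimes>\<^sub>M cint)) < \<infinity>" .
  qed measurable
  have intR: "integrable lborel (\<lambda>x. indicator {0..<1} x *\<^sub>R R x)"
    using lborel_cint.integrable_fst[OF intR2[of "\<lambda>l. - (2 * pi * of_int l)"]] by (simp add: R_def)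
  have intH: "integrable lborel H"
    unfolding H_def scaleR_diff_right using intP intR by (rule Bochner_Integration.integrable_diff)
  have "trig_null H"
    unfolding trig_null_def
  proof (intro conjI allI intH)
    fix k :: int
    have 1: "(LINT x|lborel. indicator {0..<1} x *\<^sub>R P x * cis (2 * pi * of_int k * x)) = hF k"
    proof -
      have c: "cis (2 * pi * of_int k * (x + of_int m)) = cis (2 * pi * of_int k * x)" for x and m :: int
      proof -
        have "cis (2 * pi * of_int k * (x + of_int m)) = cis (2 * pi * of_int k * x) * cis (2 * pi * of_int (k * m))"
          by (simp add: cis_mult algebra_simps)
        also have "cis (2 * pi * of_int (k * m)) = 1" by (rule cis_multiple_2pi) simp
        finally show ?thesis by simp
      qed
      have "hF k = (LINT x|lborel. LINT m|cint. indicator {0..<1} x *\<^sub>R (F (x + of_int m) * cis (2 * pi * of_int k * (x + of_int m))))"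
        unfolding hF_def by (rule integral_unfold[symmetric]) (use F in simp)
      also have "\<dots> = (LINT x|lborel. indicator {0..<1} x *\<^sub>R P x * cis (2 * pi * of_int k * x))"
        unfolding c P_def by simp
      finally show ?thesis by simp
    qed
    have 2: "(LINT x|lborel. indicator {0..<1} x *\<^sub>R R x * cis (2 * pi * of_int k * x)) = hF k"
    proof -
      have "(LINT x|lborel. indicator {0..<1} x *\<^sub>R R x * cis (2 * pi * of_int k * x)) =
        (LINT x|lborel. LINT l|cint. indicator {0..<1} x *\<^sub>R (hF l * cis ((2 * pi * of_int (k - l)) * x)))"
      proof (rule Bochner_Integration.integral_cong[OF refl])
        fix x :: real
        have "hF l * cis (- (2 * pi * of_int l * x)) * cis (2 * pi * of_int k * x) = hF l * cis ((2 * pi * of_int (k - l)) * x)" for l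
          by (simp add: cis_mult algebra_simps)
        then have "R x * cis (2 * pi * of_int k * x) = (LINT l|cint. hF l * cis ((2 * pi * of_int (k - l)) * x))"
          unfolding R_def by (subst integral_mult_left_zero[symmetric]) (simp only:)
        then show "indicator {0..<1} x *\<^sub>R R x * cis (2 * pi * of_int k * x) =
          (LINT l|cint. indicator {0..<1} x *\<^sub>R (hF l * cis ((2 * pi * of_int (k - l)) * x)))"
          by simp
      qed
      also have "\<dots> = (LINT l|cint. LINT x|lborel. indicator {0..<1} x *\<^sub>R (hF l * cis ((2 * pi * of_int (k - l)) * x)))"
        by (rule lborel_cint.Fubini_integral[OF intR2, symmetric])
      also have "\<dots> = (LINT l|cint. hF l * (LINT x|lborel. indicator {0..<1} x *\<^sub>R cis (2 * pi * of_int (k - l) * x)))"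
        by (simp flip: integral_mult_right_zero)
      also have "\<dots> = (LINT l|cint. (if l = k then hF k else 0))"
        unfolding integral_cis_interval by (intro Bochner_Integration.integral_cong) auto
      also have "\<dots> = hF k"
        by (subst lebesgue_integral_count_space_finite_support) (auto simp: Collect_conv_if)
      finally show ?thesis .
    qed
    show "(LINT x|lborel. H x * cis (2 * pi * of_int k * x)) = 0"
    proof -
      have "integrable lborel (\<lambda>x. indicator {0..<1} x *\<^sub>R P x * cis (2 * pi * of_int k * x))"
        using intP by (subst integrable_mult_cis) simp_all
      moreover have "integrable lborel (\<lambda>x. indicator {0..<1} x *\<^sub>R R x * cis (2 * pi * of_int k * x))"
        using intR by (subst integrable_mult_cis) simp_all
      ultimately have "(LINT x|lborel. indicator {0..<1} x *\<^sub>R P x * cis (2 * pi * of_int k * x) -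
          indicator {0..<1} x *\<^sub>R R x * cis (2 * pi * of_int k * x)) =
        (LINT x|lborel. indicator {0..<1} x *\<^sub>R P x * cis (2 * pi * of_int k * x)) -
        (LINT x|lborel. indicator {0..<1} x *\<^sub>R R x * cis (2 * pi * of_int k * x))"
        by (rule Bochner_Integration.integral_diff)
      then
      show ?thesis unfolding H_def scaleR_diff_right left_diff_distrib 1 2 by simp
    qed
  qed
  then have "AE x in lborel. H x = 0"
    by (rule trig_null_AE_eq_0) (auto simp: H_def)
  then have "AE x in lborel. x \<in> {0..<1} \<longrightarrow> P x = R x"
    by eventually_elim (auto simp: H_def)
  then have "AE x in lborel. P x = R x"
  proof (rule AE_lborel_periodic)
    fix x and n :: int
    assume *: "P (x + of_int n) = R (x + of_int n)"
    have eq: "(\<lambda>m. F (x + of_int n + of_int m)) = (\<lambda>m. (\<lambda>m. F (x + of_int m)) (m + n))"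
      by (simp add: add_ac)
    have "P (x + of_int n) = P x"
      unfolding P_def eq by (rule integral_bij_count_space[OF bij_betw_int_translate])
    moreover have "R (x + of_int n) = R x"
    proof -
      have "cis (- (2 * pi * of_int l * (x + of_int n))) = cis (- (2 * pi * of_int l * x))" for l
      proof -
        have "cis (- (2 * pi * of_int l * (x + of_int n))) = cis (- (2 * pi * of_int l * x)) * cis (2 * pi * of_int (- l * n))"
          by (simp add: cis_mult algebra_simps)
        also have "cis (2 * pi * of_int (- l * n)) = 1" by (rule cis_multiple_2pi) simp
        finally show ?thesis by simp
      qed
      then show ?thesis unfolding R_def by simp
    qed
    ultimately show "P x = R x" using * by simp
  qed
  with AE_integrable_translates[OF F] show ?thesis
    unfolding P_def R_def by eventually_elim simp
qed

text \<open>Periodization with period \<open>n\<close> bounds the mass of \<open>F\<close> on \<open>[-n/2, n/2)\<close> by its mass outside.\<close>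

lemma AE_eq_0_if_fourier_AE_eq_0:
  fixes F :: "real \<Rightarrow> complex"
  assumes F: "integrable lborel F"
    and zero: "AE s in lborel. (LINT x|lborel. F x * cis (2 * pi * s * x)) = 0"
  shows "AE x in lborel. F x = 0"
proof -
  have [measurable]: "F \<in> borel_measurable borel" using F by auto
  \<comment> \<open>A single base frequency \<open>s\<close> that works for all periods
    \<open>n\<close> and all \<open>l\<close>, by countability.\<close>
  have "AE s in lborel. \<forall>(l::int) (n::nat). (LINT x|lborel. F x * cis (2 * pi * (s + of_int l / of_nat n) * x)) = 0"
    unfolding AE_all_countable using AE_lborel_translate[OF zero] by blast
  from AE_lborel_ex[OF this] obtain s where s: "\<And>(l::int) (n::nat). (LINT x|lborel. F x * cis (2 * pi * (s + of_int l / of_nat n) * x)) = 0"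
    by blast
  define I where "I n = {- (real n / 2)..<real n / 2}" for n :: nat
  define a where "a n = (LINT x|lborel. indicator (I n) x *\<^sub>R norm (F x))" for n
  define T where "T = (LINT x|lborel. norm (F x))"
  have iI: "integrable lborel (\<lambda>x. indicator (I n) x *\<^sub>R norm (F x))" for n
    using F by (intro integrable_mult_indicator) (auto simp: I_def)
  have bound: "a n \<le> T - a n" if n: "n > 0" for n
  proof -
    \<comment> \<open>Rescaling brings period \<open>n\<close> to period 1, and modulation by
      \<open>s\<close> makes the coefficient of \<open>G\<close> at \<open>l\<close> a multiple of
      the transform of \<open>F\<close> at \<open>s + l / n\<close>, which vanishes by the choice of
      \<open>s\<close>.\<close>
    define G where "G x = F (0 + real n * x) * cis (2 * pi * s * (0 + real n * x))" for x
    let ?J = "{-1/2..<-1/2+1::real}" and ?n = "\<lambda>x. ennreal (norm (G x))"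
    have [measurable]: "G \<in> borel_measurable borel" unfolding G_def by measurable
    have G: "integrable lborel G"
      unfolding G_def
      by (rule lborel_integrable_real_affine[of "\<lambda>x. F x * cis (2 * pi * s * x)"]) (use F n in auto)
    have hG: "(LINT x|lborel. G x * cis (2 * pi * of_int l * x)) = 0" for l :: int
    proof -
      have "0 = (LINT x|lborel. F x * cis (2 * pi * (s + of_int l / of_nat n) * x))" using s by simp
      also have "\<dots> = \<bar>real n\<bar> *\<^sub>R (LINT x|lborel. F (0 + real n * x) * cis (2 * pi * (s + of_int l / of_nat n) * (0 + real n * x)))"
        using n by (intro lborel_integral_real_affine) simp
      also have "(LINT x|lborel. F (0 + real n * x) * cis (2 * pi * (s + of_int l / of_nat n) * (0 + real n * x))) =
        (LINT x|lborel. G x * cis (2 * pi * of_int l * x))"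
      proof (intro Bochner_Integration.integral_cong refl)
        fix x :: real
        have "2 * pi * (s + of_int l / of_nat n) * (0 + real n * x) = 2 * pi * s * (0 + real n * x) + 2 * pi * of_int l * x"
          using n by (simp add: field_simps)
        then show "F (0 + real n * x) * cis (2 * pi * (s + of_int l / of_nat n) * (0 + real n * x)) =
          G x * cis (2 * pi * of_int l * x)"
          by (simp only: G_def mult.assoc cis_mult)
      qed
      finally show ?thesis using n by simp
    qed
    have "AE x in lborel. integrable cint (\<lambda>m. G (x + of_int m)) \<and> (LINT m|cint. G (x + of_int m)) = 0"
      using poisson_summation[OF G] by (simp add: hG)
    \<comment> \<open>The periodization of \<open>G\<close> vanishes, so the term
      \<open>m = 0\<close> is balanced by the sum of all others.\<close>
    then have "AE x in lborel. ?n x \<le> (\<integral>\<^sup>+m. (if m = 0 then 0 else ?n (x + of_int m)) \<partial>cint)"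
    proof eventually_elim
      case (elim x)
      let ?c = "\<lambda>m::int. G (x + of_int m)"
      have z: "integrable cint (\<lambda>m. if m = 0 then ?c 0 else 0)" "(LINT m|cint. (if m = 0 then ?c 0 else 0)) = G x"
        by (auto simp: lebesgue_integral_count_space_finite_support Collect_conv_if
          intro!: integrable_count_space_finite_support)
      have i: "integrable cint (\<lambda>m. if m = 0 then 0 else ?c m)"
        by (rule Bochner_Integration.integrable_bound[of _ ?c]) (use elim in auto)
      have "0 = (LINT m|cint. ?c m)" using elim by simp
      also have "\<dots> = (LINT m|cint. (if m = 0 then ?c 0 else 0) + (if m = 0 then 0 else ?c m))"
        by (rule Bochner_Integration.integral_cong) auto
      also have "\<dots> = G x + (LINT m|cint. (if m = 0 then 0 else ?c m))"
        using z i by (subst Bochner_Integration.integral_add) auto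
      finally have "norm (G x) = norm (LINT m|cint. (if m = 0 then 0 else ?c m))"
        by (metis add_eq_0_iff norm_minus_cancel)
      also have "\<dots> \<le> (LINT m|cint. norm (if m = 0 then 0 else ?c m))" by (rule integral_norm_bound)
      finally have "?n x \<le> ennreal (LINT m|cint. norm (if m = 0 then 0 else ?c m))"
        by (rule ennreal_leI)
      also have "\<dots> = (\<integral>\<^sup>+m. ennreal (norm (if m = 0 then 0 else ?c m)) \<partial>cint)"
        using i by (intro nn_integral_eq_integral[symmetric]) auto
      also have "\<dots> = (\<integral>\<^sup>+m. (if m = 0 then 0 else ennreal (norm (?c m))) \<partial>cint)"
        by (intro nn_integral_cong) auto
      finally show ?case .
    qed
    then have "(\<integral>\<^sup>+x. indicator ?J x * ?n x \<partial>lborel) \<le>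
      (\<integral>\<^sup>+x. indicator ?J x * (\<integral>\<^sup>+m. (if m = 0 then 0 else ?n (x + of_int m)) \<partial>cint) \<partial>lborel)"
      by (intro nn_integral_mono_AE) (auto elim!: eventually_mono intro!: mult_left_mono)
    also have "\<dots> = (\<integral>\<^sup>+x. (\<integral>\<^sup>+m. indicator ?J x * (if m = 0 then 0 else ?n (x + of_int m)) \<partial>cint) \<partial>lborel)"
      by (intro nn_integral_cong nn_integral_cmult[symmetric]) auto
    also have "\<dots> = (\<integral>\<^sup>+m. (\<integral>\<^sup>+x. indicator ?J x * (if m = 0 then 0 else ?n (x + of_int m)) \<partial>lborel) \<partial>cint)"
      by (rule lborel_cint.Fubini'[symmetric]) measurable
    also have "\<dots> = (\<integral>\<^sup>+m. (\<integral>\<^sup>+x. indicator ?J x * (indicator (- ?J) (x + of_int m) * ?n (x + of_int m)) \<partial>lborel) \<partial>cint)"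
    proof (intro nn_integral_cong)
      fix m :: int and x :: real
      \<comment> \<open>A nonzero integer moves every point of the half-open unit interval out of
        it, so omitting \<open>m = 0\<close> is the same as restricting to the complement of
        \<open>?J\<close>.\<close>
      have "m = 0 \<longleftrightarrow> x + of_int m \<in> ?J" if "x \<in> ?J"
      proof
        assume "x + of_int m \<in> ?J"
        then have "-1 < real_of_int m" "real_of_int m < 1" using that by auto
        then show "m = 0" by linarith
      qed (use that in simp)
      then show "indicator ?J x * (if m = 0 then 0 else ?n (x + of_int m)) =
        indicator ?J x * (indicator (- ?J) (x + of_int m) * ?n (x + of_int m))"
        by (cases "x \<in> ?J") (simp_all del: atLeastLessThan_iff)
    qed
    also have "\<dots> = (\<integral>\<^sup>+x. indicator (- ?J) x * ?n x \<partial>lborel)"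
      by (rule nn_integral_unfold_interval[symmetric]) measurable
    finally have le: "(\<integral>\<^sup>+x. indicator ?J x * ?n x \<partial>lborel) \<le>
      (\<integral>\<^sup>+x. indicator (- ?J) x * ?n x \<partial>lborel)" .
    have mem: "x \<in> ?J \<longleftrightarrow> 0 + real n * x \<in> I n" for x
      using n mult_le_cancel_left_pos[of "real n" "-1/2" x] mult_less_cancel_left_pos[of "real n" x "1/2"]
      by (auto simp: I_def)
    have sc: "(\<integral>\<^sup>+x. indicator S x * ennreal (norm (F x)) \<partial>lborel) =
        \<bar>real n\<bar> * (\<integral>\<^sup>+x. indicator S (0 + real n * x) * ennreal (norm (G x)) \<partial>lborel)" if "S \<in> sets borel" for S
      using n that by (subst nn_integral_real_affine[of _ "real n" 0]) (auto simp: G_def norm_mult)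
    have "(\<integral>\<^sup>+x. indicator (I n) x * ennreal (norm (F x)) \<partial>lborel) \<le> (\<integral>\<^sup>+x. indicator (- I n) x * ennreal (norm (F x)) \<partial>lborel)"
    proof -
      have "indicator (I n) (0 + real n * x) = (indicator ?J x :: ennreal)"
        "indicator (- I n) (0 + real n * x) = (indicator (- ?J) x :: ennreal)" for x
        using mem[of x] by (simp_all only: indicator_def Compl_iff)
      moreover have "I n \<in> sets borel" by (simp add: I_def)
      ultimately show ?thesis
        using mult_left_mono[OF le, of "ennreal \<bar>real n\<bar>"] by (simp only: sc sets.compl_sets borel_comp)
          (simp only: zero_le)
    qed
    moreover have "(\<integral>\<^sup>+x. indicator (I n) x * ennreal (norm (F x)) \<partial>lborel) = ennreal (a n)"
      unfolding a_def using iI[of n]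
      by (subst nn_integral_eq_integral[symmetric]) (auto intro!: nn_integral_cong simp: indicator_def)
    moreover have "(\<integral>\<^sup>+x. indicator (- I n) x * ennreal (norm (F x)) \<partial>lborel) = ennreal (T - a n)"
    proof -
      have "T - a n = (LINT x|lborel. norm (F x) - indicator (I n) x *\<^sub>R norm (F x))"
        unfolding T_def a_def using F iI[of n] by (subst Bochner_Integration.integral_diff) auto
      moreover have "integrable lborel (\<lambda>x. norm (F x) - indicator (I n) x *\<^sub>R norm (F x))"
        using F iI[of n] by auto
      ultimately show ?thesis
        by (simp only:, subst nn_integral_eq_integral[symmetric]) (auto intro!: nn_integral_cong simp: indicator_def)
    qed
    moreover have "0 \<le> T - a n"
      unfolding T_def a_def using F iI[of n]
      by (auto intro!: integral_mono simp: indicator_def)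
    ultimately show ?thesis by (simp add: ennreal_le_iff)
  qed
  have "a \<longlonglongrightarrow> T"
    unfolding a_def T_def
  proof (rule integral_dominated_convergence[where w = "\<lambda>x. norm (F x)"])
    show "AE x in lborel. (\<lambda>n. indicator (I n) x *\<^sub>R norm (F x)) \<longlonglongrightarrow> norm (F x)"
    proof (intro AE_I2 tendsto_eventually)
      fix x :: real
      obtain N :: nat where N: "2 * \<bar>x\<bar> + 1 \<le> N" using real_arch_simple by blast
      show "eventually (\<lambda>n. indicator (I n) x *\<^sub>R norm (F x) = norm (F x)) sequentially"
        using eventually_ge_at_top[of N]
        by eventually_elim (use N in \<open>auto simp: I_def indicator_def\<close>)
    qed
    show "(\<lambda>x. indicator (I n) x *\<^sub>R norm (F x)) \<in> borel_measurable lborel" for n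
      using iI[of n] by auto
    show "AE x in lborel. norm (indicator (I n) x *\<^sub>R norm (F x)) \<le> norm (F x)" for n
      by (auto simp: indicator_def)
  qed (use F in auto)
  moreover from this have "(\<lambda>n. T - a n) \<longlonglongrightarrow> T - T" by (intro tendsto_intros)
  \<comment> \<open>In the limit of large periods the inner mass is everything and the outer mass
    nothing. The index starts at 1 because period 0 is excluded in \<open>bound\<close>.\<close>
  ultimately have "T \<le> T - T"
    by (rule LIMSEQ_le) (use bound in \<open>auto intro!: exI[of _ 1]\<close>)
  then have "T \<le> 0" by simp
  moreover have "T \<ge> 0" unfolding T_def by simp
  ultimately have "T = 0" by simp
  then show ?thesis
    unfolding T_def using F by (subst (asm) integral_nonneg_eq_0_iff_AE) auto
qed

section \<open>Lattice points and the selection of matched pairs\<close>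

lemma fst_snd_borel_measurable [measurable]:
  "fst \<in> borel_measurable (borel :: ('a::second_countable_topology \<times> 'b::second_countable_topology) measure)"
  "snd \<in> borel_measurable (borel :: ('a \<times> 'b) measure)"
  unfolding borel_prod[symmetric] by measurable

lemma sets_borel_Times [measurable (raw)]:
  fixes A :: "'a::second_countable_topology set" and B :: "'b::second_countable_topology set"
  shows "A \<in> sets borel \<Longrightarrow> B \<in> sets borel \<Longrightarrow> A \<times> B \<in> sets borel"
  unfolding borel_prod[symmetric] by simp

lemma AE_lborel_pairD:
  fixes P :: "'a::euclidean_space \<times> 'b::euclidean_space \<Rightarrow> bool"
  assumes "AE p in lborel. P p"
  shows "AE x in lborel. AE y in lborel. P (x, y)"
  using assms unfolding lborel_prod[symmetric] by (rule lborel_pair.AE_pair)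

lemma AE_lborel_pairI:
  fixes P :: "'a::euclidean_space \<times> 'b::euclidean_space \<Rightarrow> bool"
  assumes [measurable]: "Measurable.pred borel P"
    and "AE x in lborel. AE y in lborel. P (x, y)"
  shows "AE p in lborel. P p"
proof -
  have "{p \<in> space (lborel \<Otimes>\<^sub>M lborel). P p} \<in> sets (lborel \<Otimes>\<^sub>M lborel)"
    unfolding lborel_prod by measurable
  from lborel_pair.AE_pair_measure[OF this assms(2)] show ?thesis unfolding lborel_prod .
qed

text \<open>\<open>P\<close> is traded for the complement of a Borel null set, because
  \<open>AE_lborel_pairI\<close> works with measurable predicates.\<close>

lemma AE_lborel_fst:
  fixes P :: "'a::euclidean_space \<Rightarrow> bool"
  assumes "AE x in lborel. P x"
  shows "AE p in (lborel :: ('a \<times> 'b::euclidean_space) measure). P (fst p)"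
proof -
  obtain N where N: "N \<in> null_sets lborel" "\<And>x. x \<notin> N \<Longrightarrow> P x" using assms by (auto elim!: AE_E3)
  have [measurable]: "N \<in> sets borel" using N by auto
  have "AE x in lborel. x \<notin> N" using N(1) by (rule AE_not_in)
  then have "AE p in (lborel :: ('a \<times> 'b) measure). fst p \<notin> N"
    by (intro AE_lborel_pairI) (measurable, auto)
  then show ?thesis by eventually_elim (use N in auto)
qed

text \<open>Translation invariance in each fibre, integrated by Tonelli. It passes between
  coordinates (\<xi>, \<eta>) and (\<xi>, \<eta> - \<xi>), hence the uses with \<open>t\<close> the
  identity and negation.\<close>

lemma lborel_shear:
  fixes t :: "'a::euclidean_space \<Rightarrow> 'b::euclidean_space"
  assumes [measurable]: "t \<in> borel_measurable borel"
  shows "distr lborel borel (\<lambda>(x, y). (x, y + t x)) = lborel"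
proof (rule measure_eqI)
  fix A :: "('a \<times> 'b) set" assume "A \<in> sets (distr lborel borel (\<lambda>(x, y). (x, y + t x)))"
  then have [measurable]: "A \<in> sets borel" by simp
  have [measurable]: "(\<lambda>(x, y). (x, y + t x)) \<in> borel_measurable (borel :: ('a \<times> 'b) measure)"
    unfolding borel_prod[symmetric] by measurable
  have "emeasure (distr lborel borel (\<lambda>(x, y). (x, y + t x))) A =
     (\<integral>\<^sup>+p. indicator A (fst p, snd p + t (fst p)) \<partial>lborel)"
    by (subst nn_integral_indicator[symmetric], simp, subst nn_integral_distr) (auto simp: case_prod_beta)
  also have "\<dots> = (\<integral>\<^sup>+x. \<integral>\<^sup>+y. indicator A (x, y + t x) \<partial>lborel \<partial>lborel)"
    unfolding lborel_prod[symmetric] by (subst lborel.nn_integral_fst[symmetric]) (auto simp: borel_prod)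
  also have "\<dots> = (\<integral>\<^sup>+x. \<integral>\<^sup>+y. indicator A (x, y) \<partial>lborel \<partial>lborel)"
    by (intro nn_integral_cong nn_integral_lborel_translate) measurable
  also have "\<dots> = (\<integral>\<^sup>+p. indicator A p \<partial>(lborel \<Otimes>\<^sub>M lborel))"
    by (subst lborel.nn_integral_fst) (auto simp: borel_prod lborel_prod)
  also have "\<dots> = emeasure lborel A" by (simp add: lborel_prod)
  finally show "emeasure (distr lborel borel (\<lambda>(x, y). (x, y + t x))) A = emeasure lborel A" .
qed simp

lemma AE_lborel_shear:
  fixes t :: "'a::euclidean_space \<Rightarrow> 'b::euclidean_space"
  assumes [measurable]: "t \<in> borel_measurable borel" and "AE p in lborel. P p"
  shows "AE p in lborel. P (fst p, snd p + t (fst p))"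
proof -
  have "AE p in distr lborel borel (\<lambda>(x, y). (x, y + t x)). P p"
    using assms by (subst lborel_shear)
  moreover have "(\<lambda>(x, y). (x, y + t x)) \<in> borel_measurable (lborel :: ('a \<times> 'b) measure)"
    unfolding lborel_prod[symmetric] borel_prod[symmetric] by measurable
  ultimately have "AE p in lborel. P (case p of (x, y) \<Rightarrow> (x, y + t x))" by (rule AE_distrD[rotated])
  then show ?thesis by (simp add: case_prod_beta)
qed

lemma AE_lborel_swap:
  fixes P :: "'a::euclidean_space \<times> 'b::euclidean_space \<Rightarrow> bool"
  assumes "AE p in lborel. P p"
  shows "AE p in lborel. P (snd p, fst p)"
proof -
  have "AE p in distr (lborel \<Otimes>\<^sub>M lborel) (lborel \<Otimes>\<^sub>M lborel) (\<lambda>(x, y). (y, x)). P p"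
    using assms unfolding lborel_prod[symmetric] by (subst (asm) lborel_pair.distr_pair_swap)
  from AE_distrD[OF _ this] have "AE p in lborel \<Otimes>\<^sub>M lborel. P (case p of (x, y) \<Rightarrow> (y, x))"
    by simp
  then show ?thesis unfolding lborel_prod by (simp add: case_prod_beta)
qed

lemma AE_lborel_snd:
  fixes P :: "'b::euclidean_space \<Rightarrow> bool"
  assumes "AE x in lborel. P x"
  shows "AE p in (lborel :: ('a::euclidean_space \<times> 'b) measure). P (snd p)"
  using AE_lborel_swap[OF AE_lborel_fst[OF assms]] by simp

section \<open>The unit cell and lattice translates\<close>

lemma unit_cell_borel [measurable]: "{0..<1} \<times> {0..<1} \<in> sets (borel :: plane measure)"
  by (intro sets_borel_Times) auto

abbreviation unit_cell :: "plane set" where "unit_cell \<equiv> {0..<1} \<times> {0..<1}"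

text \<open>The saturation of \<open>E\<close> under the integer lattice, that is, the preimage of
  the image of \<open>E\<close> in the torus.\<close>

definition lattice_hull :: "plane set \<Rightarrow> plane set" where
  "lattice_hull E = {p. \<exists>m n :: int. p + (of_int m, of_int n) \<in> E}"

lemma sets_lattice_hull [measurable]:
  assumes [measurable]: "E \<in> sets borel"
  shows "lattice_hull E \<in> sets borel"
  unfolding lattice_hull_def by measurable

lemma nn_integral_unfold_interval_sum:
  fixes f :: "real \<Rightarrow> ennreal"
  assumes [measurable]: "f \<in> borel_measurable borel"
  shows "(\<integral>\<^sup>+x. f x \<partial>lborel) = (\<integral>\<^sup>+x. indicator {0..<1} x * (\<integral>\<^sup>+m. f (x + of_int m) \<partial>cint) \<partial>lborel)"
proof -
  have "(\<integral>\<^sup>+x. f x \<partial>lborel) = (\<integral>\<^sup>+m. (\<integral>\<^sup>+x. indicator {0..<1} x * f (x + of_int m) \<partial>lborel) \<partial>cint)"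
    using nn_integral_unfold_interval[of f 0] by simp
  also have "\<dots> = (\<integral>\<^sup>+x. (\<integral>\<^sup>+m. indicator {0..<1} x * f (x + of_int m) \<partial>cint) \<partial>lborel)"
    by (rule lborel_cint.Fubini') measurable
  also have "\<dots> = (\<integral>\<^sup>+x. indicator {0..<1} x * (\<integral>\<^sup>+m. f (x + of_int m) \<partial>cint) \<partial>lborel)"
    by (intro nn_integral_cong nn_integral_cmult) auto
  finally show ?thesis .
qed

lemma nn_integral_unfold_cell:
  fixes f :: "plane \<Rightarrow> ennreal"
  assumes [measurable]: "f \<in> borel_measurable borel"
  shows "(\<integral>\<^sup>+p. f p \<partial>lborel) =
    (\<integral>\<^sup>+p. indicator unit_cell p * (\<integral>\<^sup>+m. \<integral>\<^sup>+n. f (p + (of_int m, of_int n)) \<partial>cint \<partial>cint) \<partial>lborel)"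
proof -
  interpret c: sigma_finite_measure cint by (rule sigma_finite_measure_count_space)
  have "(\<integral>\<^sup>+p. f p \<partial>lborel) = (\<integral>\<^sup>+x. \<integral>\<^sup>+y. f (x, y) \<partial>lborel \<partial>lborel)"
    unfolding lborel_prod[symmetric] by (subst lborel.nn_integral_fst) (auto simp: borel_prod lborel_prod)
  also have "\<dots> = (\<integral>\<^sup>+x. \<integral>\<^sup>+y. indicator {0..<1} y * (\<integral>\<^sup>+n. f (x, y + of_int n) \<partial>cint) \<partial>lborel \<partial>lborel)"
    by (intro nn_integral_cong nn_integral_unfold_interval_sum) measurable
  also have "\<dots> = (\<integral>\<^sup>+x. indicator {0..<1} x * (\<integral>\<^sup>+m. \<integral>\<^sup>+y. indicator {0..<1} y * (\<integral>\<^sup>+n. f (x + of_int m, y + of_int n) \<partial>cint) \<partial>lborel \<partial>cint) \<partial>lborel)"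
    by (rule nn_integral_unfold_interval_sum) measurable
  also have "\<dots> = (\<integral>\<^sup>+x. indicator {0..<1} x * (\<integral>\<^sup>+y. \<integral>\<^sup>+m. indicator {0..<1} y * (\<integral>\<^sup>+n. f (x + of_int m, y + of_int n) \<partial>cint) \<partial>cint \<partial>lborel) \<partial>lborel)"
    by (intro nn_integral_cong arg_cong2[where f="(*)"] refl lborel_cint.Fubini') measurable
  also have "\<dots> = (\<integral>\<^sup>+x. \<integral>\<^sup>+y. indicator unit_cell (x, y) * (\<integral>\<^sup>+m. \<integral>\<^sup>+n. f ((x, y) + (of_int m, of_int n)) \<partial>cint \<partial>cint) \<partial>lborel \<partial>lborel)"
    by (subst nn_integral_cmult[symmetric]) (auto simp: nn_integral_cmult indicator_times mult.assoc intro!: nn_integral_cong)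
  also have "\<dots> = (\<integral>\<^sup>+p. indicator unit_cell p * (\<integral>\<^sup>+m. \<integral>\<^sup>+n. f (p + (of_int m, of_int n)) \<partial>cint \<partial>cint) \<partial>lborel)"
    unfolding lborel_prod[symmetric] by (subst lborel.nn_integral_fst[symmetric]) (auto simp: borel_prod lborel_prod)
  finally show ?thesis .
qed

lemma nn_integral_lborel_reflect:
  fixes f :: "'a::euclidean_space \<Rightarrow> ennreal"
  assumes [measurable]: "f \<in> borel_measurable borel"
  shows "(\<integral>\<^sup>+p. f (b - p) \<partial>lborel) = (\<integral>\<^sup>+p. f p \<partial>lborel)"
proof -
  have eq: "lborel = distr lborel borel (\<lambda>x. b - x)"
    using lborel_affine[of "-1" b] by (simp add: density_1)
  show ?thesis by (subst (2) eq, subst nn_integral_distr) auto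
qed

text \<open>A union bound: the right side counts all lattice translates of \<open>p\<close> that lie
  in \<open>E\<close>.\<close>

lemma indicator_lattice_hull_le:
  "(indicator (lattice_hull E) p :: ennreal) \<le> (\<integral>\<^sup>+m. \<integral>\<^sup>+n. indicator E (p + (of_int m, of_int n)) \<partial>cint \<partial>cint)"
proof (cases "p \<in> lattice_hull E")
  case True
  then obtain m0 n0 :: int where mn: "p + (of_int m0, of_int n0) \<in> E" by (auto simp: lattice_hull_def)
  have "(1::ennreal) = (\<integral>\<^sup>+m. \<integral>\<^sup>+n. indicator {m0} m * indicator {n0} n \<partial>cint \<partial>cint)"
    by (simp add: nn_integral_cmult nn_integral_multc)
  also have "\<dots> \<le> (\<integral>\<^sup>+m. \<integral>\<^sup>+n. indicator E (p + (of_int m, of_int n)) \<partial>cint \<partial>cint)"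
    by (intro nn_integral_mono) (use mn in \<open>auto simp: indicator_def\<close>)
  finally show ?thesis using True by simp
qed simp

text \<open>The count of lattice translates in \<open>E\<close> unfolds to the measure of
  \<open>E\<close>, whatever the translation or reflection. In \<open>diagonal_selection\<close> the
  first form tests a new \<open>b\<close> against an old \<open>a\<close>, the second a new
  \<open>a\<close> against an old \<open>b\<close>.\<close>

lemma nn_integral_cell_lattice_hull_le:
  assumes [measurable]: "E \<in> sets borel"
  shows "(\<integral>\<^sup>+p. indicator unit_cell p * indicator (lattice_hull E) (p + t) \<partial>lborel) \<le> emeasure lborel E"
    and "(\<integral>\<^sup>+p. indicator unit_cell p * indicator (lattice_hull E) (t - p) \<partial>lborel) \<le> emeasure lborel E"
proof -
  have "(\<integral>\<^sup>+p. indicator unit_cell p * indicator (lattice_hull E) (p + t) \<partial>lborel) \<le>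
    (\<integral>\<^sup>+p. indicator unit_cell p * (\<integral>\<^sup>+m. \<integral>\<^sup>+n. indicator E (p + (of_int m, of_int n) + t) \<partial>cint \<partial>cint) \<partial>lborel)"
    using indicator_lattice_hull_le[of E "_ + t"] by (intro nn_integral_mono mult_left_mono) (auto simp: algebra_simps)
  also have "\<dots> = (\<integral>\<^sup>+p. indicator E (p + t) \<partial>lborel)"
    by (rule nn_integral_unfold_cell[symmetric]) measurable
  also have "\<dots> = emeasure lborel E"
    by (subst nn_integral_lborel_translate) auto
  finally show "(\<integral>\<^sup>+p. indicator unit_cell p * indicator (lattice_hull E) (p + t) \<partial>lborel) \<le> emeasure lborel E" .
  have flip: "(\<integral>\<^sup>+m. \<integral>\<^sup>+n. indicator E (q + (of_int m, of_int n)) \<partial>cint \<partial>cint) =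
     (\<integral>\<^sup>+m. \<integral>\<^sup>+n. (indicator E (q - (of_int m, of_int n)) :: ennreal) \<partial>cint \<partial>cint)" for q
  proof -
    have bij: "bij_betw uminus (UNIV::int set) UNIV"
      by (rule bij_betwI[where g = uminus]) auto
    have "(\<integral>\<^sup>+m. \<integral>\<^sup>+n. indicator E (q + (of_int m, of_int n)) \<partial>cint \<partial>cint) =
      (\<integral>\<^sup>+m. \<integral>\<^sup>+n. (indicator E (q + (of_int (- m), of_int n)) :: ennreal) \<partial>cint \<partial>cint)"
      by (rule nn_integral_bij_count_space[OF bij, symmetric])
    also have "\<dots> = (\<integral>\<^sup>+m. \<integral>\<^sup>+n. indicator E (q + (of_int (- m), of_int (- n))) \<partial>cint \<partial>cint)"
      by (intro nn_integral_cong nn_integral_bij_count_space[OF bij, symmetric])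
    also have "\<dots> = (\<integral>\<^sup>+m. \<integral>\<^sup>+n. indicator E (q - (of_int m, of_int n)) \<partial>cint \<partial>cint)"
      by (simp only: diff_conv_add_uminus uminus_Pair of_int_minus)
    finally show ?thesis .
  qed
  have "(\<integral>\<^sup>+p. indicator unit_cell p * indicator (lattice_hull E) (t - p) \<partial>lborel) \<le>
    (\<integral>\<^sup>+p. indicator unit_cell p * (\<integral>\<^sup>+m. \<integral>\<^sup>+n. indicator E (t - (p + (of_int m, of_int n))) \<partial>cint \<partial>cint) \<partial>lborel)"
    using indicator_lattice_hull_le[of E "t - _"] unfolding flip
    by (intro nn_integral_mono mult_left_mono) (auto simp: algebra_simps)
  also have "\<dots> = (\<integral>\<^sup>+p. indicator E (t - p) \<partial>lborel)"
    by (rule nn_integral_unfold_cell[symmetric]) measurable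
  also have "\<dots> = emeasure lborel E"
    by (subst nn_integral_lborel_reflect) auto
  finally show "(\<integral>\<^sup>+p. indicator unit_cell p * indicator (lattice_hull E) (t - p) \<partial>lborel) \<le> emeasure lborel E" .
qed

text \<open>The number of lattice translates of \<open>p\<close> in \<open>S\<close> has integral
  \<open>emeasure lborel S\<close> over the unit cell, hence is finite for almost every
  \<open>p\<close> there. Other points are moved into the cell, which only renumbers their
  translates.\<close>

lemma AE_finite_lattice_points:
  fixes S :: "plane set"
  assumes [measurable]: "S \<in> sets borel" and fin: "emeasure lborel S < \<infinity>"
  shows "AE p in lborel. finite {y :: int \<times> int. p + (of_int (fst y), of_int (snd y)) \<in> S}"
proof -
  let ?v = "\<lambda>z :: int \<times> int. (real_of_int (fst z), real_of_int (snd z))"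
  let ?A = "\<lambda>p. {y. p + ?v y \<in> S}"
  let ?N = "\<lambda>p :: plane. (\<integral>\<^sup>+m. \<integral>\<^sup>+n. indicator S (p + (of_int m, of_int n)) \<partial>cint \<partial>cint)"
  have "(\<integral>\<^sup>+p. indicator unit_cell p * ?N p \<partial>lborel) = emeasure lborel S"
    by (subst nn_integral_unfold_cell[symmetric]) auto
  then have "AE p in lborel. indicator unit_cell p * ?N p \<noteq> \<infinity>"
    using fin by (intro nn_integral_PInf_AE) auto
  then have cell: "AE p in lborel. p \<in> unit_cell \<longrightarrow> finite (?A p)"
  proof eventually_elim
    case (elim p)
    show ?case
    proof
      assume "p \<in> unit_cell"
      then have "?N p \<noteq> \<infinity>" using elim by simp
      moreover have "?N p = (\<integral>\<^sup>+z. indicator (?A p) z \<partial>count_space UNIV)"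
        by (subst nn_integral_fst_count_space[symmetric]) (auto simp: indicator_def intro!: nn_integral_cong)
      ultimately show "finite (?A p)"
        by (auto simp: emeasure_count_space split: if_splits)
    qed
  qed
  have "AE p in lborel. \<forall>z :: int \<times> int. p + ?v z \<in> unit_cell \<longrightarrow>
      finite (?A (p + ?v z))"
    unfolding AE_all_countable using AE_lborel_translate[OF cell] by blast
  then show ?thesis
  proof eventually_elim
    case (elim p)
    define z :: "int \<times> int" where "z = (- \<lfloor>fst p\<rfloor>, - \<lfloor>snd p\<rfloor>)"
    have "p + ?v z \<in> unit_cell"
      by (cases p) (simp add: z_def; linarith)
    then have "finite (?A (p + ?v z))"
      by (rule elim[rule_format])
    then have "finite ((\<lambda>y. (fst y + fst z, snd y + snd z)) ` ?A (p + ?v z))"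
      by (rule finite_imageI)
    moreover have "?A p \<subseteq>
      (\<lambda>y. (fst y + fst z, snd y + snd z)) ` ?A (p + ?v z)"
    proof safe
      fix m n :: int assume "p + (of_int (fst (m, n)), of_int (snd (m, n))) \<in> S"
      then have *: "p + (of_int m, of_int n) \<in> S" by simp
      have "(m - fst z, n - snd z) \<in> ?A (p + ?v z)"
        using * by (simp add: add.assoc)
      then show "(m, n) \<in> (\<lambda>y. (fst y + fst z, snd y + snd z)) ` ?A (p + ?v z)"
        by (rule rev_image_eqI) simp
    qed
    ultimately show ?case by (rule finite_subset[rotated])
  qed
qed

text \<open>Given \<open>b - a \<in> E\<close>, the point \<open>a\<close> is still uniformly distributed modulo the lattice, so a new
  pair meets each earlier one in \<open>lattice_hull E\<close> with conditional probability at most twice the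
  measure of \<open>E\<close>.\<close>

lemma diagonal_selection:
  fixes E :: "plane set" and Good :: "plane \<Rightarrow> plane \<Rightarrow> bool"
  assumes E [measurable]: "E \<in> sets borel" and pos: "emeasure lborel E > 0"
    and small: "emeasure lborel E * ennreal (2 * real M) < 1"
    and good: "AE p in lborel. Good (fst p) (snd p)"
  shows "\<exists>a b :: nat \<Rightarrow> plane. \<forall>i<M. \<forall>j<M.
     Good (a i) (b j) \<and> (if i = j then b j - a i \<in> E else b j - a i \<notin> lattice_hull E)"
proof -
  let ?Q = "\<lambda>(a :: nat \<Rightarrow> plane) (b :: nat \<Rightarrow> plane) i j. Good (a i) (b j) \<and> (if i = j then b j - a i \<in> E else b j - a i \<notin> lattice_hull E)"
  \<comment> \<open>Conditions for the future: an \<open>a\<close> or \<open>b\<close> is only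
    chosen if almost every later partner is good with it.\<close>
  define G1 where "G1 a \<longleftrightarrow> (AE q in lborel. Good a q)" for a
  define G2 where "G2 b \<longleftrightarrow> (AE p in lborel. Good p b)" for b
  define e where "e = emeasure lborel E"
  have G1: "AE a in lborel. G1 a" unfolding G1_def using AE_lborel_pairD[OF good] by simp
  have G2: "AE b in lborel. G2 b" unfolding G2_def using AE_lborel_pairD[OF AE_lborel_swap[OF good]] by simp
  have "k \<le> M \<Longrightarrow> \<exists>a b :: nat \<Rightarrow> plane. (\<forall>i<k. G1 (a i) \<and> G2 (b i)) \<and> (\<forall>i<k. \<forall>j<k.
     ?Q a b i j)" for k
  proof (induction k)
    case (Suc k)
    from Suc.IH[OF Suc_leD[OF Suc.prems]] obtain a b where ab0: "\<forall>i<k. G1 (a i) \<and> G2 (b i)"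
      "\<forall>i<k. \<forall>j<k. ?Q a b i j"
      by blast
    then have ab: "\<And>i. i < k \<Longrightarrow> G1 (a i) \<and> G2 (b i)"
      "\<And>i j. i < k \<Longrightarrow> j < k \<Longrightarrow> ?Q a b i j"
      by blast+
    have sh: "AE p in lborel. P (fst p, snd p + fst p)" if "AE p in lborel. P p"
      for P :: "plane \<times> plane \<Rightarrow> bool"
      using AE_lborel_shear[of "\<lambda>x. x" P] that by simp
    \<comment> \<open>A candidate \<open>(p, w)\<close> stands for the new pair \<open>a = p\<close>
      and \<open>b = w + p\<close>, so that \<open>b - a = w\<close> lies in \<open>E\<close>; by
      shear invariance almost every candidate is good. \<open>B1\<close> and \<open>B2\<close>
      collect the candidates whose \<open>b\<close>, respectively \<open>a\<close>, clashes with the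
      old index \<open>i\<close>.\<close>
    define X where "X = unit_cell \<times> E"
    define B1 where "B1 i = {z. z \<in> X \<and> snd z + fst z - a i \<in> lattice_hull E}" for i
    define B2 where "B2 i = {z. z \<in> X \<and> b i - fst z \<in> lattice_hull E}" for i
    have [measurable]: "X \<in> sets borel" unfolding X_def by measurable
    have [measurable]: "B1 i \<in> sets borel" "B2 i \<in> sets borel" for i
      unfolding B1_def B2_def by measurable
    have fub: "emeasure lborel S = (\<integral>\<^sup>+w. \<integral>\<^sup>+p. indicator S (p, w) \<partial>lborel \<partial>lborel)"
      if [measurable]: "S \<in> sets borel" for S :: "(plane \<times> plane) set"
    proof -
      have "(\<integral>\<^sup>+w. \<integral>\<^sup>+p. indicator S (p, w) \<partial>lborel \<partial>lborel) = (\<integral>\<^sup>+z. indicator S z \<partial>(lborel \<Otimes>\<^sub>M lborel))"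
        by (rule lborel_pair.nn_integral_snd) (simp add: lborel_prod)
      then show ?thesis by (simp add: lborel_prod)
    qed
    have cellm: "emeasure lborel unit_cell = 1"
    proof -
      have "emeasure (lborel \<Otimes>\<^sub>M lborel) unit_cell = 1" by (subst lborel.emeasure_pair_measure_Times) auto
      then show ?thesis by (simp add: lborel_prod)
    qed
    have eX: "emeasure lborel X = e"
    proof -
      have "indicator X (p, w) = (indicator E w * indicator unit_cell p :: ennreal)" for p w
        by (auto simp: X_def indicator_def)
      then have "emeasure lborel X = (\<integral>\<^sup>+w. \<integral>\<^sup>+p. indicator E w * indicator unit_cell p \<partial>lborel \<partial>lborel)"
        by (simp only: fub[OF \<open>X \<in> sets borel\<close>])
      also have "\<dots> = (\<integral>\<^sup>+w. indicator E w * emeasure lborel unit_cell \<partial>lborel)"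
        by (subst nn_integral_cmult_indicator) auto
      also have "\<dots> = e" unfolding cellm e_def by simp
      finally show ?thesis .
    qed
    have eB: "emeasure lborel Y \<le> e * e"
      if [measurable]: "Y \<in> sets borel" and Y: "\<And>p w. indicator Y (p, w) = (indicator E w * k w p :: ennreal)"
        and k: "\<And>w. k w \<in> borel_measurable borel" "\<And>w. (\<integral>\<^sup>+p. k w p \<partial>lborel) \<le> e" for Y :: "(plane \<times> plane) set" and k
    proof -
      have "emeasure lborel Y = (\<integral>\<^sup>+w. indicator E w * (\<integral>\<^sup>+p. k w p \<partial>lborel) \<partial>lborel)"
        unfolding fub[OF \<open>Y \<in> sets borel\<close>] Y using k(1) by (simp add: nn_integral_cmult)
      also have "\<dots> \<le> (\<integral>\<^sup>+w. indicator E w * e \<partial>lborel)"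
        by (intro nn_integral_mono mult_left_mono k(2)) auto
      also have "\<dots> = e * e" by (simp add: nn_integral_multc e_def)
      finally show ?thesis .
    qed
    have eB1: "emeasure lborel (B1 i) \<le> e * e" for i
    proof (rule eB)
      let ?k = "\<lambda>w p. indicator unit_cell p * (indicator (lattice_hull E) (p + (w - a i)) :: ennreal)"
      show "indicator (B1 i) (p, w) = indicator E w * ?k w p" for p w
        by (auto simp: B1_def X_def indicator_def algebra_simps)
      show "?k w \<in> borel_measurable borel" for w by measurable
      show "(\<integral>\<^sup>+p. ?k w p \<partial>lborel) \<le> e" for w
        unfolding e_def by (rule nn_integral_cell_lattice_hull_le[OF E])
    qed measurable
    have eB2: "emeasure lborel (B2 i) \<le> e * e" for i
    proof (rule eB)
      let ?k = "\<lambda>w p. indicator unit_cell p * (indicator (lattice_hull E) (b i - p) :: ennreal)"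
      show "indicator (B2 i) (p, w) = indicator E w * ?k w p" for p w
        by (auto simp: B2_def X_def indicator_def algebra_simps)
      show "?k w \<in> borel_measurable borel" for w by measurable
      show "(\<integral>\<^sup>+p. ?k w p \<partial>lborel) \<le> e" for w
        unfolding e_def by (rule nn_integral_cell_lattice_hull_le[OF E])
    qed measurable
    \<comment> \<open>Each of the \<open>2 * k\<close> bad sets has measure at most
      \<open>e * e\<close>, so together they have less than the measure \<open>e\<close> of
      \<open>X\<close>; this is the purpose of the factor \<open>2 * real M\<close> in
      \<open>small\<close>.\<close>
    define B where "B = (\<Union>i<k. B1 i \<union> B2 i)"
    have [measurable]: "B \<in> sets borel" unfolding B_def by measurable
    \<comment> \<open>Here \<open>Suc k \<le> M\<close> makes the factor in \<open>small\<close>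
      nonzero, which rules out infinite measure.\<close>
    have efin: "e < \<infinity>"
    proof (rule ccontr)
      assume "\<not> e < \<infinity>"
      then have "e = \<infinity>" by (simp add: less_top[symmetric])
      then show False using small Suc.prems by (simp add: e_def[symmetric] ennreal_top_mult)
    qed
    have "emeasure lborel B \<le> (\<Sum>i<k. emeasure lborel (B1 i \<union> B2 i))"
      unfolding B_def by (rule emeasure_subadditive_finite) auto
    also have "\<dots> \<le> (\<Sum>i<k. e * e + e * e)"
      by (intro sum_mono order_trans[OF emeasure_subadditive] add_mono eB1 eB2) auto
    also have "\<dots> = e * (e * ennreal (2 * real k))"
    proof -
      obtain r where r: "e = ennreal r" "r \<ge> 0" using efin by (cases e) auto
      show ?thesis unfolding r(1) using r(2)
        by (simp add: ennreal_mult[symmetric] ennreal_plus[symmetric] ennreal_of_nat_eq_real_of_nat algebra_simps del: ennreal_plus)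
    qed
    also have "\<dots> < e"
    proof -
      have "e * ennreal (2 * real k) \<le> e * ennreal (2 * real M)"
        using Suc.prems by (intro mult_left_mono ennreal_leI) auto
      then have "e * ennreal (2 * real k) < 1" using small unfolding e_def by (rule le_less_trans)
      then have "e * (e * ennreal (2 * real k)) < e * 1"
        using pos efin by (intro ennreal_mult_strict_left_mono) (auto simp: e_def)
      then show ?thesis by simp
    qed
    finally have less: "emeasure lborel B < emeasure lborel X" by (simp add: eX)
    have "\<not> (AE z in lborel. \<not> (z \<in> X \<and> z \<notin> B))"
    proof
      assume "AE z in lborel. \<not> (z \<in> X \<and> z \<notin> B)"
      then have "emeasure lborel X \<le> emeasure lborel B"
        by (intro emeasure_mono_AE) (auto elim!: eventually_mono)
      with less show False by simp
    qed
    moreover have n1: "AE z in lborel. Good (fst z) (snd z + fst z)" using sh[OF good] by simp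
    have n2: "AE z in lborel. \<forall>i\<in>{..<k}. Good (a i) (snd z + fst z)"
    proof (intro AE_finite_allI)
      fix i assume "i \<in> {..<k}"
      then have "AE q in lborel. Good (a i) q" using ab(1) by (auto simp: G1_def)
      from sh[OF AE_lborel_snd[OF this]] show "AE z in lborel. Good (a i) (snd z + fst z)" by simp
    qed simp
    have n3: "AE z in (lborel :: (plane \<times> plane) measure). \<forall>i\<in>{..<k}. Good (fst z) (b i)"
    proof (intro AE_finite_allI)
      fix i assume "i \<in> {..<k}"
      then have "AE q in lborel. Good q (b i)" using ab(1) by (auto simp: G2_def)
      from AE_lborel_fst[OF this] show "AE z in (lborel :: (plane \<times> plane) measure). Good (fst z) (b i)" .
    qed simp
    have n4: "AE z in (lborel :: (plane \<times> plane) measure). G1 (fst z)" by (rule AE_lborel_fst[OF G1])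
    have n5: "AE z in lborel. G2 (snd z + fst z)" using sh[OF AE_lborel_snd[OF G2]] by simp
    ultimately obtain z where z: "z \<in> X" "z \<notin> B" "Good (fst z) (snd z + fst z)"
      "\<forall>i\<in>{..<k}. Good (a i) (snd z + fst z)" "\<forall>i\<in>{..<k}. Good (fst z) (b i)" "G1 (fst z)" "G2 (snd z + fst z)"
    proof -
      assume *: "\<And>z. \<lbrakk>z \<in> X; z \<notin> B; Good (fst z) (snd z + fst z); \<forall>i\<in>{..<k}. Good (a i) (snd z + fst z);
        \<forall>i\<in>{..<k}. Good (fst z) (b i); G1 (fst z); G2 (snd z + fst z)\<rbrakk> \<Longrightarrow> thesis"
      show thesis
      proof (rule ccontr)
        assume "\<not> thesis"
        from n1 n2 n3 n4 n5 have "AE z in lborel. \<not> (z \<in> X \<and> z \<notin> B)"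
          by eventually_elim (use * \<open>\<not> thesis\<close> in blast)
        with \<open>\<not> (AE z in lborel. \<not> (z \<in> X \<and> z \<notin> B))\<close> show False by simp
      qed
    qed
    define a' where "a' = a(k := fst z)"
    define b' where "b' = b(k := snd z + fst z)"
    have "snd z \<in> E" using z(1) by (auto simp: X_def)
    moreover have "snd z + fst z - a i \<notin> lattice_hull E" "b i - fst z \<notin> lattice_hull E" if "i < k" for i
      using z(1,2) that by (auto simp: B_def B1_def B2_def)
    ultimately have "(\<forall>i<Suc k. G1 (a' i) \<and> G2 (b' i)) \<and> (\<forall>i<Suc k. \<forall>j<Suc k.
     ?Q a' b' i j)"
      using ab z(3-) by (auto simp: a'_def b'_def less_Suc_eq)
    then show ?case by blast
  qed auto
  from this[of M] show ?thesis by blast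
qed

section \<open>The Zak transform of a finite rank kernel\<close>

lemma cint_pair: "cint \<Otimes>\<^sub>M cint = count_space (UNIV :: (int \<times> int) set)"
  using pair_measure_countable[of "UNIV :: int set" "UNIV :: int set"] by simp

text \<open>Sends \<open>(n, l)\<close> to \<open>(l, l + n)\<close>, so that a double sum over
  \<open>(l, k)\<close> is grouped by the difference \<open>n = k - l\<close>, which becomes the
  exponent of the trigonometric polynomial.\<close>

lemma bij_betw_diagonal: "bij_betw (\<lambda>z. (snd z, snd z + fst z)) UNIV (UNIV :: (int \<times> int) set)"
  by (rule bij_betwI[where g = "\<lambda>z. (snd z - fst z, fst z)"]) auto

lemma integrable_cint_prod:
  fixes a b :: "int \<Rightarrow> complex"
  assumes "integrable cint a" "integrable cint b"
  shows "integrable (count_space UNIV) (\<lambda>z :: int \<times> int. a (fst z) * b (snd z))"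
proof -
  have "integrable (cint \<Otimes>\<^sub>M cint) (\<lambda>z. a (fst z) * b (snd z))"
  proof (rule cint_cint.Fubini_integrable)
    show "(\<lambda>z. a (fst z) * b (snd z)) \<in> borel_measurable (cint \<Otimes>\<^sub>M cint)" by (simp add: cint_pair)
    show "integrable cint (\<lambda>x. LINT y|cint. norm (a (fst (x, y)) * b (snd (x, y))))"
      using assms by (simp add: norm_mult)
    show "AE x in cint. integrable cint (\<lambda>y. a (fst (x, y)) * b (snd (x, y)))"
      using assms by simp
  qed
  then show ?thesis by (simp add: cint_pair)
qed

text \<open>One diagonal of an absolutely summable product family. This is the source of the
  summability that \<open>poisson_summation\<close> asks for.\<close>

lemma integrable_cint_diagonal:
  fixes a b :: "int \<Rightarrow> complex"
  assumes "integrable cint a" "integrable cint b"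
  shows "integrable cint (\<lambda>l. a l * b (l + n))"
proof -
  have "integrable (count_space UNIV) (\<lambda>z :: int \<times> int. a (snd z) * b (snd z + fst z))"
    using integrable_bij_count_space[OF bij_betw_diagonal, of "\<lambda>z. a (fst z) * b (snd z)"]
      integrable_cint_prod[OF assms] by simp
  then have "integrable (cint \<Otimes>\<^sub>M cint) (\<lambda>(n, l). a l * b (l + n))"
    by (simp add: cint_pair case_prod_beta')
  from cint_cint.AE_integrable_fst[OF this] show ?thesis by (simp add: AE_count_space)
qed

text \<open>At \<open>y = \<eta> - \<xi>\<close> this is the kernel K(\<xi>, \<eta>) of the
  overview.\<close>

definition partial_ft :: "(plane \<Rightarrow> complex) \<Rightarrow> real \<Rightarrow> real \<Rightarrow> complex" where
  "partial_ft f \<xi> y = (LINT x|lborel. f (x, y) * cis (2 * pi * \<xi> * x))"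

text \<open>The modulated sum of \<open>f\<close> over row \<open>n\<close> of the lattice through
  \<open>w\<close>. Up to a phase it is the coefficient with exponent \<open>n\<close> of the
  trigonometric polynomial.\<close>

definition periodized :: "(plane \<Rightarrow> complex) \<Rightarrow> real \<Rightarrow> plane \<Rightarrow> int \<Rightarrow> complex" where
  "periodized f \<xi> w n = (LINT m|cint. f (w + (of_int m, of_int n)) * cis (2 * pi * \<xi> * (fst w + of_int m)))"

text \<open>Gathers what holds at all integer shifts of (\<xi>, \<eta>) at once, so that the Zak
  computation can be done pointwise.\<close>

definition lattice_kernel ::
  "(plane \<Rightarrow> complex) \<Rightarrow> (nat \<Rightarrow> real \<Rightarrow> complex) \<Rightarrow> (nat \<Rightarrow> real \<Rightarrow> complex) \<Rightarrow> nat \<Rightarrow> real \<Rightarrow> real \<Rightarrow> bool" where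
  "lattice_kernel f u v N \<xi> \<eta> \<longleftrightarrow>
    (\<forall>k<N. integrable cint (\<lambda>l. u k (\<xi> + of_int l)) \<and> integrable cint (\<lambda>l. v k (\<eta> + of_int l))) \<and>
    (\<forall>l k :: int. partial_ft f (\<xi> + of_int l) (\<eta> + of_int k - (\<xi> + of_int l)) =
      (\<Sum>j<N. u j (\<xi> + of_int l) * v j (\<eta> + of_int k)))"

text \<open>In the product of the Zak transforms of \<open>u j\<close> at \<alpha> and
  \<open>v j\<close> at \<beta>, group the terms by \<open>n = k - l\<close>. The phases satisfy
  \<open>l * \<alpha> - (l + n) * \<beta> = - l * (\<beta> - \<alpha>) - n * \<beta>\<close>, so the
  sum over \<open>l\<close> is the Poisson series of row \<open>n\<close> at \<open>w\<close>, and
  \<beta> alone remains outside. Shifting \<alpha> and \<beta> together keeps \<open>w\<close> and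
  varies only the outer phases.\<close>

lemma zak_identity:
  fixes \<alpha> \<beta> :: real
  assumes lk: "lattice_kernel f u v N \<xi> \<eta>"
    and per: "\<And>n. periodized f \<xi> w n =
      (LINT l|cint. partial_ft f (\<xi> + of_int l) (snd w + of_int n) * cis (- (2 * pi * of_int l * fst w)))"
    and w: "w = (\<beta> - \<alpha>, \<eta> - \<xi>)"
  shows "(\<Sum>j<N. (LINT l|cint. u j (\<xi> + of_int l) * cis (2 * pi * of_int l * \<alpha>)) *
      (LINT k|cint. v j (\<eta> + of_int k) * cis (- (2 * pi * of_int k * \<beta>)))) =
    (LINT n|cint. periodized f \<xi> w n * cis (- (2 * pi * of_int n * \<beta>)))"
proof -
  define a where "a j l = u j (\<xi> + of_int l) * cis (2 * pi * of_int l * \<alpha>)" for j and l :: int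
  define b where "b j k = v j (\<eta> + of_int k) * cis (- (2 * pi * of_int k * \<beta>))" for j and k :: int
  define A where "A z = (\<Sum>j<N. a j (fst z) * b j (snd z))" for z :: "int \<times> int"
  have ai: "integrable cint (a j)" "integrable cint (b j)" if "j < N" for j
    using lk that unfolding a_def b_def lattice_kernel_def by auto
  have Ai: "integrable (count_space UNIV) A"
    unfolding A_def by (intro Bochner_Integration.integrable_sum integrable_cint_prod ai) auto
  have A2: "integrable (cint \<Otimes>\<^sub>M cint) (\<lambda>(l, k). A (l, k))" using Ai by (simp add: cint_pair)
  have A3: "integrable (cint \<Otimes>\<^sub>M cint) (\<lambda>(n, l). A (l, l + n))"
    using integrable_bij_count_space[OF bij_betw_diagonal, of A] Ai by (simp add: cint_pair case_prod_beta')
  have "(\<Sum>j<N. (LINT l|cint. a j l) * (LINT k|cint. b j k)) = (\<Sum>j<N. (LINT l|cint. a j l * (LINT k|cint. b j k)))"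
    by simp
  also have "\<dots> = (LINT l|cint. (\<Sum>j<N. a j l * (LINT k|cint. b j k)))"
    by (rule Bochner_Integration.integral_sum[symmetric]) (use ai in auto)
  also have "\<dots> = (LINT l|cint. LINT k|cint. A (l, k))"
    unfolding A_def by (intro Bochner_Integration.integral_cong refl)
      (subst Bochner_Integration.integral_sum, use ai in auto)
  also have "\<dots> = (LINT z|count_space UNIV. A z)"
    using cint_cint.integral_fst[OF A2] by (simp add: cint_pair case_prod_beta')
  also have "\<dots> = (LINT z|count_space UNIV. A (snd z, snd z + fst z))"
    by (rule integral_bij_count_space[OF bij_betw_diagonal, symmetric])
  also have "\<dots> = (LINT n|cint. LINT l|cint. A (l, l + n))"
    using cint_cint.integral_fst[OF A3] by (simp add: cint_pair case_prod_beta')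
  also have "\<dots> = (LINT n|cint. periodized f \<xi> w n * cis (- (2 * pi * of_int n * \<beta>)))"
  proof (rule Bochner_Integration.integral_cong[OF refl])
    fix n :: int
    have "A (l, l + n) = partial_ft f (\<xi> + of_int l) (snd w + of_int n) *
      cis (- (2 * pi * of_int l * fst w)) * cis (- (2 * pi * of_int n * \<beta>))" for l
    proof -
      have c: "cis (2 * pi * of_int l * \<alpha>) * cis (- (2 * pi * of_int (l + n) * \<beta>)) =
        cis (- (2 * pi * of_int l * fst w)) * cis (- (2 * pi * of_int n * \<beta>))"
        by (simp add: cis_mult w algebra_simps)
      have y: "snd w + of_int n = \<eta> + of_int (l + n) - (\<xi> + of_int l)" by (simp add: w)
      have "A (l, l + n) = (\<Sum>j<N. u j (\<xi> + of_int l) * v j (\<eta> + of_int (l + n))) *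
         (cis (2 * pi * of_int l * \<alpha>) * cis (- (2 * pi * of_int (l + n) * \<beta>)))"
        unfolding A_def a_def b_def sum_distrib_right by (intro sum.cong) (simp_all add: mult_ac)
      also have "(\<Sum>j<N. u j (\<xi> + of_int l) * v j (\<eta> + of_int (l + n))) = partial_ft f (\<xi> + of_int l) (snd w + of_int n)"
        unfolding y using lk unfolding lattice_kernel_def by metis
      finally show ?thesis unfolding c by (simp add: mult.assoc)
    qed
    then show "(LINT l|cint. A (l, l + n)) = periodized f \<xi> w n * cis (- (2 * pi * of_int n * \<beta>))"
      unfolding per by (subst integral_mult_left_zero[symmetric]) (simp only:)
  qed
  finally show ?thesis unfolding a_def b_def .
qed

text \<open>After division by the term of lowest frequency \<open>m0\<close> the sum is a polynomial
  in \<open>cis (2 * pi * \<xi>)\<close> with constant coefficient \<open>c m0\<close>. It has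
  finitely many roots, each attained at countably many \<xi>.\<close>

lemma AE_exp_sum_neq_0:
  fixes c :: "int \<Rightarrow> complex"
  assumes A: "finite A" "A \<noteq> {}" "\<And>m. m \<in> A \<Longrightarrow> c m \<noteq> 0"
  shows "AE \<xi> in lborel. (\<Sum>m\<in>A. c m * cis (2 * pi * of_int m * \<xi>)) \<noteq> 0"
proof -
  define m0 where "m0 = Min A"
  have m0: "m0 \<in> A" "\<And>m. m \<in> A \<Longrightarrow> m0 \<le> m" using A by (auto simp: m0_def)
  define P where "P = (\<Sum>m\<in>A. monom (c m) (nat (m - m0)))"
  have "coeff P 0 = (\<Sum>m\<in>A. if nat (m - m0) = 0 then c m else 0)"
    by (simp add: P_def coeff_sum if_distrib cong: if_cong)
  also have "\<dots> = (\<Sum>m\<in>{m0}. if nat (m - m0) = 0 then c m else 0)"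
    by (rule sum.mono_neutral_right) (use A m0 in force)+
  finally have "coeff P 0 \<noteq> 0" using A(3) m0 by simp
  then have "P \<noteq> 0" by auto
  then have fin: "finite {z. poly P z = 0}" by (rule poly_roots_finite)
  have cnt: "countable {\<xi>. cis (2 * pi * \<xi>) = z}" for z
  proof (cases "\<exists>\<xi>0. cis (2 * pi * \<xi>0) = z")
    case True
    then obtain \<xi>0 where \<xi>0: "cis (2 * pi * \<xi>0) = z" by blast
    have "{\<xi>. cis (2 * pi * \<xi>) = z} \<subseteq> range (\<lambda>n::int. \<xi>0 + of_int n)"
    proof
      fix \<xi> assume "\<xi> \<in> {\<xi>. cis (2 * pi * \<xi>) = z}"
      then have "sin (2 * pi * \<xi>) = sin (2 * pi * \<xi>0) \<and> cos (2 * pi * \<xi>) = cos (2 * pi * \<xi>0)"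
        using \<xi>0 by (auto simp: complex_eq_iff)
      then obtain n :: int where "2 * pi * \<xi> = 2 * pi * \<xi>0 + 2 * pi * n"
        using sin_cos_eq_iff[of "2 * pi * \<xi>" "2 * pi * \<xi>0"] by blast
      then have "2 * pi * \<xi> = 2 * pi * (\<xi>0 + n)" by (simp add: algebra_simps)
      then have "\<xi> = \<xi>0 + n" by simp
      then show "\<xi> \<in> range (\<lambda>n::int. \<xi>0 + of_int n)" by blast
    qed
    then show ?thesis by (rule countable_subset) simp
  next
    case False
    then have "{\<xi>. cis (2 * pi * \<xi>) = z} = {}" by blast
    then show ?thesis by simp
  qed
  have "countable (\<Union>z\<in>{z. poly P z = 0}. {\<xi>. cis (2 * pi * \<xi>) = z})"
    by (intro countable_UN countable_finite fin cnt)
  then have "AE \<xi> in lborel. \<xi> \<notin> (\<Union>z\<in>{z. poly P z = 0}. {\<xi>. cis (2 * pi * \<xi>) = z})"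
    by (intro AE_not_in countable_imp_null_set_lborel)
  then show ?thesis
  proof eventually_elim
    case (elim \<xi>)
    have "poly P (cis (2 * pi * \<xi>)) = (\<Sum>m\<in>A. c m * cis (2 * pi * of_int m * \<xi>)) * cis (- (2 * pi * of_int m0 * \<xi>))"
      unfolding P_def poly_sum sum_distrib_right
    proof (rule sum.cong)
      fix m assume "m \<in> A"
      then have e: "real (nat (m - m0)) = of_int m - of_int m0" using m0 by simp
      have "cis (2 * pi * \<xi>) ^ nat (m - m0) = cis ((of_int m - of_int m0) * (2 * pi * \<xi>))"
        by (subst Complex.DeMoivre, subst e) (rule refl)
      then have "cis (2 * pi * \<xi>) ^ nat (m - m0) = cis (2 * pi * of_int m * \<xi>) * cis (- (2 * pi * of_int m0 * \<xi>))"
        by (simp add: cis_mult algebra_simps)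
      then show "poly (monom (c m) (nat (m - m0))) (cis (2 * pi * \<xi>)) =
        c m * cis (2 * pi * of_int m * \<xi>) * cis (- (2 * pi * of_int m0 * \<xi>))"
        by (simp add: poly_monom mult.assoc)
    qed simp
    then show ?case using elim by auto
  qed
qed

text \<open>For fixed \<open>a\<close> the map from \<open>b\<close> to \<open>b - a\<close> is a
  translation, so a null set of pairs (\<xi>, \<open>w\<close>) pulls back to a null set of pairs
  \<open>(a, b)\<close> with \<xi> read off as \<open>snd a\<close>.\<close>

lemma AE_lborel_pull_difference:
  fixes P :: "real \<times> plane \<Rightarrow> bool"
  assumes "AE q in lborel. P q"
  shows "AE z in (lborel :: (plane \<times> plane) measure). P (snd (fst z), snd z - fst z)"
proof -
  obtain N where N: "N \<in> null_sets lborel" "\<And>x. x \<notin> N \<Longrightarrow> P x" using assms by (auto elim!: AE_E3)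
  have [measurable]: "N \<in> sets borel" using N by auto
  have "AE q in lborel. q \<notin> N" using N(1) by (rule AE_not_in)
  then have "AE \<xi> in lborel. AE w in lborel. (\<xi>, w) \<notin> N" by (rule AE_lborel_pairD)
  from AE_lborel_snd[OF this]
  have "AE a in (lborel :: plane measure). AE b in lborel. (snd a, b - a) \<notin> N"
  proof eventually_elim
    case (elim a)
    from AE_lborel_translate[OF elim, of "- a"] show ?case by simp
  qed
  moreover have "Measurable.pred borel (\<lambda>z :: plane \<times> plane. (snd (fst z), snd z - fst z) \<notin> N)"
    by measurable
  ultimately have "AE z in (lborel :: (plane \<times> plane) measure). (snd (fst z), snd z - fst z) \<notin> N"
    using AE_lborel_pairI[of "\<lambda>z. (snd (fst z), snd z - fst z) \<notin> N"] by simp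
  then show ?thesis by eventually_elim (rule N(2))
qed

lemma AE_lattice_kernel:
  assumes ui: "\<And>k. k < N \<Longrightarrow> integrable lborel (u k)" "\<And>k. k < N \<Longrightarrow> integrable lborel (v k)"
    and K: "AE p in lborel. partial_ft f (fst p) (snd p - fst p) = (\<Sum>k<N. u k (fst p) * v k (snd p))"
  shows "AE p in lborel. lattice_kernel f u v N (fst p) (snd p)"
proof -
  have "AE \<xi> in lborel. \<forall>k\<in>{..<N}. integrable cint (\<lambda>l. u k (\<xi> + of_int l))"
    by (intro AE_finite_allI AE_integrable_translates ui) auto
  from AE_lborel_fst[OF this]
  have 1: "AE p in (lborel :: plane measure). \<forall>k\<in>{..<N}. integrable cint (\<lambda>l. u k (fst p + of_int l))" .
  have "AE \<xi> in lborel. \<forall>k\<in>{..<N}. integrable cint (\<lambda>l. v k (\<xi> + of_int l))"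
    by (intro AE_finite_allI AE_integrable_translates ui) auto
  from AE_lborel_snd[OF this]
  have 2: "AE p in (lborel :: plane measure). \<forall>k\<in>{..<N}. integrable cint (\<lambda>l. v k (snd p + of_int l))" .
  have 3: "AE p in lborel. \<forall>l k :: int. partial_ft f (fst p + of_int l) (snd p + of_int k - (fst p + of_int l)) =
      (\<Sum>j<N. u j (fst p + of_int l) * v j (snd p + of_int k))"
    unfolding AE_all_countable using AE_lborel_translate[OF K, of "(of_int _, of_int _)"] by simp
  from 1 2 3 show ?thesis
    unfolding lattice_kernel_def by eventually_elim auto
qed

lemma measurable_partial_ft [measurable (raw)]:
  assumes [measurable]: "f \<in> borel_measurable borel" "a \<in> borel_measurable M" "b \<in> borel_measurable M"
  shows "(\<lambda>x. partial_ft f (a x) (b x)) \<in> borel_measurable M"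
  unfolding partial_ft_def by measurable

lemma measurable_periodized [measurable (raw)]:
  assumes [measurable]: "f \<in> borel_measurable borel" "a \<in> borel_measurable M" "w \<in> borel_measurable M"
  shows "(\<lambda>x. periodized f (a x) (w x) n) \<in> borel_measurable M"
  unfolding periodized_def by measurable

text \<open>Poisson summation along the row at height \<open>y + n\<close>, applied to
  \<open>f (x, y + n) * cis (2 * pi * \<xi> * x)\<close>. Its coefficient at \<open>l\<close> is the
  kernel at \<open>\<xi> + l\<close> and \<open>y + \<xi> + l + n\<close>, hence by the
  factorization a finite sum of diagonals of summable products.\<close>

lemma AE_periodized_eq:
  assumes f: "integrable lborel f"
    and lk: "AE p in lborel. lattice_kernel f u v N (fst p) (snd p)"
  shows "AE q in (lborel :: (real \<times> plane) measure). \<forall>n::int. periodized f (fst q) (snd q) n =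
      (LINT l|cint. partial_ft f (fst q + of_int l) (snd (snd q) + of_int n) * cis (- (2 * pi * of_int l * fst (snd q))))"
proof -
  have [measurable]: "f \<in> borel_measurable borel" using f by auto
  define P where "P \<xi> w \<longleftrightarrow> (\<forall>n::int. periodized f \<xi> w n =
      (LINT l|cint. partial_ft f (\<xi> + of_int l) (snd w + of_int n) * cis (- (2 * pi * of_int l * fst w))))" for \<xi> w
  have [measurable]: "Measurable.pred borel (\<lambda>z. P (a z) (b z))"
    if [measurable]: "a \<in> borel_measurable borel" "b \<in> borel_measurable borel"
    for a :: "'z::euclidean_space \<Rightarrow> real" and b :: "'z \<Rightarrow> plane"
    unfolding P_def by measurable
  have "integrable (lborel \<Otimes>\<^sub>M lborel) (\<lambda>(x, y). f (x, y))" using f by (simp add: lborel_prod)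
  from lborel_pair.AE_integrable_snd[OF this]
  have "AE y in lborel. integrable lborel (\<lambda>x. f (x, y))" .
  then have "AE y in lborel. \<forall>n::int. integrable lborel (\<lambda>x. f (x, y + of_int n))"
    unfolding AE_all_countable using AE_lborel_translate by blast
  moreover have "AE p in lborel. lattice_kernel f u v N (fst p) (snd p + fst p)"
    using AE_lborel_shear[of "\<lambda>x. x", OF _ lk] by simp
  ultimately have "AE p in (lborel :: plane measure). (\<forall>n::int. integrable lborel (\<lambda>x. f (x, snd p + of_int n))) \<and>
      lattice_kernel f u v N (fst p) (snd p + fst p)"
    using AE_lborel_snd by (intro AE_conjI)
  then
  have "AE p in (lborel :: plane measure). AE x in lborel. P (fst p) (x, snd p)"
  proof eventually_elim
    case (elim p)
    define \<xi> y where "\<xi> = fst p" and "y = snd p"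
    have lk: "lattice_kernel f u v N \<xi> (y + \<xi>)" using elim by (simp add: \<xi>_def y_def)
    have fi: "integrable lborel (\<lambda>x. f (x, y + of_int n))" for n using elim by (simp add: y_def)
    have "AE x in lborel. periodized f \<xi> (x, y) n =
       (LINT l|cint. partial_ft f (\<xi> + of_int l) (y + of_int n) * cis (- (2 * pi * of_int l * x)))" for n
    proof -
      let ?F = "\<lambda>x. f (x, y + of_int n) * cis (2 * pi * \<xi> * x)"
      let ?s = "\<lambda>l. \<Sum>j<N. u j (\<xi> + of_int l) * v j (y + \<xi> + of_int (l + n))"
      have hF: "(LINT x|lborel. ?F x * cis (2 * pi * of_int l * x)) = partial_ft f (\<xi> + of_int l) (y + of_int n)" for l :: int
        unfolding partial_ft_def by (intro Bochner_Integration.integral_cong) (simp_all add: mult.assoc cis_mult algebra_simps)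
      have "partial_ft f (\<xi> + of_int l) (y + of_int n) = ?s l" for l
      proof -
        have "partial_ft f (\<xi> + of_int l) (y + \<xi> + of_int (l + n) - (\<xi> + of_int l)) = ?s l"
          using lk unfolding lattice_kernel_def by blast
        moreover have "y + \<xi> + of_int (l + n) - (\<xi> + of_int l) = y + of_int n" by simp
        ultimately show ?thesis by simp
      qed
      moreover have "integrable cint (\<lambda>l. \<Sum>j<N. u j (\<xi> + of_int l) * v j (y + \<xi> + of_int (l + n)))"
        by (intro Bochner_Integration.integrable_sum integrable_cint_diagonal[where b = "\<lambda>l. v _ (y + \<xi> + of_int l)"])
          (use lk in \<open>auto simp: lattice_kernel_def\<close>)
      ultimately have "integrable cint (\<lambda>l. LINT x|lborel. ?F x * cis (2 * pi * of_int l * x))"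
        unfolding hF by simp
      moreover have "integrable lborel ?F" using fi by simp
      ultimately have "AE x in lborel. (LINT m|cint. ?F (x + of_int m)) =
         (LINT l|cint. partial_ft f (\<xi> + of_int l) (y + of_int n) * cis (- (2 * pi * of_int l * x)))"
        using poisson_summation[of ?F] unfolding hF by auto
      then show ?thesis by (simp add: periodized_def)
    qed
    then show ?case unfolding P_def AE_all_countable \<xi>_def y_def by simp
  qed
  from AE_lborel_pairD[OF this]
  have "AE \<xi> in lborel. AE y in lborel. AE x in lborel. P \<xi> (x, y)"
    by (simp only: fst_conv snd_conv)
  then have "AE \<xi> in lborel. AE w in lborel. P \<xi> w"
  proof eventually_elim
    case (elim \<xi>)
    then have "AE w in (lborel :: plane measure). P \<xi> (snd w, fst w)"
      using AE_lborel_pairI[of "\<lambda>w. P \<xi> (snd w, fst w)"] by simp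
    from AE_lborel_swap[OF this] show ?case by simp
  qed
  then have "AE q in (lborel :: (real \<times> plane) measure). P (fst q) (snd q)"
    using AE_lborel_pairI[of "\<lambda>q :: real \<times> plane. P (fst q) (snd q)"] by simp
  then show ?thesis unfolding P_def .
qed

text \<open>Excludes cancellation within a row. For fixed \<open>w\<close> the row meets the support
  in finitely many points, so its sum is, up to a phase, a trigonometric polynomial in \<xi> whose
  coefficients are the values of \<open>f\<close>.\<close>

lemma AE_periodized_neq_0:
  assumes f [measurable]: "f \<in> borel_measurable borel" and fin: "emeasure lborel {p. f p \<noteq> 0} < \<infinity>"
  shows "AE q in (lborel :: (real \<times> plane) measure).
    finite {z :: int \<times> int. f (snd q + (of_int (fst z), of_int (snd z))) \<noteq> 0} \<and>
    (\<forall>n::int. (\<exists>m::int. f (snd q + (of_int m, of_int n)) \<noteq> 0) \<longrightarrow> periodized f (fst q) (snd q) n \<noteq> 0)"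
proof -
  have fp: "AE w in lborel. finite {z :: int \<times> int. f (w + (of_int (fst z), of_int (snd z))) \<noteq> 0}"
    using AE_finite_lattice_points[OF _ fin] by simp
  define P where "P \<xi> w \<longleftrightarrow> (\<forall>n::int. (\<exists>m::int. f (w + (of_int m, of_int n)) \<noteq> 0) \<longrightarrow> periodized f \<xi> w n \<noteq> 0)" for \<xi> w
  have [measurable]: "Measurable.pred borel (\<lambda>z :: plane \<times> real. P (snd z) (fst z))"
    unfolding P_def by measurable
  from fp have "AE w in lborel. AE \<xi> in lborel. P \<xi> w"
  proof eventually_elim
    case (elim w)
    show ?case unfolding P_def AE_all_countable
    proof
      fix n :: int
      define A where "A = {m::int. f (w + (of_int m, of_int n)) \<noteq> 0}"
      define c where "c m = f (w + (of_int m, of_int n))" for m :: int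
      have "A \<subseteq> fst ` {z :: int \<times> int. f (w + (of_int (fst z), of_int (snd z))) \<noteq> 0}"
        unfolding A_def by (auto intro!: rev_image_eqI[where x = "(_, n)"])
      then have A: "finite A" using elim finite_subset by blast
      have per: "periodized f \<xi> w n = (\<Sum>m\<in>A. c m * cis (2 * pi * of_int m * \<xi>)) * cis (2 * pi * \<xi> * fst w)" for \<xi>
      proof -
        have "{m. f (w + (of_int m, of_int n)) * cis (2 * pi * \<xi> * (fst w + of_int m)) \<noteq> 0} = A"
          by (auto simp: A_def)
        then have "periodized f \<xi> w n = (\<Sum>m\<in>A. c m * cis (2 * pi * \<xi> * (fst w + of_int m)))"
          unfolding periodized_def using A by (subst lebesgue_integral_count_space_finite_support) (simp_all add: c_def)
        also have "\<dots> = (\<Sum>m\<in>A. c m * cis (2 * pi * of_int m * \<xi>)) * cis (2 * pi * \<xi> * fst w)"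
          unfolding sum_distrib_right by (intro sum.cong) (simp_all add: mult.assoc cis_mult algebra_simps)
        finally show ?thesis .
      qed
      show "AE \<xi> in lborel. (\<exists>m::int. f (w + (of_int m, of_int n)) \<noteq> 0) \<longrightarrow> periodized f \<xi> w n \<noteq> 0"
      proof (cases "A = {}")
        case True
        then have "\<not> (\<exists>m::int. f (w + (of_int m, of_int n)) \<noteq> 0)" by (auto simp: A_def)
        then show ?thesis by simp
      next
        case False
        have "AE \<xi> in lborel. (\<Sum>m\<in>A. c m * cis (2 * pi * of_int m * \<xi>)) \<noteq> 0"
          by (rule AE_exp_sum_neq_0) (use A False in \<open>auto simp: A_def c_def\<close>)
        then show ?thesis by eventually_elim (simp add: per)
      qed
    qed
  qed
  then have "AE q in (lborel :: (plane \<times> real) measure). P (snd q) (fst q)"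
    using AE_lborel_pairI[of "\<lambda>q :: plane \<times> real. P (snd q) (fst q)"] by simp
  from AE_lborel_swap[OF this] AE_lborel_snd[OF fp] show ?thesis
    unfolding P_def by eventually_elim simp
qed

section \<open>The two-dimensional case\<close>

text \<open>The measure above \<theta> depends continuously on \<theta> because horizontal lines are
  null; it is positive for very negative \<theta> and tends to 0 upwards, so small positive values
  are attained.\<close>

lemma exists_small_upper_part:
  fixes S :: "plane set"
  assumes S [measurable]: "S \<in> sets borel" and pos: "0 < emeasure lborel S" and fin: "emeasure lborel S < \<infinity>"
    and e: "(e::real) > 0"
  shows "\<exists>\<theta>. 0 < emeasure lborel {p \<in> S. \<theta> < snd p} \<and> emeasure lborel {p \<in> S. \<theta> < snd p} < ennreal e"
proof -
  define m where "m \<theta> = measure lborel {p \<in> S. \<theta> < snd p}" for \<theta>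
  have eq: "emeasure lborel {p \<in> S. \<theta> < snd p} = ennreal (m \<theta>)" for \<theta>
    unfolding m_def using emeasure_mono[of "{p \<in> S. \<theta> < snd p}" S lborel] fin
    by (intro emeasure_eq_ennreal_measure) (auto simp: top_unique)
  have lim: "(\<lambda>n. m (t n)) \<longlonglongrightarrow> measure lborel L"
    if [measurable]: "L \<in> sets borel"
      and ev: "AE p in lborel. eventually (\<lambda>n. p \<in> S \<and> t n < snd p \<longleftrightarrow> p \<in> L) sequentially"
    for t :: "nat \<Rightarrow> real" and L
  proof -
    have "(\<lambda>n. LINT p|lborel. indicator {p \<in> S. t n < snd p} p) \<longlonglongrightarrow> (LINT p|lborel. indicator L p :: real)"
    proof (rule integral_dominated_convergence[where w = "indicator S"])
      show "integrable lborel (indicator S :: plane \<Rightarrow> real)" using fin by (simp add: integrable_indicator_iff)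
      show "AE p in lborel. (\<lambda>n. indicator {p \<in> S. t n < snd p} p) \<longlonglongrightarrow> (indicator L p :: real)"
        using ev
      proof eventually_elim
        case (elim p)
        then show ?case by (intro tendsto_eventually) (auto elim!: eventually_mono simp: indicator_def)
      qed
    qed (auto simp: indicator_def)
    then show ?thesis by (simp add: m_def)
  qed
  have cont: "continuous_on X m" for X
  proof (rule continuous_on_sequentiallyI)
    fix t :: "nat \<Rightarrow> real" and \<theta> assume t: "t \<longlonglongrightarrow> \<theta>"
    have "AE p in (lborel :: plane measure). snd p \<noteq> \<theta>"
      by (rule AE_lborel_snd) (rule AE_lborel_singleton)
    then have "AE p in lborel. eventually (\<lambda>n. p \<in> S \<and> t n < snd p \<longleftrightarrow> p \<in> {p \<in> S. \<theta> < snd p}) sequentially"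
    proof eventually_elim
      case (elim p)
      then consider "\<theta> < snd p" | "snd p < \<theta>" by linarith
      then show ?case
        by cases (use order_tendstoD[OF t] in \<open>force elim!: eventually_mono\<close>)+
    qed
    then show "(\<lambda>n. m (t n)) \<longlonglongrightarrow> m \<theta>" unfolding m_def[of \<theta>] by (intro lim) auto
  qed
  have "(\<lambda>n. m (- real n)) \<longlonglongrightarrow> measure lborel S"
  proof (rule lim[OF S], intro AE_I2)
    fix p :: plane
    obtain N :: nat where "- snd p < N" using reals_Archimedean2 by blast
    then show "eventually (\<lambda>n. p \<in> S \<and> - real n < snd p \<longleftrightarrow> p \<in> S) sequentially"
      by (intro eventually_sequentiallyI[of N]) auto
  qed
  moreover have "measure lborel S > 0" using pos fin by (simp add: measure_def enn2real_positive_iff)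
  ultimately have "eventually (\<lambda>n. m (- real n) > 0) sequentially" by (rule order_tendstoD)
  then obtain a where a: "m a > 0" by (auto simp: eventually_sequentially)
  have lim0: "(\<lambda>n. m (a + real n)) \<longlonglongrightarrow> 0"
  proof -
    have "(\<lambda>n. m (a + real n)) \<longlonglongrightarrow> measure lborel ({} :: plane set)"
    proof (rule lim, simp, intro AE_I2)
      fix p :: plane
      obtain N :: nat where "snd p - a < N" using reals_Archimedean2 by blast
      then show "eventually (\<lambda>n. p \<in> S \<and> a + real n < snd p \<longleftrightarrow> p \<in> {}) sequentially"
        by (intro eventually_sequentiallyI[of N]) auto
    qed
    then show ?thesis by simp
  qed
  \<comment> \<open>Strictly below \<open>e\<close>, and at most \<open>m a\<close> so that the
    intermediate value theorem applies to the right of \<open>a\<close>.\<close>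
  define y where "y = min (e / 2) (m a)"
  have "0 < y" using e a by (simp add: y_def)
  then have "eventually (\<lambda>n. m (a + real n) < y) sequentially" by (rule order_tendstoD(2)[OF lim0])
  then obtain n where "m (a + real n) < y" by (auto simp: eventually_sequentially)
  then obtain \<theta> where "m \<theta> = y"
    using IVT2'[of m "a + real n" y a] cont by (auto simp: y_def)
  then have "0 < m \<theta> \<and> m \<theta> < e" using e a by (auto simp: y_def)
  then show ?thesis unfolding eq by (auto simp: ennreal_less_iff m_def)
qed

lemma norm_eq_1_imp_cis:
  assumes "norm \<zeta> = 1"
  shows "\<exists>z. \<zeta> = cis (- (2 * pi * z))"
proof -
  have "\<zeta> = cis (Arg \<zeta>)" using assms by (metis cis_Arg sgn_div_norm norm_zero zero_neq_one div_by_1 scaleR_one inverse_1)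
  then show ?thesis by (intro exI[of _ "- (Arg \<zeta> / (2 * pi))"]) simp
qed

lemma finite_rank_kernel_finite_support_imp_0:
  fixes f :: "plane \<Rightarrow> complex" and u v :: "nat \<Rightarrow> real \<Rightarrow> complex"
  assumes f: "integrable lborel f" and fin: "emeasure lborel {p. f p \<noteq> 0} < \<infinity>"
    and ui: "\<And>k. k < N \<Longrightarrow> integrable lborel (u k)" "\<And>k. k < N \<Longrightarrow> integrable lborel (v k)"
    and K: "AE p in lborel. partial_ft f (fst p) (snd p - fst p) = (\<Sum>k<N. u k (fst p) * v k (snd p))"
  shows "AE p in lborel. f p = 0"
proof (rule ccontr)
  assume contra: "\<not> (AE p in lborel. f p = 0)"
  have [measurable]: "f \<in> borel_measurable borel" using f by auto
  define S where "S = {p. f p \<noteq> 0}"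
  have S [measurable]: "S \<in> sets borel" unfolding S_def by measurable
  have "emeasure lborel S \<noteq> 0"
  proof
    assume "emeasure lborel S = 0"
    then have "AE p in lborel. p \<notin> S" by (intro AE_not_in) (simp add: null_sets_def)
    with contra show False by (simp add: S_def)
  qed
  then have pos: "0 < emeasure lborel S" by (simp add: zero_less_iff_neq_zero)
  \<comment> \<open>One more than the rank; the measure bound below is then what
    \<open>diagonal_selection\<close> demands for \<open>M\<close> pairs.\<close>
  define M where "M = Suc N"
  obtain \<theta> where \<theta>: "0 < emeasure lborel {p \<in> S. \<theta> < snd p}"
      "emeasure lborel {p \<in> S. \<theta> < snd p} < ennreal (1 / (2 * real M))"
    using exists_small_upper_part[OF S pos, of "1 / (2 * real M)"] fin by (auto simp: S_def M_def)
  define E where "E = {p \<in> S. \<theta> < snd p}"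
  have [measurable]: "E \<in> sets borel" unfolding E_def by measurable
  have small: "emeasure lborel E * ennreal (2 * real M) < 1"
  proof -
    have "emeasure lborel E * ennreal (2 * real M) < ennreal (1 / (2 * real M)) * ennreal (2 * real M)"
    proof (rule ennreal_mult_strict_right_mono)
      show "emeasure lborel E < ennreal (1 / (2 * real M))" using \<theta>(2) by (simp add: E_def)
      show "0 < ennreal (2 * real M)" by (simp add: M_def ennreal_less_zero_iff del: ennreal_plus)
    qed simp
    also have "\<dots> = ennreal (1 / (2 * real M) * (2 * real M))" by (rule ennreal_mult[symmetric]) auto
    also have "1 / (2 * real M) * (2 * real M) = 1" by (simp add: M_def)
    finally show ?thesis by simp
  qed
  \<comment> \<open>All almost sure properties of a pair in one predicate, so that the selection
    secures them for every entry of the matrix. Second coordinates carry the variables \<xi> and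
    \<eta> of the kernel, first coordinates the Zak parameters \<alpha> and \<beta>.\<close>
  define W where "W a b \<longleftrightarrow> lattice_kernel f u v N (snd a) (snd b) \<and>
     (\<forall>n::int. periodized f (snd a) (b - a) n =
      (LINT l|cint. partial_ft f (snd a + of_int l) (snd (b - a) + of_int n) * cis (- (2 * pi * of_int l * fst (b - a))))) \<and>
     finite {z :: int \<times> int. f (b - a + (of_int (fst z), of_int (snd z))) \<noteq> 0} \<and>
     (\<forall>n::int. (\<exists>m::int. f (b - a + (of_int m, of_int n)) \<noteq> 0) \<longrightarrow> periodized f (snd a) (b - a) n \<noteq> 0)" for a b :: "plane"
  have lk: "AE p in lborel. lattice_kernel f u v N (fst p) (snd p)"
    by (rule AE_lattice_kernel[OF ui K])
  have lk': "AE z in (lborel :: (plane \<times> plane) measure). lattice_kernel f u v N (snd (fst z)) (snd (snd z))"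
  proof -
    obtain Z where Z: "Z \<in> null_sets lborel" "\<And>x. x \<notin> Z \<Longrightarrow> lattice_kernel f u v N (fst x) (snd x)"
      using lk by (auto elim!: AE_E3)
    have [measurable]: "Z \<in> sets borel" using Z by auto
    have "AE p in lborel. p \<notin> Z" using Z(1) by (rule AE_not_in)
    from AE_lborel_pairD[OF this] have "AE a in (lborel :: plane measure). AE \<eta> in lborel. (snd a, \<eta>) \<notin> Z"
      by (rule AE_lborel_snd)
    then have "AE a in (lborel :: plane measure). AE b in (lborel :: plane measure). (snd a, snd b) \<notin> Z"
      by eventually_elim (rule AE_lborel_snd)
    then have "AE z in (lborel :: (plane \<times> plane) measure). (snd (fst z), snd (snd z)) \<notin> Z"
      using AE_lborel_pairI[of "\<lambda>z :: plane \<times> plane. (snd (fst z), snd (snd z)) \<notin> Z"] by simp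
    then show ?thesis by eventually_elim (use Z(2) in fastforce)
  qed
  have good: "AE z in lborel. W (fst z) (snd z)"
    using lk' AE_lborel_pull_difference[OF AE_periodized_eq[OF f lk]]
      AE_lborel_pull_difference[OF AE_periodized_neq_0[OF \<open>f \<in> borel_measurable borel\<close> fin]]
    unfolding W_def by eventually_elim simp
  obtain a b where ab: "\<And>i j. i < M \<Longrightarrow> j < M \<Longrightarrow> W (a i) (b j)"
      "\<And>i. i < M \<Longrightarrow> b i - a i \<in> E"
      "\<And>i j. i < M \<Longrightarrow> j < M \<Longrightarrow> i \<noteq> j \<Longrightarrow> b j - a i \<notin> lattice_hull E"
  proof -
    have "\<exists>a b :: nat \<Rightarrow> plane. \<forall>i<M. \<forall>j<M.
     W (a i) (b j) \<and> (if i = j then b j - a i \<in> E else b j - a i \<notin> lattice_hull E)"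
      by (rule diagonal_selection) (use \<theta>(1) small good in \<open>auto simp: E_def\<close>)
    then obtain a b :: "nat \<Rightarrow> plane" where *: "\<forall>i<M. \<forall>j<M.
     W (a i) (b j) \<and> (if i = j then b j - a i \<in> E else b j - a i \<notin> lattice_hull E)" by blast
    show ?thesis by (rule that[of a b]) (use * in \<open>(simp; fail | metis)+\<close>)
  qed
  \<comment> \<open>All row numbers that occur in any of the \<open>M * M\<close> entries.\<close>
  define Z where "Z = (\<Union>i<M. \<Union>j<M. snd ` {z :: int \<times> int. f (b j - a i + (of_int (fst z), of_int (snd z))) \<noteq> 0})"
  have finZ: "finite Z" unfolding Z_def using ab(1) by (intro finite_UN_I finite_imageI) (auto simp: W_def)
  have Zmem: "n \<in> Z" if "i < M" "j < M" "f (b j - a i + (of_int m, of_int n)) \<noteq> 0" for i j m n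
    unfolding Z_def
    by (rule UN_I[where a = i], simp add: that, rule UN_I[where a = j], simp add: that,
        rule rev_image_eqI[where x = "(m, n)"]) (use that in auto)
  have per0: "periodized f \<xi> w n = 0" if "\<And>m. f (w + (of_int m, of_int n)) = 0" for \<xi> w n
    unfolding periodized_def by (simp add: that)
  \<comment> \<open>Shifting exponents by \<open>K0\<close> turns the trigonometric polynomials into
    ordinary ones.\<close>
  obtain K0 :: nat where K0: "\<And>n. n \<in> Z \<Longrightarrow> - int K0 \<le> n"
  proof -
    obtain c where "\<And>n. n \<in> Z \<Longrightarrow> c \<le> n" using bdd_below_finite[OF finZ] by (auto simp: bdd_below_def)
    then show ?thesis by (intro that[of "nat (- c)"]) force
  qed
  define c where "c i j n = periodized f (snd (a i)) (b j - a i) n * cis (- (2 * pi * of_int n * fst (b j)))" for i j n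
  have c0: "c i j n \<noteq> 0 \<longleftrightarrow> (\<exists>m. f (b j - a i + (of_int m, of_int n)) \<noteq> 0)" if "i < M" "j < M" for i j n
  proof -
    have "(\<exists>m. f (b j - a i + (of_int m, of_int n)) \<noteq> 0) \<Longrightarrow> periodized f (snd (a i)) (b j - a i) n \<noteq> 0"
      using ab(1)[OF that] unfolding W_def by blast
    moreover have "c i j n \<noteq> 0 \<longleftrightarrow> periodized f (snd (a i)) (b j - a i) n \<noteq> 0" by (simp add: c_def)
    ultimately show ?thesis using per0[of "b j - a i" n "snd (a i)"] by blast
  qed
  have cZ: "c i j n = 0" if "i < M" "j < M" "n \<notin> Z" for i j n
    using c0[OF that(1,2)] Zmem[OF that(1,2)] that(3) by blast
  define p where "p i j = (\<Sum>n\<in>Z. monom (c i j n) (nat (n + int K0)))" for i j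
  have coeff_p: "coeff (p i j) d = (if int d - int K0 \<in> Z then c i j (int d - int K0) else 0)" for i j d
  proof -
    have "coeff (p i j) d = (\<Sum>n\<in>Z. if nat (n + int K0) = d then c i j n else 0)"
      by (simp add: p_def coeff_sum)
    also have "\<dots> = (\<Sum>n\<in>Z. if n = int d - int K0 then c i j n else 0)"
      by (rule sum.cong) (use K0 in force)+
    also have "\<dots> = (if int d - int K0 \<in> Z then c i j (int d - int K0) else 0)"
      using finZ by simp
    finally show ?thesis .
  qed
  \<comment> \<open>Chosen so that \<open>n + K0 > r i + s j\<close> says exactly that row
    \<open>n\<close> of the lattice through \<open>b j - a i\<close> lies above \<theta>.\<close>
  define r where "r i = \<theta> + real K0 + snd (a i)" for i
  define s where "s j = - snd (b j)" for j
  have "M \<le> N"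
  proof (rule rank_ge_if_diagonal_degrees_dominate)
    fix \<zeta> :: complex assume "norm \<zeta> = 1"
    then obtain z where z: "\<zeta> = cis (- (2 * pi * z))" using norm_eq_1_imp_cis by blast
    \<comment> \<open>Moving all first coordinates by the same \<open>z\<close> keeps the
      differences \<open>b j - a i\<close>, so only the phases change and the entry becomes a
      polynomial in \<zeta>. The power of \<zeta> pays for the shift of exponents.\<close>
    define U where "U i k = \<zeta> ^ K0 * (LINT l|cint. u k (snd (a i) + of_int l) * cis (2 * pi * of_int l * (fst (a i) + z)))" for i k
    define V where "V k j = (LINT l|cint. v k (snd (b j) + of_int l) * cis (- (2 * pi * of_int l * (fst (b j) + z))))" for k j
    have "poly (p i j) \<zeta> = (\<Sum>k<N. U i k * V k j)" if ij: "i < M" "j < M" for i j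
    proof -
      have g: "W (a i) (b j)" using ab(1) ij by blast
      have "(\<Sum>k<N. (LINT l|cint. u k (snd (a i) + of_int l) * cis (2 * pi * of_int l * (fst (a i) + z))) *
          (LINT l|cint. v k (snd (b j) + of_int l) * cis (- (2 * pi * of_int l * (fst (b j) + z))))) =
        (LINT n|cint. periodized f (snd (a i)) (b j - a i) n * cis (- (2 * pi * of_int n * (fst (b j) + z))))"
        using g unfolding W_def by (intro zak_identity) (auto simp: prod_eq_iff)
      also have "\<dots> = (LINT n|cint. c i j n * cis (- (2 * pi * of_int n * z)))"
        unfolding c_def by (simp add: mult.assoc cis_mult algebra_simps)
      also have "\<dots> = (\<Sum>n\<in>Z. c i j n * cis (- (2 * pi * of_int n * z)))"
      proof -
        have sub: "{n. c i j n * cis (- (2 * pi * of_int n * z)) \<noteq> 0} \<subseteq> Z" using cZ[OF ij] by auto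
        show ?thesis
          by (subst lebesgue_integral_count_space_finite_support)
            (use sub finZ in \<open>auto intro: finite_subset intro!: sum.mono_neutral_left\<close>)
      qed
      finally have "(\<Sum>k<N. U i k * V k j) = (\<Sum>n\<in>Z. c i j n * (\<zeta> ^ K0 * cis (- (2 * pi * of_int n * z))))"
        unfolding U_def V_def mult.assoc sum_distrib_left[symmetric] by (simp add: sum_distrib_left mult_ac)
      also have "\<dots> = poly (p i j) \<zeta>"
        unfolding p_def poly_sum
      proof (rule sum.cong)
        fix n assume "n \<in> Z"
        then have "- int K0 \<le> n" by (rule K0)
        then have e: "real (nat (n + int K0)) = of_int n + real K0" by simp
        have "\<zeta> ^ K0 * cis (- (2 * pi * of_int n * z)) = \<zeta> ^ nat (n + int K0)"
          unfolding z Complex.DeMoivre e cis_mult by (simp add: algebra_simps)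
        then show "c i j n * (\<zeta> ^ K0 * cis (- (2 * pi * of_int n * z))) = poly (monom (c i j n) (nat (n + int K0))) \<zeta>"
          by (simp add: poly_monom)
      qed simp
      finally show ?thesis by simp
    qed
    then show "\<exists>U V. \<forall>i<M. \<forall>j<M. poly (p i j) \<zeta> = (\<Sum>k<N. U i k * V k j)" by blast
  next
    fix i assume i: "i < M"
    have "b i - a i \<in> E" by (rule ab(2)[OF i])
    then have fE: "f (b i - a i + (of_int 0, of_int 0)) \<noteq> 0" and \<theta>s: "\<theta> < snd (b i - a i)"
      by (auto simp: E_def S_def zero_prod_def[symmetric])
    \<comment> \<open>Row 0 contains \<open>b i - a i\<close> itself, a point of the support above
      \<theta>. Higher rows may meet the support too, so this only bounds the degree from below,
      which is enough.\<close>
    have "coeff (p i i) K0 \<noteq> 0"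
    proof -
      have "c i i 0 \<noteq> 0" using c0[OF i i, of 0] fE by blast
      then show ?thesis using Zmem[OF i i fE] by (simp add: coeff_p)
    qed
    then have "p i i \<noteq> 0" "K0 \<le> degree (p i i)" by (auto intro: le_degree)
    then show "p i i \<noteq> 0 \<and> real (degree (p i i)) > r i + s i"
      using \<theta>s by (simp add: r_def s_def)
  next
    fix i j assume ij: "i < M" "j < M" "i \<noteq> j" and nz: "p i j \<noteq> 0"
    define n where "n = int (degree (p i j)) - int K0"
    have "coeff (p i j) (degree (p i j)) \<noteq> 0" using nz by simp
    then have "c i j n \<noteq> 0" by (auto simp: coeff_p n_def split: if_splits)
    then obtain m where m: "f (b j - a i + (of_int m, of_int n)) \<noteq> 0" using c0[OF ij(1,2)] by blast
    \<comment> \<open>A point of the support above \<theta> would lie in \<open>E\<close>, but the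
      lattice through \<open>b j - a i\<close> avoids \<open>E\<close>.\<close>
    have "b j - a i + (of_int m, of_int n) \<notin> E" using ab(3)[OF ij] by (auto simp: lattice_hull_def)
    then have "snd (b j - a i) + of_int n \<le> \<theta>" using m by (auto simp: E_def S_def not_less)
    then show "real (degree (p i j)) \<le> r i + s j" by (simp add: r_def s_def n_def)
  qed
  then show False by (simp add: M_def)
qed

section \<open>Factorization of finite rank kernels\<close>

text \<open>Finite rank gives for each test set an identity off a null set of its own, so the test
  sets must be countably many to share one; bounded sets have square integrable indicators. Boxes
  with rational corners are closed under intersection and generate the Borel sets.\<close>

lemma countable_bounded_box_generator:
  "\<exists>\<G> :: nat \<Rightarrow> 'a::euclidean_space set. (\<forall>n. bounded (\<G> n) \<and> \<G> n \<in> sets borel) \<and>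
    (\<forall>v :: 'a \<Rightarrow> complex. integrable lborel v \<longrightarrow> (\<forall>n. (LINT y:\<G> n|lborel. v y) = 0) \<longrightarrow> (AE y in lborel. v y = 0))"
proof -
  define a' b' where "a' f = (\<Sum>i\<in>Basis. fst (f i) *\<^sub>R i)" and "b' f = (\<Sum>i\<in>Basis. snd (f i) *\<^sub>R i)"
    for f :: "'a \<Rightarrow> plane"
  define Q :: "('a \<Rightarrow> plane) set" where "Q = Basis \<rightarrow>\<^sub>E \<rat> \<times> \<rat>"
  define G where "G = (\<lambda>f. box (a' f) (b' f)) ` Q"
  have ab: "a' f \<bullet> i = fst (f i)" "b' f \<bullet> i = snd (f i)" if "i \<in> Basis" for f i
    using that by (simp_all add: a'_def b'_def)
  have box: "box (a' f) (b' f) = {x. \<forall>i\<in>Basis. fst (f i) < x \<bullet> i \<and> x \<bullet> i < snd (f i)}" for f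
    by (auto simp: box_def ab)
  have cQ: "countable Q" unfolding Q_def by (intro countable_PiE) (auto intro: countable_SIGMA countable_rat)
  have cG: "countable G" unfolding G_def using cQ by simp
  have GI: "{x. \<forall>i\<in>Basis. l i < x \<bullet> i \<and> x \<bullet> i < u i} \<in> G" if "\<And>i. i \<in> Basis \<Longrightarrow> l i \<in> \<rat>" "\<And>i. i \<in> Basis \<Longrightarrow> u i \<in> \<rat>" for l u
    unfolding G_def
    by (rule image_eqI[where x = "\<lambda>i\<in>Basis. (l i, u i)"]) (use that in \<open>auto simp: box Q_def\<close>)
  have stable: "Int_stable G"
    unfolding Int_stable_def
  proof (intro ballI)
    fix A B assume "A \<in> G" "B \<in> G"
    then obtain f g where f: "f \<in> Q" "A = box (a' f) (b' f)" and g: "g \<in> Q" "B = box (a' g) (b' g)" by (auto simp: G_def)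
    have "A \<inter> B = {x. \<forall>i\<in>Basis. max (fst (f i)) (fst (g i)) < x \<bullet> i \<and> x \<bullet> i < min (snd (f i)) (snd (g i))}"
      unfolding f(2) g(2) box by auto
    also have "\<dots> \<in> G"
      using f(1) g(1) by (intro GI) (auto simp: Q_def max_def min_def PiE_iff)
    finally show "A \<inter> B \<in> G" .
  qed
  have gen: "sigma_sets UNIV G = sets borel"
  proof
    have "S \<in> sets borel" if "S \<in> G" for S using that by (auto simp: G_def)
    then show "sigma_sets UNIV G \<subseteq> sets borel"
      using sets.sigma_sets_subset[of G borel] by auto
    have "S \<in> sigma_sets UNIV G" if "open S" for S :: "'a set"
    proof -
      have "S = (\<Union>f\<in>{f \<in> Basis \<rightarrow>\<^sub>E \<rat> \<times> \<rat>. box (a' f) (b' f) \<subseteq> S}. box (a' f) (b' f))"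
        unfolding a'_def b'_def by (rule open_UNION_box[OF that])
      also have "\<dots> \<in> sigma_sets UNIV G"
      proof (rule sigma_sets_UNION)
        show "countable ((\<lambda>f. box (a' f) (b' f)) ` {f \<in> Basis \<rightarrow>\<^sub>E \<rat> \<times> \<rat>. box (a' f) (b' f) \<subseteq> S})"
          using cQ by (intro countable_image) (auto simp: Q_def intro: countable_subset)
      qed (auto simp: G_def Q_def intro!: sigma_sets.Basic)
      finally show ?thesis .
    qed
    then have "Collect open \<subseteq> sigma_sets UNIV G" by auto
    then have "sigma_sets UNIV (Collect open) \<subseteq> sigma_sets UNIV G" by (rule sigma_sets_mono)
    then show "sets borel \<subseteq> sigma_sets UNIV G" by (simp add: borel_def)
  qed
  define C where "C n = {x :: 'a. \<forall>i\<in>Basis. - real n < x \<bullet> i \<and> x \<bullet> i < real n}" for n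
  have C: "C n \<in> G" for n unfolding C_def by (rule GI) auto
  have "incseq C" unfolding incseq_def C_def by fastforce
  moreover have "(\<Union>n. C n) = UNIV"
  proof (intro equalityI subsetI UNIV_I)
    fix x :: 'a
    obtain n :: nat where "norm x < n" using reals_Archimedean2 by blast
    then have "\<bar>x \<bullet> i\<bar> < n" if "i \<in> Basis" for i using Basis_le_norm[OF that, of x] by simp
    then have "x \<in> C n" by (force simp: C_def abs_less_iff)
    then show "x \<in> (\<Union>n. C n)" by blast
  qed
  ultimately have sep: "AE y in lborel. v y = 0"
    if "integrable lborel v" "\<And>A. A \<in> G \<Longrightarrow> (LINT y:A|lborel. v y) = 0" for v :: "'a \<Rightarrow> complex"
    using AE_eq_0_if_generator_integrals_eq_0[where C = C, OF that(1) stable gen C _ _ that(2)] by blast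
  have ne: "G \<noteq> {}" using C by blast
  have mem: "from_nat_into G n \<in> G" for n using from_nat_into[OF ne] .
  show ?thesis
  proof (intro exI[of _ "from_nat_into G"] conjI allI impI)
    show "bounded (from_nat_into G n)" for n using mem[of n] by (auto simp: G_def)
    show "from_nat_into G n \<in> sets borel" for n using mem[of n] by (auto simp: G_def)
    fix v :: "'a \<Rightarrow> complex" assume v: "integrable lborel v" "\<forall>n. (LINT y:from_nat_into G n|lborel. v y) = 0"
    show "AE y in lborel. v y = 0"
    proof (rule sep[OF v(1)])
      fix A assume "A \<in> G"
      then obtain n where "A = from_nat_into G n" using from_nat_into_surj[OF cG] by metis
      then show "(LINT y:A|lborel. v y) = 0" using v(2) by simp
    qed
  qed
qed

text \<open>Gaussian elimination on the spanning functions \<open>w\<close>. At a point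
  \<open>x0\<close> with \<open>w b0 x0 \<noteq> 0\<close>, subtracting the right multiple of the
  section \<open>K x0\<close> removes \<open>b0\<close> from the identities for all \<G>
  \<open>n\<close> at once. The right factors split off are sections of the successive kernels and
  therefore integrable; when no \<open>w\<close> is left, \<open>sep\<close> makes the kernel
  vanish.\<close>

lemma kernel_factorization_right:
  fixes K :: "'a::euclidean_space \<Rightarrow> 'b::euclidean_space \<Rightarrow> complex" and w :: "'i \<Rightarrow> 'a \<Rightarrow> complex"
  assumes B: "finite B"
    and sep: "\<And>v :: 'b \<Rightarrow> complex. integrable lborel v \<Longrightarrow> (\<And>n. (LINT y:\<G> n|lborel. v y) = 0) \<Longrightarrow> AE y in lborel. v y = 0"
    and Gs: "\<And>n::nat. \<G> n \<in> sets borel"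
  shows "(\<lambda>p. K (fst p) (snd p)) \<in> borel_measurable borel \<Longrightarrow> (AE x in lborel. integrable lborel (K x)) \<Longrightarrow>
    (\<And>b. b \<in> B \<Longrightarrow> w b \<in> borel_measurable borel) \<Longrightarrow>
    (\<And>n. \<exists>c. AE x in lborel. (LINT y:\<G> n|lborel. K x y) = (\<Sum>b\<in>B. c b * w b x)) \<Longrightarrow>
    \<exists>N u v. (\<forall>k<N. u k \<in> borel_measurable borel \<and> integrable lborel (v k)) \<and>
      (AE p in lborel. K (fst p) (snd p) = (\<Sum>k<(N::nat). u k (fst p) * v k (snd p)))"
  using B
proof (induction B arbitrary: K w rule: finite_induct)
  case empty
  note [measurable] = empty(1)
  have "AE x in lborel. (LINT y:\<G> n|lborel. K x y) = 0" for n using empty(4)[of n] by auto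
  then have "AE x in lborel. \<forall>n. (LINT y:\<G> n|lborel. K x y) = 0" unfolding AE_all_countable by blast
  with empty(2) have "AE x in lborel. AE y in lborel. K x y = 0"
    by eventually_elim (auto intro: sep)
  then have "AE p in lborel. K (fst p) (snd p) = 0"
    using AE_lborel_pairI[of "\<lambda>p. K (fst p) (snd p) = 0"] by simp
  then show ?case by (intro exI[of _ 0]) auto
next
  case (insert b0 B)
  note Km [measurable] = insert.prems(1)
  have wm [measurable]: "w b \<in> borel_measurable borel" if "b \<in> insert b0 B" for b using insert.prems(3) that by blast
  have wb0 [measurable]: "w b0 \<in> borel_measurable borel" by (rule wm) simp
  obtain c where c: "\<And>n. AE x in lborel. (LINT y:\<G> n|lborel. K x y) = (\<Sum>b\<in>insert b0 B. c n b * w b x)"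
    using insert.prems(4) by metis
  show ?case
  proof (cases "AE x in lborel. w b0 x = 0")
    case True
    show ?thesis
    proof (rule insert.IH[of K w])
      fix n
      from c[of n] True have "AE x in lborel. (LINT y:\<G> n|lborel. K x y) = (\<Sum>b\<in>B. c n b * w b x)"
        by eventually_elim (use insert.hyps in simp)
      then show "\<exists>c. AE x in lborel. (LINT y:\<G> n|lborel. K x y) = (\<Sum>b\<in>B. c b * w b x)" by blast
    qed (use insert.prems in auto)
  next
    case False
    have call: "AE x in lborel. \<forall>n. (LINT y:\<G> n|lborel. K x y) = (\<Sum>b\<in>insert b0 B. c n b * w b x)"
      unfolding AE_all_countable using c by blast
    \<comment> \<open>The exceptional null sets cannot cover the set where \<open>w b0\<close> is
      nonzero, since that set is not null.\<close>
    obtain x0 where x0: "w b0 x0 \<noteq> 0" "integrable lborel (K x0)"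
      "\<And>n. (LINT y:\<G> n|lborel. K x0 y) = (\<Sum>b\<in>insert b0 B. c n b * w b x0)"
    proof (rule ccontr)
      assume "\<not> thesis"
      from call insert.prems(2) have "AE x in lborel. w b0 x = 0"
        by eventually_elim (use that \<open>\<not> thesis\<close> in blast)
      with False show False by simp
    qed
    define K' where "K' x y = K x y - (w b0 x / w b0 x0) * K x0 y" for x y
    define w' where "w' b x = w b x - w b0 x * w b x0 / w b0 x0" for b x
    have [measurable]: "K x0 \<in> borel_measurable borel" using x0(2) by auto
    have "\<exists>N u v. (\<forall>k<N. u k \<in> borel_measurable borel \<and> integrable lborel (v k)) \<and>
      (AE p in lborel. K' (fst p) (snd p) = (\<Sum>k<(N::nat). u k (fst p) * v k (snd p)))"
    proof (rule insert.IH[of K' w'])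
      show "(\<lambda>p. K' (fst p) (snd p)) \<in> borel_measurable borel" unfolding K'_def by measurable
      show "AE x in lborel. integrable lborel (K' x)"
        using insert.prems(2) by eventually_elim (use x0(2) in \<open>auto simp: K'_def[abs_def]\<close>)
      show "w' b \<in> borel_measurable borel" if "b \<in> B" for b
      proof -
        have [measurable]: "w b \<in> borel_measurable borel" using that by (intro wm) simp
        show ?thesis unfolding w'_def[abs_def] by measurable
      qed
      fix n
      from call insert.prems(2)
      have "AE x in lborel. (LINT y:\<G> n|lborel. K' x y) = (\<Sum>b\<in>B. c n b * w' b x)"
      proof eventually_elim
        case (elim x)
        have si: "set_integrable lborel (\<G> n) v" if "integrable lborel v" for v :: "'b \<Rightarrow> complex"
          using that Gs[of n] unfolding set_integrable_def by (intro integrable_mult_indicator) auto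
        have "(LINT y:\<G> n|lborel. K' x y) = (LINT y:\<G> n|lborel. K x y) - (LINT y:\<G> n|lborel. (w b0 x / w b0 x0) * K x0 y)"
          unfolding K'_def using elim x0(2) by (intro set_integral_diff si) auto
        also have "(LINT y:\<G> n|lborel. (w b0 x / w b0 x0) * K x0 y) = (w b0 x / w b0 x0) * (LINT y:\<G> n|lborel. K x0 y)"
          by (rule set_integral_mult_right)
        also have "(LINT y:\<G> n|lborel. K x y) - (w b0 x / w b0 x0) * (LINT y:\<G> n|lborel. K x0 y) =
           (\<Sum>b\<in>insert b0 B. c n b * w b x - (w b0 x / w b0 x0) * (c n b * w b x0))"
          using elim by (simp only: x0(3) sum_subtractf sum_distrib_left)
        also have "\<dots> = (\<Sum>b\<in>B. c n b * w b x - (w b0 x / w b0 x0) * (c n b * w b x0))"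
          using insert.hyps x0(1) by simp
        also have "\<dots> = (\<Sum>b\<in>B. c n b * w' b x)"
          by (intro sum.cong) (auto simp: w'_def algebra_simps)
        finally show ?case .
      qed
      then show "\<exists>c. AE x in lborel. (LINT y:\<G> n|lborel. K' x y) = (\<Sum>b\<in>B. c b * w' b x)" by blast
    qed
    then obtain N u v where uv: "\<forall>k<N. u k \<in> borel_measurable borel \<and> integrable lborel (v k)"
      "AE p in lborel. K' (fst p) (snd p) = (\<Sum>k<(N::nat). u k (fst p) * v k (snd p))" by blast
    define u' where "u' = u(N := \<lambda>x. w b0 x / w b0 x0)"
    define v' where "v' = v(N := K x0)"
    have "\<forall>k<Suc N. u' k \<in> borel_measurable borel \<and> integrable lborel (v' k)"
    proof (intro allI impI)
      fix k assume "k < Suc N"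
      then show "u' k \<in> borel_measurable borel \<and> integrable lborel (v' k)"
        using uv(1) x0(2) wb0 by (cases "k = N") (auto simp: u'_def v'_def)
    qed
    moreover from uv(2) have "AE p in lborel. K (fst p) (snd p) = (\<Sum>k<Suc N. u' k (fst p) * v' k (snd p))"
      by eventually_elim (auto simp: u'_def v'_def K'_def algebra_simps)
    ultimately show ?thesis by blast
  qed
qed

text \<open>The same elimination with the roles exchanged: where \<open>v N y0 \<noteq> 0\<close>
  the section of \<open>K\<close> at \<open>y0\<close> becomes the new left factor, integrable by
  assumption, and the remaining right factors change only by multiples of \<open>v N\<close>, so
  they stay integrable.\<close>

lemma kernel_factorization_left:
  fixes K :: "'a::euclidean_space \<Rightarrow> 'b::euclidean_space \<Rightarrow> complex"
  shows "(AE y in lborel. integrable lborel (\<lambda>x. K x y)) \<Longrightarrow>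
    (\<And>k. k < N \<Longrightarrow> u k \<in> borel_measurable borel) \<Longrightarrow> (\<And>k. k < N \<Longrightarrow> integrable lborel (v k)) \<Longrightarrow>
    (AE p in lborel. K (fst p) (snd p) = (\<Sum>k<(N::nat). u k (fst p) * v k (snd p))) \<Longrightarrow>
    \<exists>M u v. (\<forall>k<M. integrable lborel (u k) \<and> integrable lborel (v k)) \<and>
      (AE p in lborel. K (fst p) (snd p) = (\<Sum>k<(M::nat). u k (fst p) * v k (snd p)))"
proof (induction N arbitrary: K u v)
  case 0
  then show ?case by (intro exI[of _ 0]) auto
next
  case (Suc N)
  show ?case
  proof (cases "AE y in lborel. v N y = 0")
    case True
    from Suc.prems(4) AE_lborel_snd[OF True]
    have "AE p in lborel. K (fst p) (snd p) = (\<Sum>k<N. u k (fst p) * v k (snd p))"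
      by eventually_elim simp
    then show ?thesis using Suc.prems by (intro Suc.IH[of K u v]) auto
  next
    case False
    from AE_lborel_pairD[OF AE_lborel_swap[OF Suc.prems(4)]]
    have "AE y in lborel. AE x in lborel. K x y = (\<Sum>k<Suc N. u k x * v k y)" by simp
    note 1 = this
    obtain y0 where y0: "v N y0 \<noteq> 0" "integrable lborel (\<lambda>x. K x y0)" "AE x in lborel. K x y0 = (\<Sum>k<Suc N. u k x * v k y0)"
    proof (rule ccontr)
      assume "\<not> thesis"
      from 1 Suc.prems(1) have "AE y in lborel. v N y = 0"
        by eventually_elim (use that \<open>\<not> thesis\<close> in blast)
      with False show False by simp
    qed
    define K' where "K' x y = K x y - K x y0 * (v N y / v N y0)" for x y
    define v' where "v' k y = v k y - v k y0 * v N y / v N y0" for k y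
    have "\<exists>M u v. (\<forall>k<M. integrable lborel (u k) \<and> integrable lborel (v k)) \<and>
      (AE p in lborel. K' (fst p) (snd p) = (\<Sum>k<(M::nat). u k (fst p) * v k (snd p)))"
    proof (rule Suc.IH[of K' u v'])
      show "AE y in lborel. integrable lborel (\<lambda>x. K' x y)"
        using Suc.prems(1) by eventually_elim (use y0(2) in \<open>auto simp: K'_def\<close>)
      show "integrable lborel (v' k)" if "k < N" for k
        using Suc.prems(3)[of k] Suc.prems(3)[of N] that by (auto simp: v'_def[abs_def])
      from Suc.prems(4) AE_lborel_fst[OF y0(3)]
      show "AE p in lborel. K' (fst p) (snd p) = (\<Sum>k<N. u k (fst p) * v' k (snd p))"
      proof eventually_elim
        case (elim p)
        have "K' (fst p) (snd p) = (\<Sum>k<Suc N. u k (fst p) * v k (snd p) - u k (fst p) * v k y0 * (v N (snd p) / v N y0))"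
          unfolding K'_def elim by (simp only: sum_subtractf sum_distrib_right)
        also have "\<dots> = (\<Sum>k<N. u k (fst p) * v k (snd p) - u k (fst p) * v k y0 * (v N (snd p) / v N y0))"
          using y0(1) by simp
        also have "\<dots> = (\<Sum>k<N. u k (fst p) * v' k (snd p))"
          by (intro sum.cong) (auto simp: v'_def algebra_simps)
        finally show ?case .
      qed
    qed (use Suc.prems in auto)
    then obtain M u' v'' where uv: "\<forall>k<M. integrable lborel (u' k) \<and> integrable lborel (v'' k)"
      "AE p in lborel. K' (fst p) (snd p) = (\<Sum>k<(M::nat). u' k (fst p) * v'' k (snd p))" by blast
    define U where "U = u'(M := \<lambda>x. K x y0)"
    define V where "V = v''(M := \<lambda>y. v N y / v N y0)"
    have "\<forall>k<Suc M. integrable lborel (U k) \<and> integrable lborel (V k)"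
    proof (intro allI impI)
      fix k assume "k < Suc M"
      then show "integrable lborel (U k) \<and> integrable lborel (V k)"
        using uv(1) y0(2) Suc.prems(3)[of N] by (cases "k = M") (auto simp: U_def V_def)
    qed
    moreover from uv(2) have "AE p in lborel. K (fst p) (snd p) = (\<Sum>k<Suc M. U k (fst p) * V k (snd p))"
      by eventually_elim (auto simp: U_def V_def K'_def algebra_simps)
    ultimately show ?thesis by blast
  qed
qed

section \<open>From the operator to its integral kernel\<close>

lemma nn_integral_lborel_pair:
  fixes f :: "'a::euclidean_space \<times> 'b::euclidean_space \<Rightarrow> ennreal"
  assumes [measurable]: "f \<in> borel_measurable borel"
  shows "(\<integral>\<^sup>+z. f z \<partial>lborel) = (\<integral>\<^sup>+x. \<integral>\<^sup>+y. f (x, y) \<partial>lborel \<partial>lborel)"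
proof -
  have "f \<in> borel_measurable (lborel \<Otimes>\<^sub>M lborel)" by (simp add: lborel_prod)
  from lborel.nn_integral_fst[OF this] show ?thesis by (simp add: lborel_prod)
qed

lemma integrable_lborel_pair:
  fixes f :: "'a::euclidean_space \<times> 'b::euclidean_space \<Rightarrow> 'c::{banach, second_countable_topology}"
  assumes "integrable lborel f"
  shows "integrable (lborel \<Otimes>\<^sub>M lborel) (\<lambda>(x, y). f (x, y))"
  using assms by (simp add: lborel_prod)

text \<open>By translation and Fubini, integrating the kernel over \<open>A\<close> in its second
  variable gives the operator on the indicator of \<open>A\<close>, to which \<open>rank\<close>
  applies. Elimination from the right and then from the left yields integrable factors on both
  sides.\<close>

lemma finite_rank_kernel_factorization:
  fixes f :: "'a::euclidean_space \<times> 'a \<Rightarrow> complex" and w :: "'i \<Rightarrow> 'a \<Rightarrow> complex"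
  assumes f: "integrable lborel f" and B: "finite B"
    and wm: "\<And>b. b \<in> B \<Longrightarrow> w b \<in> borel_measurable borel"
    and rank: "\<And>A. bounded A \<Longrightarrow> A \<in> sets borel \<Longrightarrow> \<exists>c. AE \<xi> in lborel.
      (LINT p|lborel. f p * cis (2 * pi * (fst p \<bullet> \<xi>)) * indicator A (\<xi> + snd p)) = (\<Sum>b\<in>B. c b * w b \<xi>)"
  shows "\<exists>N u v. (\<forall>k<N. integrable lborel (u k) \<and> integrable lborel (v k)) \<and>
    (AE p in lborel. (LINT x|lborel. f (x, snd p - fst p) * cis (2 * pi * (x \<bullet> fst p))) =
      (\<Sum>k<(N::nat). u k (fst p) * v k (snd p)))"
proof -
  have [measurable]: "f \<in> borel_measurable borel" using f by auto
  define h where "h \<xi> y = (LINT x|lborel. f (x, y) * cis (2 * pi * (x \<bullet> \<xi>)))" for \<xi> y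
  define K where "K \<xi> \<eta> = h \<xi> (\<eta> - \<xi>)" for \<xi> \<eta>
  have hm [measurable]: "(\<lambda>p. h (fst p) (snd p)) \<in> borel_measurable borel" unfolding h_def by measurable
  have Km: "(\<lambda>p. K (fst p) (snd p)) \<in> borel_measurable borel" unfolding K_def h_def by measurable
  have fint: "integrable lborel (\<lambda>p. f p * cis (2 * pi * (fst p \<bullet> \<xi>)))" for \<xi> using f by simp
  have hint: "integrable lborel (h \<xi>)" for \<xi>
    using lborel_pair.integrable_snd[OF integrable_lborel_pair[OF fint[of \<xi>]]] by (simp add: h_def[abs_def])
  have K1: "integrable lborel (K \<xi>)" for \<xi>
    using integrable_lborel_translate[OF hint[of \<xi>], of "- \<xi>"] by (simp add: K_def[abs_def])
  \<comment> \<open>For every \<eta>: the kernel is dominated by the \<open>x\<close>-integral of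
    the norm of \<open>f\<close> at height \<open>\<eta> - \<xi>\<close>, whose integral over \<xi>
    is that of the norm of \<open>f\<close>.\<close>
  have K2: "integrable lborel (\<lambda>\<xi>. K \<xi> \<eta>)" for \<eta>
  proof (rule integrableI_bounded)
    show "(\<lambda>\<xi>. K \<xi> \<eta>) \<in> borel_measurable lborel" unfolding K_def h_def by measurable
    define F where "F y = (\<integral>\<^sup>+x. ennreal (norm (f (x, y))) \<partial>lborel)" for y
    have [measurable]: "F \<in> borel_measurable borel" unfolding F_def by measurable
    have "ennreal (norm (K \<xi> \<eta>)) \<le> F (\<eta> - \<xi>)" for \<xi>
    proof -
      \<comment> \<open>Where the defining integral does not converge, \<open>h\<close> has the
        default value 0 and the bound is trivial.\<close>
      have "ennreal (norm (h \<xi> y)) \<le> (\<integral>\<^sup>+x. ennreal (norm (f (x, y) * cis (2 * pi * (x \<bullet> \<xi>)))) \<partial>lborel)" for y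
        unfolding h_def
        by (cases "integrable lborel (\<lambda>x. f (x, y) * cis (2 * pi * (x \<bullet> \<xi>)))")
          (auto intro: integral_norm_bound_ennreal simp: not_integrable_integral_eq)
      then show ?thesis by (simp add: K_def F_def norm_mult)
    qed
    then have "(\<integral>\<^sup>+\<xi>. ennreal (norm (K \<xi> \<eta>)) \<partial>lborel) \<le> (\<integral>\<^sup>+\<xi>. F (\<eta> - \<xi>) \<partial>lborel)"
      by (intro nn_integral_mono) auto
    also have "\<dots> = (\<integral>\<^sup>+y. F y \<partial>lborel)" by (rule nn_integral_lborel_reflect) measurable
    also have "\<dots> = (\<integral>\<^sup>+p. ennreal (norm (f p)) \<partial>(lborel \<Otimes>\<^sub>M lborel))"
      unfolding F_def by (rule lborel_pair.nn_integral_snd) (simp add: lborel_prod)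
    also have "\<dots> < \<infinity>" using f by (simp add: lborel_prod integrable_iff_bounded)
    finally show "(\<integral>\<^sup>+\<xi>. ennreal (norm (K \<xi> \<eta>)) \<partial>lborel) < \<infinity>" .
  qed
  obtain \<G> :: "nat \<Rightarrow> 'a set" where G0: "\<forall>n. bounded (\<G> n) \<and> \<G> n \<in> sets borel"
    and sep0: "\<forall>v :: 'a \<Rightarrow> complex. integrable lborel v \<longrightarrow> (\<forall>n. (LINT y:\<G> n|lborel. v y) = 0) \<longrightarrow> (AE y in lborel. v y = 0)"
    using countable_bounded_box_generator by blast
  have G: "bounded (\<G> n)" "\<G> n \<in> sets borel" for n using G0 by auto
  have sep: "AE y in lborel. v y = 0" if "integrable lborel v" "\<And>n. (LINT y:\<G> n|lborel. v y) = 0" for v :: "'a \<Rightarrow> complex"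
    using sep0 that by blast
  have eq: "(LINT \<eta>:\<G> n|lborel. K \<xi> \<eta>) =
      (LINT p|lborel. f p * cis (2 * pi * (fst p \<bullet> \<xi>)) * indicator (\<G> n) (\<xi> + snd p))" for \<xi> n
  proof -
    note [measurable] = G(2)
    have hx [measurable]: "h \<xi> \<in> borel_measurable borel" using hint[of \<xi>] by auto
    have "(LINT \<eta>:\<G> n|lborel. K \<xi> \<eta>) = (LINT \<eta>|lborel. indicator (\<G> n) (\<eta> + \<xi>) *\<^sub>R K \<xi> (\<eta> + \<xi>))"
      unfolding set_lebesgue_integral_def
      by (rule integral_lborel_translate[symmetric]) (simp add: K_def, measurable)
    also have "\<dots> = (LINT y|lborel. LINT x|lborel. f (x, y) * cis (2 * pi * (x \<bullet> \<xi>)) * indicator (\<G> n) (\<xi> + y))"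
      by (intro Bochner_Integration.integral_cong refl)
        (simp add: K_def h_def add.commute scaleR_conv_of_real mult.commute indicator_def split: if_splits)
    also have "\<dots> = (LINT p|(lborel \<Otimes>\<^sub>M lborel). (case p of (x, y) \<Rightarrow> f (x, y) * cis (2 * pi * (x \<bullet> \<xi>)) * indicator (\<G> n) (\<xi> + y)))"
    proof (rule lborel_pair.integral_snd)
      show "integrable (lborel \<Otimes>\<^sub>M lborel) (\<lambda>(x, y). f (x, y) * cis (2 * pi * (x \<bullet> \<xi>)) * indicator (\<G> n) (\<xi> + y))"
        unfolding lborel_prod
        by (rule Bochner_Integration.integrable_bound[OF f]) (measurable, auto simp: norm_mult indicator_def)
    qed
    finally show ?thesis by (simp add: lborel_prod case_prod_beta')
  qed
  have "\<exists>N u v. (\<forall>k<N. u k \<in> borel_measurable borel \<and> integrable lborel (v k)) \<and>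
      (AE p in lborel. K (fst p) (snd p) = (\<Sum>k<(N::nat). u k (fst p) * v k (snd p)))"
    by (rule kernel_factorization_right[OF B sep G(2) Km _ wm])
      (use K1 rank[OF G] in \<open>auto simp: eq\<close>)
  then obtain N u v where uv: "\<forall>k<N. u k \<in> borel_measurable borel \<and> integrable lborel (v k)"
      "AE p in lborel. K (fst p) (snd p) = (\<Sum>k<(N::nat). u k (fst p) * v k (snd p))" by blast
  have "\<exists>N u v. (\<forall>k<N. integrable lborel (u k) \<and> integrable lborel (v k)) \<and>
      (AE p in lborel. K (fst p) (snd p) = (\<Sum>k<(N::nat). u k (fst p) * v k (snd p)))"
    by (rule kernel_factorization_left[OF _ _ _ uv(2)]) (use K2 uv(1) in auto)
  then show ?thesis by (simp add: K_def h_def)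
qed

text \<open>Regroups positions and differences, \<open>((x1, x2), (y1, y2))\<close>, into the two
  coordinate planes, \<open>((x1, y1), (x2, y2))\<close>; it is its own inverse.\<close>

definition interchange :: "('a \<times> 'b) \<times> ('c \<times> 'd) \<Rightarrow> ('a \<times> 'c) \<times> ('b \<times> 'd)" where
  "interchange q = ((fst (fst q), fst (snd q)), (snd (fst q), snd (snd q)))"

lemma interchange_simp [simp]: "interchange ((a, b), (c, d)) = ((a, c), (b, d))"
  by (simp add: interchange_def)

lemma interchange_interchange [simp]: "interchange (interchange q) = q"
  by (simp add: interchange_def)

lemma interchange_measurable [measurable]:
  "(interchange :: (('a::euclidean_space \<times> 'b::euclidean_space) \<times> ('c::euclidean_space \<times> 'd::euclidean_space)) \<Rightarrow> _)
     \<in> borel_measurable borel"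
  unfolding interchange_def[abs_def] by measurable

lemma distr_interchange:
  "distr lborel borel (interchange :: (('a::euclidean_space \<times> 'b::euclidean_space) \<times> ('c::euclidean_space \<times> 'd::euclidean_space)) \<Rightarrow> _) = lborel"
proof (rule measure_eqI)
  fix A :: "(('a \<times> 'c) \<times> ('b \<times> 'd)) set"
  assume "A \<in> sets (distr lborel borel (interchange :: ('a \<times> 'b) \<times> ('c \<times> 'd) \<Rightarrow> _))"
  then have [measurable]: "A \<in> sets borel" by simp
  have "emeasure (distr lborel borel (interchange :: ('a \<times> 'b) \<times> ('c \<times> 'd) \<Rightarrow> _)) A =
     (\<integral>\<^sup>+q. indicator A (interchange q) \<partial>lborel)"
    by (subst nn_integral_indicator[symmetric], simp, subst nn_integral_distr) auto
  also have "\<dots> = (\<integral>\<^sup>+x. \<integral>\<^sup>+y. indicator A (interchange (x, y)) \<partial>lborel \<partial>lborel)"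
    by (rule nn_integral_lborel_pair) measurable
  also have "\<dots> = (\<integral>\<^sup>+a. \<integral>\<^sup>+b. \<integral>\<^sup>+y. indicator A (interchange ((a, b), y)) \<partial>lborel \<partial>lborel \<partial>lborel)"
    by (rule nn_integral_lborel_pair) measurable
  also have "\<dots> = (\<integral>\<^sup>+a. \<integral>\<^sup>+b. \<integral>\<^sup>+c. \<integral>\<^sup>+d. indicator A ((a, c), (b, d)) \<partial>lborel \<partial>lborel \<partial>lborel \<partial>lborel)"
  proof (intro nn_integral_cong)
    fix a b
    have "(\<integral>\<^sup>+y. indicator A (interchange ((a, b), y)) \<partial>lborel) =
      (\<integral>\<^sup>+c. \<integral>\<^sup>+d. indicator A (interchange ((a, b), (c, d))) \<partial>lborel \<partial>lborel)"
      by (rule nn_integral_lborel_pair) measurable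
    then show "(\<integral>\<^sup>+y. indicator A (interchange ((a, b), y)) \<partial>lborel) =
      (\<integral>\<^sup>+c. \<integral>\<^sup>+d. indicator A ((a, c), (b, d)) \<partial>lborel \<partial>lborel)" by simp
  qed
  also have "\<dots> = (\<integral>\<^sup>+a. \<integral>\<^sup>+c. \<integral>\<^sup>+b. \<integral>\<^sup>+d. indicator A ((a, c), (b, d)) \<partial>lborel \<partial>lborel \<partial>lborel \<partial>lborel)"
    by (intro nn_integral_cong lborel_pair.Fubini') measurable
  also have "\<dots> = (\<integral>\<^sup>+a. \<integral>\<^sup>+c. \<integral>\<^sup>+z. indicator A ((a, c), z) \<partial>lborel \<partial>lborel \<partial>lborel)"
    by (intro nn_integral_cong nn_integral_lborel_pair[symmetric]) measurable
  also have "\<dots> = (\<integral>\<^sup>+w. \<integral>\<^sup>+z. indicator A (w, z) \<partial>lborel \<partial>lborel)"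
    by (rule nn_integral_lborel_pair[symmetric]) measurable
  also have "\<dots> = (\<integral>\<^sup>+q. indicator A q \<partial>lborel)"
    by (rule nn_integral_lborel_pair[symmetric]) measurable
  also have "\<dots> = emeasure lborel A" by simp
  finally show "emeasure (distr lborel borel interchange) A = emeasure lborel A" .
qed simp

lemma AE_lborel_interchange:
  fixes P :: "('a::euclidean_space \<times> 'c::euclidean_space) \<times> ('b::euclidean_space \<times> 'd::euclidean_space) \<Rightarrow> bool"
  assumes "AE q in lborel. P q"
  shows "AE q in lborel. P (interchange q)"
proof -
  have "AE q in distr lborel borel (interchange :: ('a \<times> 'b) \<times> ('c \<times> 'd) \<Rightarrow> _). P q"
    using assms by (subst distr_interchange)
  then show ?thesis by (rule AE_distrD[rotated]) simp
qed

section \<open>The complex Weyl transform\<close>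

lemma integrable_interchange:
  fixes f :: "('a::euclidean_space \<times> 'b::euclidean_space) \<times> ('c::euclidean_space \<times> 'd::euclidean_space) \<Rightarrow> complex"
  assumes f: "integrable lborel f"
  shows "integrable lborel (\<lambda>q. f (interchange q))"
proof -
  have "integrable (distr lborel borel (interchange :: ('a \<times> 'c) \<times> ('b \<times> 'd) \<Rightarrow> _)) f"
    using f by (subst distr_interchange)
  then show ?thesis by (rule integrable_distr[rotated]) simp
qed

text \<open>For almost every \<open>z = (\<xi>2, \<eta>2)\<close> the Fourier transform of
  \<open>f\<close> in \<open>x2\<close> at \<xi>2, with \<open>y2 = \<eta>2 - \<xi>2\<close>, is a
  function of \<open>(x1, y1)\<close> that vanishes off \<open>S\<close>. Its kernel is the section
  of the full kernel at \<open>z\<close>, factored by the sections of \<open>u\<close> and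
  \<open>v\<close>, so the planar case kills it. Fourier uniqueness in \<open>x2\<close> returns to
  \<open>f\<close>.\<close>

lemma finite_rank_finite_support_imp_0:
  fixes f :: "plane \<times> plane \<Rightarrow> complex" and w :: "'i \<Rightarrow> plane \<Rightarrow> complex"
  assumes f: "integrable lborel f"
    and S: "S \<in> sets borel" "emeasure lborel S < \<infinity>"
    and supp: "\<And>x y. f (x, y) \<noteq> 0 \<Longrightarrow> (fst x, fst y) \<in> S"
    and B: "finite B" and wm: "\<And>b. b \<in> B \<Longrightarrow> w b \<in> borel_measurable borel"
    and rank: "\<And>A. bounded A \<Longrightarrow> A \<in> sets borel \<Longrightarrow> \<exists>c. AE \<xi> in lborel.
      (LINT p|lborel. f p * cis (2 * pi * (fst p \<bullet> \<xi>)) * indicator A (\<xi> + snd p)) = (\<Sum>b\<in>B. c b * w b \<xi>)"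
  shows "AE p in lborel. f p = 0"
proof -
  have [measurable]: "f \<in> borel_measurable borel" using f by auto
  obtain N u v where ui: "\<And>k. k < N \<Longrightarrow> integrable lborel (u k)" and vi: "\<And>k. k < N \<Longrightarrow> integrable lborel (v k)"
    and K: "AE p in lborel. (LINT x|lborel. f (x, snd p - fst p) * cis (2 * pi * (x \<bullet> fst p))) =
      (\<Sum>k<(N::nat). u k (fst p) * v k (snd p))"
    using finite_rank_kernel_factorization[OF f B wm rank] by blast
  define g where "g q = f (interchange q)" for q
  have gi: "integrable lborel g" unfolding g_def using f by (rule integrable_interchange)
  have [measurable]: "g \<in> borel_measurable borel" using gi by auto
  define ft where "ft \<xi> y q = (LINT x|lborel. g (q, (x, y)) * cis (2 * pi * \<xi> * x))" for \<xi> y q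
  \<comment> \<open>The bound by \<open>G\<close> does not involve \<xi>, so the exceptional set
    lies in \<open>y\<close> alone and \<xi> may later be tied to \<open>z\<close>.\<close>
  have C: "AE y in lborel. \<forall>\<xi>. integrable lborel (ft \<xi> y)"
  proof -
    define G where "G z = (\<integral>\<^sup>+q. ennreal (norm (g (q, z))) \<partial>lborel)" for z
    have [measurable]: "G \<in> borel_measurable borel" unfolding G_def by measurable
    have "(\<integral>\<^sup>+z. G z \<partial>lborel) = (\<integral>\<^sup>+p. ennreal (norm (g p)) \<partial>(lborel \<Otimes>\<^sub>M lborel))"
      unfolding G_def by (rule lborel_pair.nn_integral_snd) (simp add: lborel_prod)
    also have "\<dots> < \<infinity>" using gi by (simp add: lborel_prod integrable_iff_bounded)
    finally have "(\<integral>\<^sup>+x. \<integral>\<^sup>+y. G (x, y) \<partial>lborel \<partial>lborel) < \<infinity>"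
      by (subst (asm) nn_integral_lborel_pair) auto
    moreover have "(\<integral>\<^sup>+y. \<integral>\<^sup>+x. G (x, y) \<partial>lborel \<partial>lborel) = (\<integral>\<^sup>+x. \<integral>\<^sup>+y. G (x, y) \<partial>lborel \<partial>lborel)"
      by (rule lborel_pair.Fubini') measurable
    ultimately have "AE y in lborel. (\<integral>\<^sup>+x. G (x, y) \<partial>lborel) \<noteq> \<infinity>"
      by (intro nn_integral_PInf_AE) auto
    then show ?thesis
    proof eventually_elim
      case (elim y)
      show ?case
      proof
        fix \<xi>
        show "integrable lborel (ft \<xi> y)"
        proof (rule integrableI_bounded)
          show "ft \<xi> y \<in> borel_measurable lborel" unfolding ft_def by measurable
          have "ennreal (norm (ft \<xi> y q)) \<le> (\<integral>\<^sup>+x. ennreal (norm (g (q, (x, y)))) \<partial>lborel)" for q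
          proof (cases "integrable lborel (\<lambda>x. g (q, (x, y)) * cis (2 * pi * \<xi> * x))")
            case True
            from integral_norm_bound_ennreal[OF this] show ?thesis by (simp add: ft_def norm_mult)
          qed (simp add: ft_def not_integrable_integral_eq)
          then have "(\<integral>\<^sup>+q. ennreal (norm (ft \<xi> y q)) \<partial>lborel) \<le>
            (\<integral>\<^sup>+q. \<integral>\<^sup>+x. ennreal (norm (g (q, (x, y)))) \<partial>lborel \<partial>lborel)"
            by (intro nn_integral_mono) auto
          also have "\<dots> = (\<integral>\<^sup>+x. G (x, y) \<partial>lborel)"
            unfolding G_def by (rule lborel_pair.Fubini') measurable
          also have "\<dots> < \<infinity>" using elim by (simp add: less_top)
          finally show "(\<integral>\<^sup>+q. ennreal (norm (ft \<xi> y q)) \<partial>lborel) < \<infinity>" .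
        qed
      qed
    qed
  qed
  have Bf: "AE y in lborel. integrable lborel (\<lambda>x. f (x, y))"
    by (rule lborel_pair.AE_integrable_snd[OF integrable_lborel_pair[OF f]])
  \<comment> \<open>Integrability is carried along because Fubini will split the integral over
    \<open>x\<close> into those over \<open>x1\<close> and \<open>x2\<close>.\<close>
  define P where "P p \<longleftrightarrow> (LINT x|lborel. f (x, snd p - fst p) * cis (2 * pi * (x \<bullet> fst p))) =
      (\<Sum>k<N. u k (fst p) * v k (snd p)) \<and> integrable lborel (\<lambda>x. f (x, snd p - fst p))" for p
  have "AE p in lborel. integrable lborel (\<lambda>x. f (x, snd p + - fst p))"
    using AE_lborel_shear[of uminus, OF _ AE_lborel_snd[OF Bf]] by simp
  with K have "AE p in lborel. P p" unfolding P_def by eventually_elim simp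
  from AE_lborel_pairD[OF AE_lborel_swap[OF AE_lborel_interchange[OF this]]]
  have P: "AE z in lborel. AE q in lborel. P ((fst q, fst z), (snd q, snd z))"
    by (simp add: interchange_def)
  have "AE y in lborel. \<forall>k\<in>{..<N}. integrable lborel (\<lambda>x. u k (x, y))"
    by (intro AE_finite_allI lborel_pair.AE_integrable_snd integrable_lborel_pair ui) auto
  from AE_lborel_fst[OF this]
  have Du: "AE z in (lborel :: plane measure). \<forall>k\<in>{..<N}. integrable lborel (\<lambda>x. u k (x, fst z))" .
  have "AE y in lborel. \<forall>k\<in>{..<N}. integrable lborel (\<lambda>x. v k (x, y))"
    by (intro AE_finite_allI lborel_pair.AE_integrable_snd integrable_lborel_pair vi) auto
  from AE_lborel_snd[OF this]
  have Dv: "AE z in (lborel :: plane measure). \<forall>k\<in>{..<N}. integrable lborel (\<lambda>x. v k (x, snd z))" .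
  have C': "AE z in (lborel :: plane measure). \<forall>\<xi>. integrable lborel (ft \<xi> (snd z + - fst z))"
    using AE_lborel_shear[of uminus, OF _ AE_lborel_snd[OF C]] by simp
  from P Du Dv C' have "AE z in lborel. AE q in lborel. ft (fst z) (snd z - fst z) q = 0"
  proof eventually_elim
    case (elim z)
    define \<xi>2 \<eta>2 where "\<xi>2 = fst z" and "\<eta>2 = snd z"
    let ?f = "ft (fst z) (snd z - fst z)"
    show ?case
    proof (rule finite_rank_kernel_finite_support_imp_0
        [where N = N and u = "\<lambda>k x. u k (x, \<xi>2)" and v = "\<lambda>k y. v k (y, \<eta>2)"])
      show "integrable lborel ?f" using elim(4) by simp
      have "{q. ?f q \<noteq> 0} \<subseteq> S"
      proof
        fix q assume q: "q \<in> {q. ?f q \<noteq> 0}"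
        show "q \<in> S"
        proof (rule ccontr)
          assume "q \<notin> S"
          then have "g (q, t) = 0" for t
            using supp[of "(fst q, fst t)" "(snd q, snd t)"] by (auto simp: g_def interchange_def)
          then have "?f q = 0" by (simp add: ft_def)
          with q show False by simp
        qed
      qed
      then have "emeasure lborel {q. ?f q \<noteq> 0} \<le> emeasure lborel S"
        using S(1) by (intro emeasure_mono) auto
      then show "emeasure lborel {q. ?f q \<noteq> 0} < \<infinity>" using S(2) by (rule le_less_trans)
      show "integrable lborel (\<lambda>x. u k (x, \<xi>2))" if "k < N" for k using elim(2) that by (simp add: \<xi>2_def)
      show "integrable lborel (\<lambda>y. v k (y, \<eta>2))" if "k < N" for k using elim(3) that by (simp add: \<eta>2_def)
      show "AE p in lborel. partial_ft ?f (fst p) (snd p - fst p) =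
           (\<Sum>k<N. u k (fst p, \<xi>2) * v k (snd p, \<eta>2))"
        using elim(1)
      proof eventually_elim
        case (elim p)
        define y where "y = (snd p - fst p, \<eta>2 - \<xi>2)"
        have yeq: "(snd p, \<eta>2) - (fst p, \<xi>2) = y" by (simp add: y_def)
        have Pz: "P ((fst p, \<xi>2), (snd p, \<eta>2))" using elim by (simp add: \<xi>2_def \<eta>2_def)
        have Py: "(LINT x|lborel. f (x, y) * cis (2 * pi * (x \<bullet> (fst p, \<xi>2)))) =
            (\<Sum>k<N. u k (fst p, \<xi>2) * v k (snd p, \<eta>2))" and fy: "integrable lborel (\<lambda>x. f (x, y))"
          using Pz unfolding P_def fst_conv snd_conv yeq by blast+
        from fy have "integrable lborel (\<lambda>x. f (x, y) * cis (2 * pi * (x \<bullet> (fst p, \<xi>2))))" by simp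
        then have "(LINT x|lborel. f (x, y) * cis (2 * pi * (x \<bullet> (fst p, \<xi>2)))) =
          (LINT x1|lborel. LINT x2|lborel. f ((x1, x2), y) * cis (2 * pi * ((x1, x2) \<bullet> (fst p, \<xi>2))))"
          unfolding lborel_prod[symmetric] by (rule lborel_pair.integral_fst'[symmetric])
        also have "\<dots> = (LINT x1|lborel. (LINT x2|lborel. f ((x1, x2), y) * cis (2 * pi * \<xi>2 * x2)) * cis (2 * pi * fst p * x1))"
        proof (rule Bochner_Integration.integral_cong[OF refl])
          fix x1
          have "f ((x1, x2), y) * cis (2 * pi * ((x1, x2) \<bullet> (fst p, \<xi>2))) =
            f ((x1, x2), y) * cis (2 * pi * \<xi>2 * x2) * cis (2 * pi * fst p * x1)" for x2
            by (simp add: mult.assoc cis_mult algebra_simps)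
          then show "(LINT x2|lborel. f ((x1, x2), y) * cis (2 * pi * ((x1, x2) \<bullet> (fst p, \<xi>2)))) =
            (LINT x2|lborel. f ((x1, x2), y) * cis (2 * pi * \<xi>2 * x2)) * cis (2 * pi * fst p * x1)"
            by (subst integral_mult_left_zero[symmetric]) (simp only:)
        qed
        also have "\<dots> = partial_ft ?f (fst p) (snd p - fst p)"
          unfolding partial_ft_def ft_def g_def by (simp add: y_def \<xi>2_def \<eta>2_def)
        finally show ?case using Py by simp
      qed
    qed
  qed
  \<comment> \<open>Undoes the substitution \<open>y2 = \<eta>2 - \<xi>2\<close>, so that \<xi>2 and
    \<open>y2\<close> vary independently.\<close>
  from AE_lborel_shear[of "\<lambda>x. x", OF _ this]
  have ftz: "AE z in lborel. AE q in lborel. ft (fst z) (snd z) q = 0" by simp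
  have "Measurable.pred borel (\<lambda>r :: plane \<times> plane. ft (fst (fst r)) (snd (fst r)) (snd r) = 0)"
    unfolding ft_def by measurable
  from AE_lborel_pairI[OF this] ftz
  have "AE r in lborel. ft (fst (fst r)) (snd (fst r)) (snd r) = 0" by simp
  from AE_lborel_pairD[OF AE_lborel_swap[OF this]]
  have "AE q in lborel. AE z in lborel. ft (fst z) (snd z) q = 0" by simp
  moreover have "AE q in lborel. integrable lborel (\<lambda>z. g (q, z))"
    by (rule lborel_pair.AE_integrable_fst[OF integrable_lborel_pair[OF gi]])
  ultimately have "AE q in lborel. AE z in lborel. g (q, z) = 0"
  proof eventually_elim
    case (elim q)
    from AE_lborel_pairD[OF AE_lborel_swap[OF elim(1)]]
    have "AE y in lborel. AE \<xi> in lborel. ft \<xi> y q = 0" by simp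
    moreover have "AE y in lborel. integrable lborel (\<lambda>x. g (q, (x, y)))"
      by (rule lborel_pair.AE_integrable_snd[OF integrable_lborel_pair[OF elim(2)]])
    ultimately have "AE y in lborel. AE x in lborel. g (q, (x, y)) = 0"
      by eventually_elim (rule AE_eq_0_if_fourier_AE_eq_0, simp_all add: ft_def)
    moreover have "Measurable.pred borel (\<lambda>z :: plane. g (q, (snd z, fst z)) = 0)" by measurable
    ultimately have "AE z in (lborel :: plane measure). g (q, (snd z, fst z)) = 0"
      using AE_lborel_pairI[of "\<lambda>z. g (q, (snd z, fst z)) = 0"] by simp
    from AE_lborel_swap[OF this] show ?case by simp
  qed
  then have "AE r in lborel. g r = 0"
    using AE_lborel_pairI[of "\<lambda>r. g r = 0"] by simp
  from AE_lborel_interchange[OF this] show ?thesis by (simp add: g_def)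
qed

section \<open>Reduction from quaternions to complex numbers\<close>

text \<open>Transports the measure theory from pairs, where the product structure is available, to
  the vectors of the theorem.\<close>

definition vec2 :: "plane \<Rightarrow> real^2" where
  "vec2 p = (\<chi> i. if i = 1 then fst p else snd p)"

lemma vec2_nth [simp]: "vec2 p $ 1 = fst p" "vec2 p $ 2 = snd p"
  by (simp_all add: vec2_def)

lemma vec2_eq: "vec2 p = fst p *\<^sub>R axis 1 1 + snd p *\<^sub>R axis 2 1"
  by (simp add: vec_eq_iff forall_2 axis_def)

lemma vec2_measurable [measurable]: "vec2 \<in> borel_measurable borel"
  unfolding vec2_eq[abs_def] by measurable

lemma vec_nth_measurable [measurable]: "(\<lambda>x :: real^2. x $ i) \<in> borel_measurable borel"
  by (intro borel_measurable_continuous_onI continuous_intros)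

lemma distr_vec2: "distr lborel borel vec2 = lborel"
proof (rule lborel_eqI[symmetric])
  fix l u :: "real^2" assume le: "\<And>b. b \<in> Basis \<Longrightarrow> l \<bullet> b \<le> u \<bullet> b"
  have ax: "axis i 1 \<in> (Basis :: (real^2) set)" for i by (simp add: axis_in_Basis_iff)
  have le': "l $ i \<le> u $ i" for i using le[OF ax[of i]] by (simp add: inner_axis)
  have pre: "vec2 -` box l u = {l$1<..<u$1} \<times> {l$2<..<u$2}"
    by (auto simp: box_def Basis_vec_def inner_axis forall_2)
  have "emeasure (distr lborel borel vec2) (box l u) = emeasure (lborel \<Otimes>\<^sub>M lborel) ({l$1<..<u$1} \<times> {l$2<..<u$2})"
    by (subst emeasure_distr) (auto simp: pre lborel_prod)
  also have "\<dots> = ennreal (u$1 - l$1) * ennreal (u$2 - l$2)"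
    using le' by (subst lborel.emeasure_pair_measure_Times) auto
  also have "\<dots> = ennreal ((u$1 - l$1) * (u$2 - l$2))"
    using le' by (simp add: ennreal_mult)
  also have "(u$1 - l$1) * (u$2 - l$2) = (\<Prod>b\<in>Basis. (u - l) \<bullet> b)"
  proof -
    have B: "(Basis :: (real^2) set) = {axis 1 1, axis 2 1}" by (auto simp: Basis_vec_def UNIV_2)
    have ne: "axis 1 (1::real) \<noteq> (axis 2 1 :: real^2)" by (simp add: axis_eq_axis)
    show ?thesis unfolding B using ne by (simp add: inner_axis)
  qed
  finally show "emeasure (distr lborel borel vec2) (box l u) = ennreal (\<Prod>b\<in>Basis. (u - l) \<bullet> b)" .
qed simp

definition vec4 :: "plane \<times> plane \<Rightarrow> (real^2) \<times> (real^2)" where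
  "vec4 q = (vec2 (fst q), vec2 (snd q))"

lemma vec4_measurable [measurable]: "vec4 \<in> borel_measurable borel"
  unfolding vec4_def[abs_def] by measurable

lemma distr_vec4: "distr lborel borel vec4 = lborel"
proof (rule measure_eqI)
  have n2: "(\<integral>\<^sup>+x. f (vec2 x) \<partial>lborel) = (\<integral>\<^sup>+x. f x \<partial>lborel)" if [measurable]: "f \<in> borel_measurable borel" for f
    by (subst distr_vec2[symmetric], subst nn_integral_distr) auto
  fix A assume "A \<in> sets (distr lborel borel vec4)"
  then have [measurable]: "A \<in> sets borel" by simp
  have "emeasure (distr lborel borel vec4) A = (\<integral>\<^sup>+q. indicator A (vec4 q) \<partial>lborel)"
    by (subst nn_integral_indicator[symmetric], simp, subst nn_integral_distr) auto
  also have "\<dots> = (\<integral>\<^sup>+x. \<integral>\<^sup>+y. indicator A (vec4 (x, y)) \<partial>lborel \<partial>lborel)"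
    by (rule nn_integral_lborel_pair) measurable
  also have "\<dots> = (\<integral>\<^sup>+x. \<integral>\<^sup>+y. indicator A (vec2 x, vec2 y) \<partial>lborel \<partial>lborel)"
    by (simp add: vec4_def)
  also have "\<dots> = (\<integral>\<^sup>+x. \<integral>\<^sup>+y. indicator A (vec2 x, y) \<partial>lborel \<partial>lborel)"
    by (intro nn_integral_cong n2) measurable
  also have "\<dots> = (\<integral>\<^sup>+x. \<integral>\<^sup>+y. indicator A (x, y) \<partial>lborel \<partial>lborel)"
    by (rule n2) measurable
  also have "\<dots> = (\<integral>\<^sup>+q. indicator A q \<partial>lborel)"
    by (rule nn_integral_lborel_pair[symmetric]) measurable
  also have "\<dots> = emeasure lborel A" by simp
  finally show "emeasure (distr lborel borel vec4) A = emeasure lborel A" .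
qed simp

text \<open>Coordinates with respect to the basis reduce this to real functions.\<close>

lemma borel_version:
  fixes f :: "'a::euclidean_space \<Rightarrow> 'b::euclidean_space"
  assumes f: "f \<in> borel_measurable lebesgue"
  shows "\<exists>f'\<in>borel_measurable borel. AE x in lborel. f x = f' x"
proof -
  have "\<exists>h\<in>borel_measurable lborel. AE x in lborel. f x \<bullet> b = h x" for b
    using f by (intro completion_ex_borel_measurable_real borel_measurable_inner borel_measurable_const)
  then obtain h where h: "\<And>b. h b \<in> borel_measurable lborel" "\<And>b. AE x in lborel. f x \<bullet> b = h b x" by metis
  have [measurable]: "h b \<in> borel_measurable borel" for b using h(1)[of b] by simp
  show ?thesis
  proof (rule bexI[of _ "\<lambda>x. \<Sum>b\<in>Basis. h b x *\<^sub>R b"])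
    have "AE x in lborel. \<forall>b\<in>Basis. f x \<bullet> b = h b x"
      by (intro AE_finite_allI h(2)) auto
    then show "AE x in lborel. f x = (\<Sum>b\<in>Basis. h b x *\<^sub>R b)"
    proof eventually_elim
      case (elim x)
      have "f x = (\<Sum>b\<in>Basis. (f x \<bullet> b) *\<^sub>R b)" by (rule euclidean_representation[symmetric])
      also have "\<dots> = (\<Sum>b\<in>Basis. h b x *\<^sub>R b)" using elim by (intro sum.cong) auto
      finally show ?case .
    qed
    show "(\<lambda>x. \<Sum>b\<in>Basis. h b x *\<^sub>R b) \<in> borel_measurable borel" by measurable
  qed
qed

section \<open>Complex subfields of the quaternions\<close>

definition quat_ci :: "complex \<Rightarrow> quat" where "quat_ci z = Re z *\<^sub>R 1 + Im z *\<^sub>R quat_i"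
definition quat_cj :: "complex \<Rightarrow> quat" where "quat_cj z = Re z *\<^sub>R 1 + Im z *\<^sub>R quat_j"

lemma quat_ci_mult: "quat_ci (y * z) = quat_ci y * quat_ci z"
  by (simp add: quat_ci_def quat_eq_iff algebra_simps)

lemma quat_cj_mult: "quat_cj (y * z) = quat_cj y * quat_cj z"
  by (simp add: quat_cj_def quat_eq_iff algebra_simps)

text \<open>A bounded homomorphism commutes with each partial sum of the exponential series. Applied
  to the two embeddings of the complex numbers, it reduces both exponentials in \<open>rho\<close>
  to \<open>cis\<close>.\<close>

lemma exp_hom:
  fixes T :: "complex \<Rightarrow> 'b::{real_normed_algebra_1, banach}"
  assumes bl: "bounded_linear T" and one: "T 1 = 1" and mult: "\<And>y z. T (y * z) = T y * T z"
  shows "exp (T z) = T (exp z)"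
proof -
  interpret bounded_linear T by fact
  have pow: "T (z ^ n) = T z ^ n" for n by (induction n) (simp_all add: one mult)
  have "(\<lambda>n. T (z ^ n /\<^sub>R fact n)) sums T (exp z)"
    by (intro sums exp_converges)
  then have "(\<lambda>n. T z ^ n /\<^sub>R fact n) sums T (exp z)" by (simp add: scaleR pow)
  with exp_converges[of "T z"] show ?thesis by (rule sums_unique2)
qed

lemma exp_quat_i: "exp (t *\<^sub>R quat_i) = quat_ci (cis t)"
proof -
  have "bounded_linear quat_ci"
    unfolding quat_ci_def by (intro bounded_linear_intros bounded_linear_Re bounded_linear_Im)
  moreover have "quat_ci 1 = 1" by (simp add: quat_ci_def)
  ultimately have "exp (quat_ci (\<i> * of_real t)) = quat_ci (exp (\<i> * of_real t))"
    by (intro exp_hom quat_ci_mult)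
  then show ?thesis by (simp add: quat_ci_def cis_conv_exp)
qed

lemma exp_quat_j: "exp (t *\<^sub>R quat_j) = quat_cj (cis t)"
proof -
  have "bounded_linear quat_cj"
    unfolding quat_cj_def by (intro bounded_linear_intros bounded_linear_Re bounded_linear_Im)
  moreover have "quat_cj 1 = 1" by (simp add: quat_cj_def)
  ultimately have "exp (quat_cj (\<i> * of_real t)) = quat_cj (exp (\<i> * of_real t))"
    by (intro exp_hom quat_cj_mult)
  then show ?thesis by (simp add: quat_cj_def cis_conv_exp)
qed

text \<open>On \<open>e = i + j\<close> right multiplication by \<open>j\<close> is left multiplication by \<open>i\<close>, so \<open>rho\<close>
  restricted to functions with values in the left complex line through \<open>e\<close> is the complex
  Schroedinger representation.\<close>

definition quat_e :: quat where "quat_e = quat_i + quat_j"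

lemma quat_e_cj: "quat_e * quat_cj z = quat_ci z * quat_e"
  by (simp add: quat_e_def quat_ci_def quat_cj_def quat_eq_iff)

lemma quat_e_neq_0: "quat_e \<noteq> 0"
  by (simp add: quat_e_def quat_eq_iff)

text \<open>The coordinates \<open>a, b\<close> of \<open>q = a + j b\<close> with respect to the right action of \<open>\<real> + \<real>i\<close>.\<close>

definition coord_a :: "quat \<Rightarrow> complex" where "coord_a q = Complex (qRe q) (qIm1 q)"
definition coord_b :: "quat \<Rightarrow> complex" where "coord_b q = Complex (qIm2 q) (- qIm3 q)"

text \<open>Right multiplication by the subfield of \<open>quat_i\<close> is complex multiplication
  in both coordinates; the minus sign in \<open>coord_b\<close> reflects
  \<open>j * i = - k\<close>.\<close>

lemma coord_mult_ci: "coord_a (q * quat_ci z) = coord_a q * z" "coord_b (q * quat_ci z) = coord_b q * z"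
  by (simp_all add: coord_a_def coord_b_def quat_ci_def complex_eq_iff algebra_simps)

lemma coord_eq_0: "coord_a q = 0 \<Longrightarrow> coord_b q = 0 \<Longrightarrow> q = 0"
  by (simp add: coord_a_def coord_b_def complex_eq_iff quat_eq_iff)

lemma norm_coord_le: "norm (coord_a q) \<le> norm q" "norm (coord_b q) \<le> norm q"
  by (auto simp: coord_a_def coord_b_def norm_quat_eq cmod_def)

lemma bounded_linear_coord: "bounded_linear coord_a" "bounded_linear coord_b"
  by (rule bounded_linear_intro[where K = 1],
      simp_all add: norm_coord_le[THEN order_trans] norm_coord_le, simp_all add: coord_a_def coord_b_def complex_eq_iff)+

text \<open>Moving the right exponential across \<open>quat_e\<close> makes it a left one in the
  same complex subfield, so both merge into one character in \<xi> times the central phase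
  \<open>cis (pi * (x \<bullet> y))\<close>.\<close>

lemma rho_indicator:
  "rho x y (\<lambda>\<eta>. indicator A \<eta> *\<^sub>R quat_e) \<xi> =
    indicator A (\<xi> + y) *\<^sub>R (quat_ci (cis (pi * (x \<bullet> y)) * cis (2 * pi * (x \<bullet> \<xi>))) * quat_e)"
proof -
  let ?s = "2 * pi * (x $ 1 * \<xi> $ 1 + x $ 1 * y $ 1 / 2)" and ?t = "2 * pi * (x $ 2 * \<xi> $ 2 + x $ 2 * y $ 2 / 2)"
  have "rho x y (\<lambda>\<eta>. indicator A \<eta> *\<^sub>R quat_e) \<xi> =
    indicator A (\<xi> + y) *\<^sub>R (quat_ci (cis ?s) * (quat_e * quat_cj (cis ?t)))"
    unfolding rho_def exp_quat_i exp_quat_j by (simp add: mult.assoc)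
  also have "quat_ci (cis ?s) * (quat_e * quat_cj (cis ?t)) = quat_ci (cis ?s * cis ?t) * quat_e"
    by (simp add: quat_e_cj quat_ci_mult mult.assoc)
  also have "cis ?s * cis ?t = cis (pi * (x \<bullet> y)) * cis (2 * pi * (x \<bullet> \<xi>))"
    by (simp add: cis_mult inner_vec_def sum_2 algebra_simps)
  finally show ?thesis .
qed

section \<open>Weyl transform in complex coordinates\<close>

lemma AE_lebesgue_iff: "(AE x in lebesgue. P x) \<longleftrightarrow> (AE x in lborel. P x)"
  by (rule AE_completion_iff)

lemma borel_imp_lebesgue_measurable:
  "f \<in> borel_measurable borel \<Longrightarrow> f \<in> borel_measurable (lebesgue :: 'a::euclidean_space measure)"
  by (rule measurable_completion) simp

text \<open>A Borel version of \<open>g\<close> is cut off outside \<open>T\<close>, so that the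
  support condition holds everywhere and survives restriction to sections.\<close>

lemma Lspace_1_borel_version:
  fixes g :: "(real^2) \<times> (real^2) \<Rightarrow> quat"
  assumes g: "g \<in> Lspace 1" and T: "T \<in> sets borel"
    and supp: "\<And>x y. g (x, y) \<noteq> 0 \<Longrightarrow> (x $ 1, y $ 1) \<in> T"
  shows "\<exists>h. integrable lborel h \<and> (AE p in lborel. g p = h p) \<and> (\<forall>x y. h (x, y) \<noteq> 0 \<longrightarrow> (x $ 1, y $ 1) \<in> T)"
proof -
  have gm: "g \<in> borel_measurable lebesgue" and gi: "integrable lebesgue (\<lambda>x. norm (g x))"
    using g by (auto simp: Lspace_def)
  obtain g' where g': "g' \<in> borel_measurable borel" "AE p in lborel. g p = g' p"
    using borel_version[OF gm] by blast
  note [measurable] = g'(1) T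
  define h where "h p = (if (fst p $ 1, snd p $ 1) \<in> T then g' p else 0)" for p
  have cm [measurable]: "(\<lambda>p :: (real^2) \<times> (real^2). fst p $ 1) \<in> borel_measurable borel"
    "(\<lambda>p :: (real^2) \<times> (real^2). snd p $ 1) \<in> borel_measurable borel"
    by (intro borel_measurable_continuous_onI continuous_intros)+
  have hm: "h \<in> borel_measurable borel" unfolding h_def by measurable
  have gh: "AE p in lborel. g p = h p"
    using g'(2) by eventually_elim (use supp in \<open>force simp: h_def\<close>)
  have "integrable lebesgue h"
  proof (rule Bochner_Integration.integrable_bound[OF gi])
    show "h \<in> borel_measurable lebesgue" using hm by (rule borel_imp_lebesgue_measurable)
    show "AE x in lebesgue. norm (h x) \<le> norm (norm (g x))"
      using AE_completion[OF gh] by eventually_elim simp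
  qed
  then have "integrable lborel h" using hm by (subst (asm) integrable_completion) auto
  with gh show ?thesis by (intro exI[of _ h]) (auto simp: h_def)
qed

text \<open>In the integrand \<open>h\<close> stands left of a complex factor and then
  \<open>quat_e\<close>. Dividing by \<open>quat_e\<close> on the right exposes the complex factor,
  which \<open>L\<close> carries outside because it is linear for right multiplication by complex
  numbers.\<close>

lemma weyl_indicator:
  fixes g h :: "(real^2) \<times> (real^2) \<Rightarrow> quat"
  assumes g: "g \<in> borel_measurable lebesgue" and h: "integrable lborel h" and gh: "AE p in lborel. g p = h p"
    and A: "A \<in> sets borel"
    and L: "bounded_linear L" "\<And>q z. L (q * quat_ci z) = L q * (z :: complex)"
  shows "L (weyl g (\<lambda>\<eta>. indicator {\<zeta>. (\<zeta> $ 1, \<zeta> $ 2) \<in> A} \<eta> *\<^sub>R quat_e) (vec2 \<xi>) * inverse quat_e) =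
    (LINT p|lborel. L (h (vec4 p)) * cis (pi * (fst p \<bullet> snd p)) * cis (2 * pi * (fst p \<bullet> \<xi>)) * indicator A (\<xi> + snd p))"
proof -
  let ?E = "\<lambda>x. quat_ci (cis (pi * (fst x \<bullet> snd x)) * cis (2 * pi * (fst x \<bullet> vec2 \<xi>)))"
  let ?A = "{\<zeta> :: real^2. (\<zeta> $ 1, \<zeta> $ 2) \<in> A}" and ?\<phi> = "\<lambda>\<eta>. indicator {\<zeta>. (\<zeta> $ 1, \<zeta> $ 2) \<in> A} \<eta> *\<^sub>R quat_e"
  interpret L: bounded_linear L by (rule L)
  have [measurable]: "h \<in> borel_measurable borel" "A \<in> sets borel" using h A by auto
  have Am [measurable]: "?A \<in> sets borel"
  proof -
    have "(\<lambda>\<zeta> :: real^2. (\<zeta> $ 1, \<zeta> $ 2)) -` A \<inter> space borel \<in> sets borel"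
      by (rule measurable_sets[OF _ A]) measurable
    then show ?thesis by (simp add: vimage_def)
  qed
  have Lm [measurable]: "L \<in> borel_measurable borel"
    by (intro borel_measurable_continuous_onI L.continuous_on continuous_on_id)
  have qm [measurable]: "quat_ci \<in> borel_measurable borel"
    unfolding quat_ci_def[abs_def] by (intro borel_measurable_continuous_onI continuous_intros)
  define G where "G x = indicator ?A (vec2 \<xi> + snd x) *\<^sub>R (h x * (?E x * quat_e))" for x
  have qn: "norm (quat_ci z) = norm z" for z
    by (simp add: norm_quat_eq quat_ci_def cmod_def)
  have Gm [measurable]: "G \<in> borel_measurable borel" unfolding G_def by measurable
  have hn: "integrable lborel (\<lambda>x. norm (h x) * norm quat_e)" using h by simp
  have Gi: "integrable lborel G"
    by (rule Bochner_Integration.integrable_bound[OF hn])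
      (measurable, auto simp: G_def norm_mult qn indicator_def)
  have "weyl g ?\<phi> (vec2 \<xi>) = (LINT x|lebesgue. G x)"
    unfolding weyl_def
  proof (rule integral_cong_AE)
    have "(\<lambda>x. indicator ?A (vec2 \<xi> + snd x) *\<^sub>R (?E x * quat_e))
       \<in> borel_measurable borel" by measurable
    then have "(\<lambda>x. g x * (indicator ?A (vec2 \<xi> + snd x) *\<^sub>R (?E x * quat_e)))
       \<in> borel_measurable lebesgue"
      by (intro borel_measurable_times g borel_imp_lebesgue_measurable)
    then show "(\<lambda>(x, y). g (x, y) * rho x y ?\<phi> (vec2 \<xi>)) \<in> borel_measurable lebesgue"
      by (simp add: rho_indicator case_prod_beta')
    show "G \<in> borel_measurable lebesgue" by (rule borel_imp_lebesgue_measurable) measurable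
    show "AE x in lebesgue. (case x of (x, y) \<Rightarrow> g (x, y) * rho x y ?\<phi> (vec2 \<xi>)) = G x"
      using AE_completion[OF gh] by eventually_elim (simp add: rho_indicator case_prod_beta' G_def)
  qed
  also have "\<dots> = (LINT x|lborel. G x)" by (rule integral_completion) simp
  finally have W: "weyl g ?\<phi> (vec2 \<xi>) = (LINT x|lborel. G x)" .
  have bl: "bounded_linear (\<lambda>q. L (q * inverse quat_e))"
    by (rule bounded_linear_compose[OF L(1) bounded_linear_mult_left])
  have LG: "L (G x * inverse quat_e) = L (h x) * cis (pi * (fst x \<bullet> snd x)) * cis (2 * pi * (fst x \<bullet> vec2 \<xi>)) * indicator ?A (vec2 \<xi> + snd x)" for x
  proof -
    have "G x * inverse quat_e = indicator ?A (vec2 \<xi> + snd x) *\<^sub>R (h x * ?E x)"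
      using quat_e_neq_0 by (simp add: G_def mult.assoc)
    then show ?thesis by (simp add: L.scaleR L(2) mult_ac scaleR_conv_of_real indicator_def)
  qed
  have "L (weyl g ?\<phi> (vec2 \<xi>) * inverse quat_e) = (LINT x|lborel. L (G x * inverse quat_e))"
    unfolding W by (rule integral_bounded_linear[OF bl Gi, symmetric])
  also have "\<dots> = (LINT p|lborel. L (G (vec4 p) * inverse quat_e))"
  proof -
    have "(\<lambda>x. L (G x * inverse quat_e)) \<in> borel_measurable borel" by measurable
    from integral_distr[OF _ this, of vec4 lborel] show ?thesis by (simp add: distr_vec4)
  qed
  also have "\<dots> = (LINT p|lborel. L (h (vec4 p)) * cis (pi * (fst p \<bullet> snd p)) * cis (2 * pi * (fst p \<bullet> \<xi>)) * indicator A (\<xi> + snd p))"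
    unfolding LG
    by (intro Bochner_Integration.integral_cong refl)
      (simp add: vec4_def inner_vec_def sum_2 inner_prod_def indicator_def plus_prod_def)
  finally show ?thesis .
qed

lemma AE_coordinate_eq_0:
  fixes g h :: "(real^2) \<times> (real^2) \<Rightarrow> quat"
  assumes g: "g \<in> borel_measurable lebesgue" and h: "integrable lborel h" and gh: "AE p in lborel. g p = h p"
    and T: "T \<in> sets borel" "emeasure lborel T < \<infinity>"
    and supp: "\<And>x y. h (x, y) \<noteq> 0 \<Longrightarrow> (x $ 1, y $ 1) \<in> T"
    and fr: "finite_rank (weyl g)"
    and L: "bounded_linear L" "\<And>q z. L (q * quat_ci z) = L q * (z :: complex)"
  shows "AE p in lborel. L (h (vec4 p)) = 0"
proof -
  interpret L: bounded_linear L by (rule L)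
  have [measurable]: "L \<in> borel_measurable borel"
    by (intro borel_measurable_continuous_onI L.continuous_on continuous_on_id)
  obtain B where B: "finite B" "B \<subseteq> Lspace 2"
    and rk: "\<And>\<phi>. \<phi> \<in> Lspace 2 \<Longrightarrow> \<exists>c :: (real^2 \<Rightarrow> quat) \<Rightarrow> real. AE \<xi> in lebesgue. weyl g \<phi> \<xi> = (\<Sum>b\<in>B. c b *\<^sub>R b \<xi>)"
    using fr unfolding finite_rank_def by blast
  have "\<exists>b'\<in>borel_measurable borel. AE x in lborel. b x = b' x" if "b \<in> B" for b
    using B(2) that by (intro borel_version) (auto simp: Lspace_def)
  then obtain V where V: "\<And>b. b \<in> B \<Longrightarrow> V b \<in> borel_measurable borel" "\<And>b. b \<in> B \<Longrightarrow> AE x in lborel. b x = V b x"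
    by metis
  \<comment> \<open>Borel versions of the spanning functions, stripped of \<open>quat_e\<close> on
    the right and read in the coordinate \<open>L\<close>; real coefficients of \<open>b\<close>
    become complex coefficients of \<open>w b\<close>.\<close>
  define w where "w b \<xi> = L (V b (vec2 \<xi>) * inverse quat_e)" for b \<xi>
  \<comment> \<open>The central phase is unimodular, so absorbing it changes neither zeros nor
    integrability.\<close>
  define f where "f p = L (h (vec4 p)) * cis (pi * (fst p \<bullet> snd p))" for p
  have hv: "integrable lborel (\<lambda>p. h (vec4 p))"
  proof -
    have "integrable (distr lborel borel vec4) h" using h by (simp add: distr_vec4)
    then show ?thesis by (rule integrable_distr[rotated]) simp
  qed
  have "AE p in lborel. f p = 0"
  proof (rule finite_rank_finite_support_imp_0[of f T B w])
    show "integrable lborel f"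
      unfolding f_def using integrable_bounded_linear[OF L(1) hv] by simp
    show "(fst x, fst y) \<in> T" if "f (x, y) \<noteq> 0" for x y
    proof -
      have "h (vec4 (x, y)) \<noteq> 0" using that L.zero by (auto simp: f_def)
      from supp[OF this[unfolded vec4_def]] show ?thesis by simp
    qed
    show "w b \<in> borel_measurable borel" if "b \<in> B" for b
    proof -
      have [measurable]: "V b \<in> borel_measurable borel" using V(1)[OF that] .
      show ?thesis unfolding w_def[abs_def] by measurable
    qed
    fix A :: "plane set" assume A: "bounded A" "A \<in> sets borel"
    define A' where "A' = {\<zeta> :: real^2. (\<zeta> $ 1, \<zeta> $ 2) \<in> A}"
    define \<phi> where "\<phi> = (\<lambda>\<eta>. indicator A' \<eta> *\<^sub>R quat_e)"
    have A'm [measurable]: "A' \<in> sets borel"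
    proof -
      have "(\<lambda>\<zeta> :: real^2. (\<zeta> $ 1, \<zeta> $ 2)) -` A \<inter> space borel \<in> sets borel"
        by (rule measurable_sets[OF _ A(2)]) measurable
      then show ?thesis by (simp add: vimage_def A'_def)
    qed
    have "bounded A'"
    proof -
      have "A' \<subseteq> vec2 ` A"
      proof
        fix \<zeta> assume "\<zeta> \<in> A'"
        moreover have "\<zeta> = vec2 (\<zeta> $ 1, \<zeta> $ 2)" by (simp add: vec_eq_iff forall_2)
        ultimately show "\<zeta> \<in> vec2 ` A" by (auto simp: A'_def)
      qed
      moreover have "bounded_linear vec2"
        unfolding vec2_eq[abs_def] by (intro bounded_linear_intros bounded_linear_fst bounded_linear_snd)
      ultimately show ?thesis using bounded_linear_image[OF A(1)] bounded_subset by blast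
    qed
    have \<phi>: "\<phi> \<in> Lspace 2"
      unfolding Lspace_def
    proof (intro CollectI conjI)
      show "\<phi> \<in> borel_measurable lebesgue"
        unfolding \<phi>_def by (rule borel_imp_lebesgue_measurable) measurable
      have "integrable lborel (\<lambda>x. indicator A' x * norm quat_e powr 2)"
        using emeasure_bounded_finite[OF \<open>bounded A'\<close>]
        by (intro integrable_mult_left impI) (simp add: integrable_indicator_iff)
      then have "integrable lebesgue (\<lambda>x. indicator A' x * norm quat_e powr 2)"
        by (subst integrable_completion) auto
      also have "(\<lambda>x. indicator A' x * norm quat_e powr 2) = (\<lambda>x. norm (\<phi> x) powr 2)"
        by (auto simp: \<phi>_def indicator_def)
      finally show "integrable lebesgue (\<lambda>x. norm (\<phi> x) powr 2)" .
    qed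
    obtain c :: "(real^2 \<Rightarrow> quat) \<Rightarrow> real" where c: "AE \<xi> in lborel. weyl g \<phi> \<xi> = (\<Sum>b\<in>B. c b *\<^sub>R b \<xi>)"
      using rk[OF \<phi>] unfolding AE_lebesgue_iff by blast
    have "AE \<xi> in lborel. \<forall>b\<in>B. b \<xi> = V b \<xi>" by (intro AE_finite_allI B V(2))
    with c have "AE \<xi> in lborel. weyl g \<phi> \<xi> = (\<Sum>b\<in>B. c b *\<^sub>R V b \<xi>)"
      by eventually_elim (simp cong: sum.cong)
    then have "AE \<xi> in distr lborel borel vec2. weyl g \<phi> \<xi> = (\<Sum>b\<in>B. c b *\<^sub>R V b \<xi>)"
      by (subst distr_vec2)
    then have "AE \<xi> in lborel. weyl g \<phi> (vec2 \<xi>) = (\<Sum>b\<in>B. c b *\<^sub>R V b (vec2 \<xi>))"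
      by (rule AE_distrD[rotated]) simp
    then have "AE \<xi> in lborel. (LINT p|lborel. f p * cis (2 * pi * (fst p \<bullet> \<xi>)) * indicator A (\<xi> + snd p)) = (\<Sum>b\<in>B. of_real (c b) * w b \<xi>)"
    proof eventually_elim
      case (elim \<xi>)
      have "(LINT p|lborel. f p * cis (2 * pi * (fst p \<bullet> \<xi>)) * indicator A (\<xi> + snd p)) =
          L (weyl g \<phi> (vec2 \<xi>) * inverse quat_e)"
        unfolding f_def \<phi>_def A'_def by (rule weyl_indicator[OF g h gh A(2) L, symmetric])
      also have "\<dots> = (\<Sum>b\<in>B. of_real (c b) * w b \<xi>)"
        unfolding elim sum_distrib_right mult_scaleR_left L.sum L.scaleR w_def by (simp only: scaleR_conv_of_real)
      finally show ?case .
    qed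
    then show "\<exists>c. AE \<xi> in lborel. (LINT p|lborel. f p * cis (2 * pi * (fst p \<bullet> \<xi>)) * indicator A (\<xi> + snd p)) = (\<Sum>b\<in>B. c b * w b \<xi>)"
      by (intro exI[of _ "\<lambda>b. complex_of_real (c b)"])
  qed (use T B in auto)
  then show ?thesis by eventually_elim (simp add: f_def)
qed

theorem theorem4p2:
  fixes g :: "(real^2) \<times> (real^2) \<Rightarrow> quat" and A :: "((real^2) \<times> (real^2)) set"
  assumes "g \<in> Lspace 1"
    and "{p. g p \<noteq> 0} \<subseteq> A"
    and "\<And>x y. (x, y) \<in> A \<longleftrightarrow> (x $ 1, y $ 1) \<in> proj13 A \<and> (x $ 2, y $ 2) \<in> proj24 A"
    and "proj13 A \<in> lmeasurable" and "proj24 A \<in> lmeasurable"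
    and "finite_rank (weyl g)"
  shows "AE p in lebesgue. g p = 0"
proof -
  \<comment> \<open>The projection is Lebesgue measurable but perhaps not Borel; an open set
    exceeding it by measure less than 1 is Borel and still of finite measure.\<close>
  obtain T where T: "open T" "proj13 A \<subseteq> T" "T - proj13 A \<in> lmeasurable"
    using sets_lebesgue_outer_open[OF fmeasurableD[OF assms(4)], of 1] by auto
  have "proj13 A \<union> (T - proj13 A) \<in> lmeasurable"
    using assms(4) T(3) by (rule fmeasurable.Un)
  then have Tl: "T \<in> lmeasurable" using T(2) by (simp add: Un_absorb1)
  have Tb: "T \<in> sets borel" using T(1) by simp
  have Tf: "emeasure lborel T < \<infinity>" using Tl Tb by (simp add: fmeasurable_def)
  have "(x $ 1, y $ 1) \<in> T" if "g (x, y) \<noteq> 0" for x y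
    using that assms(2,3) T(2) by blast
  then obtain h where h: "integrable lborel h" "AE p in lborel. g p = h p"
      "\<And>x y. h (x, y) \<noteq> 0 \<Longrightarrow> (x $ 1, y $ 1) \<in> T"
    using Lspace_1_borel_version[OF assms(1) Tb] by blast
  have gm: "g \<in> borel_measurable lebesgue" using assms(1) by (simp add: Lspace_def)
  note zero = AE_coordinate_eq_0[OF gm h(1,2) Tb Tf h(3) assms(6)]
  \<comment> \<open>The complex argument runs once for each right-complex coordinate; a quaternion
    with both coordinates 0 is 0.\<close>
  have "AE p in lborel. L (h (vec4 p)) = 0" if "L = coord_a \<or> L = coord_b" for L
    using that by (intro zero) (auto simp: bounded_linear_coord coord_mult_ci)
  then have "AE p in lborel. coord_a (h (vec4 p)) = 0" "AE p in lborel. coord_b (h (vec4 p)) = 0"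
    by blast+
  then have "AE p in lborel. h (vec4 p) = 0"
    by eventually_elim (rule coord_eq_0)
  moreover have "h \<in> borel_measurable borel" using h(1) by auto
  ultimately have "AE p in distr lborel borel vec4. h p = 0"
    by (subst AE_distr_iff) auto
  then have "AE p in lborel. h p = 0" by (subst (asm) distr_vec4)
  with h(2) have "AE p in lborel. g p = 0" by eventually_elim simp
  then show ?thesis by (simp add: AE_lebesgue_iff)
qed

end
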